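(* Let $P=P(p_1,p_2,\dots,p_n)$ be a positive pretzel knot of even type, where $p_1$ is an even integer and $p_i$ is a positive odd integer for $2\le i\le n$. Let $u^{\Delta}(P)$ be its $\Delta$-unknotting number and $a_2(P)$ the second coefficient of its Conway polynomial. Then: (1) If $n$ is even and $p_1>0$, then $$u^{\Delta}(P)=\frac18\sum_{i=1}^{n}p_i^2+\frac14p_1\sum_{i=2}^{n}p_i-\frac18(n-1)\quad\bigl(=a_2(P)\bigr).$$ (2) If $n$ is odd and $p_1<0$, then $$u^{\Delta}(P)=\frac18\sum_{i=2}^{n}p_i^2-\frac14p_1\sum_{i=2}^{n}p_i-\frac18(n-1)\quad\bigl(=a_2(P)\bigr).$$
   Context: A $\Delta$-move is a local move on knot diagrams. Inside a disk, the diagram consists of three arcs, each pair crossing exactly once, bounding a small triangle, with cyclic over/under information (arc 1 passes over arc 2, arc 2 over arc 3, arc 3 over arc 1, up to relabelling). The move replaces this by the diagram with the same endpoints obtained by pushing one arc across the crossing of the other two (so the triangle is reversed, as in a Reidemeister III move), keeping the over/under information of each pair. Diagrams may also be changed by ambient isotopy (Reidemeister moves). Any two knots are related by finitely many $\Delta$-moves (Murakami–Nakanishi). The $\Delta$-Gordian distance $d_G^{\Delta}(K,K')$ is the minimum number of $\Delta$-moves needed to deform $K$ into $K'$, and the $\Delta$-unknotting number is $u^{\Delta}(K)=d_G^{\Delta}(K,O)$, with $O$ the trivial knot. The Conway polynomial $\nabla_L(z)$ is defined by $\nabla_O=1$ and $\nabla_{L_+}-\nabla_{L_-}=z\nabla_{L_0}$;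 for a knot $K$, $a_2(K)$ is the coefficient of $z^2$. The pretzel link $P(p_1,\dots,p_n)$ is obtained from $n$ vertical two-strand twisted columns (twisted bands) placed side by side, the $i$-th having $|p_i|$ half-twists (crossings) with handedness given by the sign of $p_i$, by joining adjacent columns cyclically at the top and at the bottom in the standard way. It is a knot iff exactly one $p_i$ is even, or all $p_i$ are odd and $n$ is odd. A positive pretzel knot is one whose standard diagram has all crossings positive or all crossings negative. A positive pretzel knot of even type is one of: even type A ($n$ even and positive, $p_1$ even and positive, $p_i$ odd and positive for $2\le i\le n$), or even type B ($n$ odd and positive, $p_1$ even and negative, $p_i$ odd and positive for $2\le i\le n$). Knots are not distinguished from their mirror images ($u^\Delta$ and $a_2$ are invariant under mirror image). *)

theory Defs
  imports Complex_Main "HOL-Computational_Algebra.Polynomial"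
begin

text \<open>
  Oriented link diagrams in the plane are put in Morse position with respect to height and
  read from bottom to top, one cup, cap or crossing at a time. A level between two events is
  the list of the directions of its strands from left to right, \<^term>\<open>True\<close> meaning upwards.

  An event at position \<open>i\<close> involves the strands number \<open>i\<close> and \<open>i + 1\<close>, counted from 0.
  \<open>Cup i a\<close> creates these two strands, with directions \<open>a\<close> and \<open>\<not> a\<close>; \<open>Cap i\<close> joins them.
  \<open>Cross i s\<close> is a crossing; \<open>s\<close> says that the strand running from bottom left to top right is
  the over strand.
\<close>

datatype event = Cup nat bool | Cap nat | Cross nat bool

type_synonym diagram = "event list"

fun step :: "event \<Rightarrow> bool list \<Rightarrow> bool list option" where
  "step (Cup i a) xs =
     (if i \<le> length xs then Some (take i xs @ [a, \<not> a] @ drop i xs) else None)"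
| "step (Cap i) xs =
     (if i + 1 < length xs \<and> xs ! i \<noteq> xs ! (i + 1)
      then Some (take i xs @ drop (i + 2) xs) else None)"
| "step (Cross i s) xs =
     (if i + 1 < length xs
      then Some (take i xs @ [xs ! (i + 1), xs ! i] @ drop (i + 2) xs) else None)"

fun run :: "diagram \<Rightarrow> bool list \<Rightarrow> bool list option" where
  "run [] xs = Some xs"
| "run (e # w) xs = Option.bind (step e xs) (run w)"

definition link_diagram :: "diagram \<Rightarrow> bool" where
  "link_diagram D \<longleftrightarrow> run D [] = Some []"

definition unknot :: diagram where
  "unknot = [Cup 0 True, Cap 0]"


text \<open>
  Isotopy is generated by local moves: the exchange of the heights of two distant events,
  the straightening of a strand, the Reidemeister moves, and the passage of a strand across
  a local extremum (which allows to rotate crossings). These are the usual generators of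
  isotopy of oriented link diagrams in Morse position.
\<close>

fun position :: "event \<Rightarrow> nat" where
  "position (Cup i a) = i"
| "position (Cap i) = i"
| "position (Cross i s) = i"

fun move_to :: "nat \<Rightarrow> event \<Rightarrow> event" where
  "move_to j (Cup i a) = Cup j a"
| "move_to j (Cap i) = Cap j"
| "move_to j (Cross i s) = Cross j s"

fun inputs :: "event \<Rightarrow> nat" where
  "inputs (Cup i a) = 0"
| "inputs (Cap i) = 2"
| "inputs (Cross i s) = 2"

fun outputs :: "event \<Rightarrow> nat" where
  "outputs (Cup i a) = 2"
| "outputs (Cap i) = 0"
| "outputs (Cross i s) = 2"

text \<open>
  In a word \<open>[Cross i s, Cross (i + 1) t, Cross i r]\<close> the three strands cross pairwise. If they
  are numbered 1, 2, 3 from left to right at the bottom, then 1 is over 2 iff \<open>s\<close>, 1 is over 3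
  iff \<open>t\<close>, and 2 is over 3 iff \<open>r\<close>. Hence the over/under information is cyclic iff
  \<open>r = s\<close> and \<open>t \<noteq> s\<close>: the third Reidemeister move requires that this is not so, and the
  Delta-move that it is so.
\<close>

inductive isotopy_rule :: "diagram \<Rightarrow> diagram \<Rightarrow> bool" where
  exchange: "position e + inputs e \<le> position f \<Longrightarrow>
    isotopy_rule [f, e] [e, move_to (position f - inputs e + outputs e) f]"
| straighten_right: "isotopy_rule [Cup i a, Cap (i + 1)] []"
| straighten_left: "isotopy_rule [Cup (i + 1) a, Cap i] []"
| R1_cup: "isotopy_rule [Cup i a, Cross i s] [Cup i (\<not> a)]"
| R1_cap: "isotopy_rule [Cross i s, Cap i] [Cap i]"
| R2: "isotopy_rule [Cross i s, Cross i (\<not> s)] []"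
| R3: "\<not> (r = s \<and> t \<noteq> s) \<Longrightarrow>
    isotopy_rule [Cross i s, Cross (i + 1) t, Cross i r]
                 [Cross (i + 1) r, Cross i t, Cross (i + 1) s]"
| slide_cup: "isotopy_rule [Cup i a, Cross (i + 1) s] [Cup (i + 1) a, Cross i (\<not> s)]"
| slide_cap: "isotopy_rule [Cross i s, Cap (i + 1)] [Cross (i + 1) (\<not> s), Cap i]"

inductive delta_rule :: "diagram \<Rightarrow> diagram \<Rightarrow> bool" where
  "delta_rule [Cross i s, Cross (i + 1) (\<not> s), Cross i s]
              [Cross (i + 1) s, Cross i (\<not> s), Cross (i + 1) s]"

text \<open>
  The two sides of a rule may replace each other inside a diagram if they start and end at
  the same levels, i.e. if the number and directions of the boundary strands agree.
\<close>

inductive local_move :: "(diagram \<Rightarrow> diagram \<Rightarrow> bool) \<Rightarrow> diagram \<Rightarrow> diagram \<Rightarrow> bool"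
  for R where
  "\<lbrakk>R l r \<or> R r l; run u [] = Some xs; run l xs = Some ys; run r xs = Some ys;
    run v ys = Some []\<rbrakk> \<Longrightarrow> local_move R (u @ l @ v) (u @ r @ v)"

definition isotopic :: "diagram \<Rightarrow> diagram \<Rightarrow> bool" where
  "isotopic = (local_move isotopy_rule)\<^sup>*\<^sup>*"

definition delta_move :: "diagram \<Rightarrow> diagram \<Rightarrow> bool" where
  "delta_move = local_move delta_rule"

text \<open>
  For knots the set of admissible \<open>k\<close> below is nonempty, by the theorem of Murakami and
  Nakanishi.
\<close>

definition delta_gordian_distance :: "diagram \<Rightarrow> diagram \<Rightarrow> nat" where
  "delta_gordian_distance D E =
     (LEAST k. (((isotopic OO delta_move) ^^ k) OO isotopic) D E)"

definition delta_unknotting_number :: "diagram \<Rightarrow> nat" where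
  "delta_unknotting_number D = delta_gordian_distance D unknot"


text \<open>
  A crossing of two upward strands is positive iff the strand from bottom left to top right
  is the over strand. Skein triples are taken in this standard position, in which every crossing
  can be brought by an isotopy.
\<close>

definition is_conway_polynomial :: "(diagram \<Rightarrow> int poly) \<Rightarrow> bool" where
  "is_conway_polynomial f \<longleftrightarrow>
     (\<forall>D E. link_diagram D \<and> link_diagram E \<and> isotopic D E \<longrightarrow> f D = f E) \<and>
     f unknot = 1 \<and>
     (\<forall>u v i xs. run u [] = Some xs \<and> i + 1 < length xs \<and> xs ! i \<and> xs ! (i + 1) \<and>
        link_diagram (u @ v) \<longrightarrow>
        f (u @ [Cross i True] @ v) - f (u @ [Cross i False] @ v) = [:0, 1:] * f (u @ v))"

text \<open>
  These conditions determine the value on every link diagram, so that the choice only affects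
  the irrelevant values on words which are not link diagrams.
\<close>

definition conway_polynomial :: "diagram \<Rightarrow> int poly" where
  "conway_polynomial = (SOME f. is_conway_polynomial f)"

definition a2 :: "diagram \<Rightarrow> int" where
  "a2 D = coeff (conway_polynomial D) 2"


text \<open>
  The standard diagram of the pretzel link \<open>P(p 1, \<dots>, p n)\<close> has \<open>2 * n\<close> vertical strands, of
  which the strands \<open>2 * (i - 1)\<close> and \<open>2 * (i - 1) + 1\<close> are twisted to form the \<open>i\<close>-th column.
  At the bottom and at the top, neighbouring columns are joined by small arcs, and the two
  outermost strands by a large arc. The function \<open>d\<close> gives the directions of the cups at the
  bottom: \<open>link_diagram (pretzel n p d)\<close> holds iff they are induced by an orientation of the
  pretzel link, and every orientation arises in this way.
\<close>

definition pretzel :: "nat \<Rightarrow> (nat \<Rightarrow> int) \<Rightarrow> (nat \<Rightarrow> bool) \<Rightarrow> diagram" where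
  "pretzel n p d =
     [Cup 0 (d 0)] @ map (\<lambda>k. Cup (2 * k - 1) (d k)) [1..<n] @
     concat (map (\<lambda>i. replicate (nat \<bar>p i\<bar>) (Cross (2 * (i - 1)) (p i > 0))) [1..<n + 1]) @
     map (\<lambda>k. Cap (2 * k - 1)) (rev [1..<n]) @ [Cap 0]"


text \<open>
  The rest of this theory shows that, in the even case, \<open>pretzel n p d\<close> is a link diagram for a
  suitable \<open>d\<close>. (These are knots, so this \<open>d\<close> and its opposite are the only orientations.)
  The list \<open>lev d m\<close> is the level above the first \<open>m\<close> cups.
\<close>

lemma run_append: "run (u @ v) xs = Option.bind (run u xs) (run v)"
  by (induction u arbitrary: xs) (auto split: bind_splits)

definition lev :: "(nat \<Rightarrow> bool) \<Rightarrow> nat \<Rightarrow> bool list" where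
  "lev d m = map (\<lambda>k. if k = 0 then d 0 else if k + 1 = 2 * m then \<not> d 0
      else if odd k then d ((k + 1) div 2) else \<not> d (k div 2)) [0..<2 * m]"

lemma lev_Suc: assumes "m \<ge> 1"
  shows "take (2*m-1) (lev d m) @ [d m, \<not> d m] @ drop (2*m-1) (lev d m) = lev d (Suc m)"
proof -
  have e: "[0..<2 * m] = [0..<2*m-1] @ [2*m-1]" "[0..<2 * Suc m] = [0..<2*m-1] @ [2*m-1, 2*m, 2*m+1]"
    using assms by (cases m; simp)+
  show ?thesis unfolding lev_def e using assms by (auto simp: take_map[symmetric])
qed

lemma run_cups: assumes "m \<ge> 1"
  shows "run ([Cup 0 (d 0)] @ map (\<lambda>k. Cup (2 * k - 1) (d k)) [1..<m]) [] = Some (lev d m)"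
  using assms
proof (induction m rule: dec_induct)
  case base then show ?case by (simp add: lev_def numeral_2_eq_2)
next
  case (step m)
  have "length (lev d m) = 2*m" by (simp add: lev_def)
  with step lev_Suc[of m d] show ?case by (simp add: run_append)
qed

lemma run_caps: assumes "m \<ge> 1"
  shows "run (map (\<lambda>k. Cap (2 * k - 1)) (rev [1..<m]) @ [Cap 0]) (lev d m) = Some []"
  using assms
proof (induction m rule: dec_induct)
  case base then show ?case by (simp add: lev_def numeral_2_eq_2)
next
  case (step m)
  let ?t = "take (2*m-1) (lev d m)"
  have l: "length (lev d m) = 2*m" by (simp add: lev_def)
  then have lt: "length ?t = 2*m-1" by simp
  have s: "lev d (Suc m) = ?t @ [d m, \<not> d m] @ drop (2*m-1) (lev d m)" using lev_Suc[OF step(1)] by simp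
  have c: "Defs.step (Cap j) (ys @ [a, \<not> a] @ zs) = Some (ys @ zs)" if "length ys = j" for j ys zs a
    using that by (auto simp: nth_append)
  have "Defs.step (Cap (2*m-1)) (lev d (Suc m)) = Some (lev d m)"
    unfolding s c[OF lt] by (simp del: append_take_drop_id add: append_take_drop_id)
  then show ?case using step by simp
qed

lemma step_cross: assumes "length ys = i" shows "Defs.step (Cross i s) (ys @ [a, b] @ zs) = Some (ys @ [b, a] @ zs)"
  using assms by (auto simp: nth_append)

lemma split2: assumes "i + 1 < length xs"
  shows "xs = take i xs @ [xs!i, xs!(i+1)] @ drop (i+2) xs"
  using assms by (simp add: Cons_nth_drop_Suc)

lemma run_cross_even: assumes "i + 1 < length xs" "even m"
  shows "run (replicate m (Cross i s)) xs = Some xs"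
proof -
  obtain k where m: "m = 2*k" using assms by blast
  have "run (replicate (2*k) (Cross i s)) (ys @ [a, b] @ zs) = Some (ys @ [a, b] @ zs)"
    if "length ys = i" for ys a b zs
    by (induction k) (use step_cross[OF that] in \<open>auto simp del: step.simps\<close>)
  from this[of "take i xs" "xs!i" "xs!(i+1)" "drop (i+2) xs"] split2[OF assms(1)] assms m show ?thesis by simp
qed

lemma run_cross_eq: assumes "i + 1 < length xs" "xs!i = xs!(i+1)"
  shows "run (replicate m (Cross i s)) xs = Some xs"
proof -
  have "run (replicate m (Cross i s)) (ys @ [a, a] @ zs) = Some (ys @ [a, a] @ zs)"
    if "length ys = i" for ys a zs
    by (induction m) (use step_cross[OF that] in \<open>auto simp del: step.simps\<close>)
  from this[of "take i xs" "xs!i" "drop (i+2) xs"] split2[OF assms(1)] assms show ?thesis by simp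
qed

lemma run_concat: "(\<And>i. i \<in> set is \<Longrightarrow> run (f i) xs = Some xs) \<Longrightarrow> run (concat (map f is)) xs = Some xs"
  by (induction "is") (auto simp: run_append)

lemma link_diagram_pretzel:
  assumes "n \<ge> 1" "even (p 1)" and d: "d = (\<lambda>k. if k = 0 then even n else odd k)"
  shows "link_diagram (pretzel n p d)"
proof -
  let ?c = "\<lambda>i. replicate (nat \<bar>p i\<bar>) (Cross (2 * (i - 1)) (p i > 0))"
  have "run (?c i) (lev d n) = Some (lev d n)" if "i \<in> set [1..<n+1]" for i
  proof (cases "i = 1")
    case True then show ?thesis using assms by (intro run_cross_even) (auto simp: lev_def even_nat_iff)
  next
    case False
    then have "i \<ge> 2" "i \<le> n" using that by auto
    then show ?thesis by (intro run_cross_eq) (auto simp: lev_def d; presburger)+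
  qed
  then have "run (concat (map ?c [1..<n+1])) (lev d n) = Some (lev d n)" by (rule run_concat)
  with run_cups[OF assms(1), of d] run_caps[OF assms(1), of d] show ?thesis
    unfolding link_diagram_def pretzel_def append_assoc[symmetric]
    by (simp only: append_assoc) (simp only: run_append[of "[Cup 0 (d 0)] @ map (\<lambda>k. Cup (2 * k - 1) (d k)) [1..<n]", simplified append_assoc] run_append[of "concat (map ?c [1..<n+1])"] bind.simps)
qed

end

theory Submission
  imports Defs
begin

text \<open>
  Lower bound: the two sides of a \<open>\<Delta>\<close>-move differ from those of a third Reidemeister move in one
  crossing. Applying the skein relation to this crossing, and then to one of the other two, shows
  that the move changes \<open>a\<^sub>2\<close> by a difference of two constant coefficients of Conway polynomials.
  Those are 0 or 1, so the \<open>\<Delta>\<close>-unknotting number is at least \<open>\<bar>a\<^sub>2\<bar>\<close>.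

  Upper bound: next to an outer arc of the pretzel knot a trivial hook is created, a pair of
  strands twisted around each other. The first of them is swept along the columns of odd type, lying
  over everything it meets; passing a column of \<open>2k + 1\<close> crossings takes \<open>k\<close> or \<open>k + 1\<close>
  \<open>\<Delta>\<close>-moves, depending on the side from which it comes. Back at the first column, the hook cancels two
  of its crossings. Once \<open>p\<^sub>1 = 0\<close>, the knot is a sum of torus knots of type \<open>(2, p\<^sub>i)\<close>, each of
  which is undone by \<open>(p\<^sub>i\<^sup>2 - 1) / 8\<close> moves. Altogether this uses exactly \<open>a\<^sub>2\<close> moves.

  The definition of \<open>a\<^sub>2\<close> selects any function which satisfies the skein axioms, so that one such
  function has to be exhibited. It is obtained from the vertex model of the Alexander polynomial, whose
  weights are the R-matrix of the vector representation of \<open>U\<^sub>q(gl(1|1))\<close>.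
\<close>

text \<open>The two bounds meet because the constant coefficient of the Conway polynomial is 1 for
  knots and 0 for links of several components: a Delta-move changes \<open>a2\<close> by at most 1,
  and every move of the unknotting turns out to lower it by exactly 1. Both sides of the count are
  linking numbers. Removing two crossings of the first column changes \<open>a2\<close> by the
  linking number of a link whose columns are all odd, i.e. half the number of its crossings; the
  hook pays about half of the crossings of each column it passes. If the number of odd columns is
  odd, the hook returns on the far side of the first column and has to cross it as well, which
  produces the quadratic term in \<open>p 1\<close>. A state sum is chosen for the Conway polynomial
  because its invariance is a finite check for each local rule, whereas a recursive definition by
  skein trees would require its own proof of independence from all choices. The recurrent obstacle
  is that diagrams are words: a local move is admissible only on levels with enough strands and
  suitable directions. Calculations are therefore made with relations between words that hold in
  every admissible context.\<close>

section \<open>Levels, shifted words, and the effect of the isotopy rules on levels\<close>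

definition shift :: "event \<Rightarrow> event" where "shift e = move_to (Suc (position e)) e"

lemma shift_simps [simp]:
  "shift (Cup i a) = Cup (Suc i) a" "shift (Cap i) = Cap (Suc i)" "shift (Cross i s) = Cross (Suc i) s"
  by (simp_all add: shift_def)

lemma step_shift: "step (shift e) (x # xs) = map_option ((#) x) (step e xs)"
  by (cases e) (auto simp: numeral_2_eq_2)

lemma run_shift: "run (map shift w) (x # xs) = map_option ((#) x) (run w xs)"
proof (induction w arbitrary: xs)
  case (Cons e w) then show ?case by (cases "step e xs") (auto simp: step_shift)
qed simp

lemma step_Suc_Nil:
  "step (Cup (Suc i) a) [] = None" "step (Cap i) [] = None" "step (Cross i s) [] = None"
  by simp_all

lemma run_shift_Nil: "w \<noteq> [] \<Longrightarrow> run (map shift w) [] = None"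
proof (cases w)
  case (Cons e v) then show ?thesis by (cases e) (simp_all)
qed simp

text \<open>Only an implication, since the left word can be the more restrictive one: a zigzag
  forces the direction of a strand, and two cancelling crossings need two strands.\<close>

definition fits :: "diagram \<Rightarrow> diagram \<Rightarrow> bool" where
  "fits l r \<longleftrightarrow> (\<forall>xs ys. run l xs = Some ys \<longrightarrow> run r xs = Some ys)"

lemma fits_shift: assumes "fits l r" "l \<noteq> []" shows "fits (map shift l) (map shift r)"
  unfolding fits_def
proof (intro allI impI)
  fix xs ys assume *: "run (map shift l) xs = Some ys"
  then show "run (map shift r) xs = Some ys"
  proof (cases xs)
    case Nil then show ?thesis using * run_shift_Nil assms by auto
  next
    case (Cons x zs) then show ?thesis using * assms by (auto simp: run_shift fits_def)
  qed
qed

lemma step_0 [simp]: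
  "step (Cup 0 a) xs = Some (a # (\<not> a) # xs)"
  "step (Cap 0) [] = None" "step (Cap 0) [x] = None"
  "step (Cap 0) (x # y # zs) = (if x \<noteq> y then Some zs else None)"
  "step (Cross 0 s) [] = None" "step (Cross 0 s) [x] = None"
  "step (Cross 0 s) (x # y # zs) = Some (y # x # zs)"
  by auto

lemma step_1 [simp]:
  "step (Cup (Suc 0) a) (x # xs) = Some (x # a # (\<not> a) # xs)"
  "step (Cap (Suc 0)) [x, y] = None"
  "step (Cap (Suc 0)) (x # y # z # zs) = (if y \<noteq> z then Some (x # zs) else None)"
  "step (Cross (Suc 0) s) [] = None"
  "step (Cross (Suc 0) s) [x] = None" "step (Cross (Suc 0) s) [x, y] = None"
  "step (Cross (Suc 0) s) (x # y # z # zs) = Some (x # z # y # zs)"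
  by auto

declare step.simps [simp del]

lemma step_Suc:
  "step (Cup (Suc i) a) (x # xs) = map_option ((#) x) (step (Cup i a) xs)"
  "step (Cap (Suc i)) (x # xs) = map_option ((#) x) (step (Cap i) xs)"
  "step (Cross (Suc i) s) (x # xs) = map_option ((#) x) (step (Cross i s) xs)"
  using step_shift[of "Cup i a"] step_shift[of "Cap i"] step_shift[of "Cross i s"] by simp_all

lemma list_cases3: obtains "xs = []" | x where "xs = [x]" | x y where "xs = [x,y]" | x y z zs where "xs = x # y # z # zs"
  by (metis neq_Nil_conv)

text \<open>A rule at position 0 touches at most three strands, so these four shapes of a level
  decide it; other positions follow by \<open>fits_shift\<close>.\<close>

lemma fits_check:
  assumes "\<And>ys. run l [] = Some ys \<Longrightarrow> run r [] = Some ys"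
    "\<And>x ys. run l [x] = Some ys \<Longrightarrow> run r [x] = Some ys"
    "\<And>x y ys. run l [x, y] = Some ys \<Longrightarrow> run r [x, y] = Some ys"
    "\<And>x y z zs ys. run l (x # y # z # zs) = Some ys \<Longrightarrow> run r (x # y # z # zs) = Some ys"
  shows "fits l r"
  unfolding fits_def
proof (intro allI impI)
  fix xs ys assume "run l xs = Some ys"
  then show "run r xs = Some ys"
    by (cases xs rule: list_cases3) (simp_all only: assms)
qed

lemma fits_R1_cup:
  "fits [Cup i a, Cross i s] [Cup i (\<not> a)]"
  "fits [Cup i (\<not> a)] [Cup i a, Cross i s]"
  by - (induction i, (rule fits_check; auto split: if_splits simp: step_Suc_Nil; fail), (drule fits_shift; simp))+

lemma fits_R1_cap:
  "fits [Cross i s, Cap i] [Cap i]"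
  "fits [Cap i] [Cross i s, Cap i]"
  by - (induction i, (rule fits_check; auto split: if_splits simp: step_Suc_Nil; fail), (drule fits_shift; simp))+

lemma fits_R3:
  "fits [Cross i s, Cross (Suc i) t, Cross i r] [Cross (Suc i) r', Cross i t', Cross (Suc i) s']"
  "fits [Cross (Suc i) r', Cross i t', Cross (Suc i) s'] [Cross i s, Cross (Suc i) t, Cross i r]"
  by - (induction i, (rule fits_check; auto split: if_splits simp: step_Suc_Nil; fail), (drule fits_shift; simp))+

lemma fits_slide_cup:
  "fits [Cup i a, Cross (Suc i) s] [Cup (Suc i) a, Cross i t]"
  "fits [Cup (Suc i) a, Cross i t] [Cup i a, Cross (Suc i) s]"
  by - (induction i, (rule fits_check; auto split: if_splits simp: step_Suc_Nil; fail), (drule fits_shift; simp))+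

lemma fits_slide_cap:
  "fits [Cross i s, Cap (Suc i)] [Cross (Suc i) t, Cap i]"
  "fits [Cross (Suc i) t, Cap i] [Cross i s, Cap (Suc i)]"
  by - (induction i, (rule fits_check; auto split: if_splits simp: step_Suc_Nil; fail), (drule fits_shift; simp))+

lemma fits_R2: "fits [Cross i s, Cross i t] []"
  by (induction i, (rule fits_check; auto split: if_splits simp: step_Suc_Nil; fail), (drule fits_shift; simp))

lemma fits_straighten_right: "fits [Cup i a, Cap (Suc i)] []"
  by (induction i, (rule fits_check; auto split: if_splits simp: step_Suc_Nil; fail), (drule fits_shift; simp))

lemma fits_straighten_left: "fits [Cup (Suc i) a, Cap i] []"
  by (induction i, (rule fits_check; auto split: if_splits simp: step_Suc_Nil; fail), (drule fits_shift; simp))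

lemma shift_move_to: "shift (move_to j f) = move_to (Suc j) f"
  by (cases f) simp_all

lemma position_shift: "position (shift f) = Suc (position f)"
   "inputs (shift f) = inputs f" "outputs (shift f) = outputs f" "move_to j (shift f) = move_to j f"
  by (cases f; simp)+

lemma ex_shift: "position f = Suc m \<Longrightarrow> \<exists>g. f = shift g \<and> position g = m"
  by (cases f) (metis position.simps shift_simps)+

lemma ex_shift2: assumes "2 \<le> position f" shows "\<exists>g. f = shift (shift g)"
proof -
  obtain m where "position f = Suc (Suc m)" using assms by (metis Suc_le_D numeral_2_eq_2 Suc_le_mono)
  then show ?thesis using ex_shift by metis
qed

lemma move_to_position: "move_to (position f) f = f" by (cases f) auto

text \<open>By induction on the position of \<open>e\<close>, strands to the left of both events are
  stripped off. With \<open>e\<close> at position 0, the event \<open>f\<close> is a shift past all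
  inputs of \<open>e\<close>.\<close>

lemma fits_exchange: assumes "position e + inputs e \<le> position f"
  shows "fits [f, e] [e, move_to (position f - inputs e + outputs e) f]"
  "fits [e, move_to (position f - inputs e + outputs e) f] [f, e]"
proof -
  have "fits [f, e] [e, move_to (position f - inputs e + outputs e) f] \<and>
     fits [e, move_to (position f - inputs e + outputs e) f] [f, e]"
    if "position e = n" "n + inputs e \<le> position f" for n e f
    using that
  proof (induction n arbitrary: e f)
    case 0
    show ?case
    proof (cases e)
      case (Cup i a)
      then show ?thesis using 0
        by (auto simp: fits_def step_shift shift_move_to[symmetric] move_to_position option.map_comp comp_def bind_eq_Some_conv)
    next
      case (Cap i)
      then obtain g where "f = shift (shift g)" using 0 ex_shift2[of f] by auto
      then show ?thesis using 0 Cap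
        apply (auto simp: fits_def position_shift move_to_position bind_eq_Some_conv)
        subgoal for xs ys zs by (rule list_cases3[of xs]) (auto split: if_splits simp: step_shift option.map_comp comp_def shift_simps step_Suc_Nil, (cases g; auto simp: step_Suc step_Suc_Nil)+)
        subgoal for xs ys zs by (rule list_cases3[of xs]) (auto split: if_splits simp: step_shift option.map_comp comp_def)
        done
    next
      case (Cross i a)
      then obtain g where "f = shift (shift g)" using 0 ex_shift2[of f] by auto
      then show ?thesis using 0 Cross
        apply (auto simp: fits_def position_shift  bind_eq_Some_conv shift_move_to[symmetric] numeral_2_eq_2 move_to_position)
        subgoal for xs ys zs by (rule list_cases3[of xs]) (auto split: if_splits simp: step_shift option.map_comp comp_def shift_simps step_Suc_Nil, (cases g; auto simp: step_Suc step_Suc_Nil)+)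
        subgoal for xs ys zs by (rule list_cases3[of xs]) (auto split: if_splits simp: step_shift option.map_comp comp_def)
        done
    qed
  next
    case (Suc n)
    from Suc.prems obtain e' where e: "e = shift e'" "position e' = n" using ex_shift by blast
    from Suc.prems obtain f' where f: "f = shift f'" using ex_shift[of f "position f - 1"] by fastforce
    from Suc.IH[of e' f'] Suc.prems e f have *: "fits [f', e'] [e', move_to (position f' - inputs e' + outputs e') f'] \<and>
     fits [e', move_to (position f' - inputs e' + outputs e') f'] [f', e']" by (auto simp: position_shift)
    have N: "move_to (position f - inputs e + outputs e) f = shift (move_to (position f' - inputs e' + outputs e') f')"
      using Suc.prems e f by (simp add: position_shift shift_move_to Suc_diff_le)
    have "fits (map shift [f', e']) (map shift [e', move_to (position f' - inputs e' + outputs e') f'])"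
      "fits (map shift [e', move_to (position f' - inputs e' + outputs e') f']) (map shift [f', e'])"
      using * fits_shift by blast+
    then show ?case unfolding N by (simp add: e f)
  qed
  from this[OF refl assms] show "fits [f, e] [e, move_to (position f - inputs e + outputs e) f]"
  "fits [e, move_to (position f - inputs e + outputs e) f] [f, e]" by auto
qed

lemma isotopy_rule_fits: assumes "isotopy_rule l r" shows "fits l r"
  using assms
proof cases
  case (exchange e f) then show ?thesis using fits_exchange by blast
next case (straighten_right i a) then show ?thesis by (simp add: fits_straighten_right)
next case (straighten_left i a) then show ?thesis by (simp add: fits_straighten_left)
next case (R1_cup i a s) then show ?thesis by (simp add: fits_R1_cup)
next case (R1_cap i s) then show ?thesis by (simp add: fits_R1_cap)
next case (R2 i s) then show ?thesis by (simp add: fits_R2)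
next case (R3 r s t i) then show ?thesis by (simp add: fits_R3)
next case (slide_cup i a s) then show ?thesis by (simp add: fits_slide_cup)
next case (slide_cap i s) then show ?thesis by (simp add: fits_slide_cap)
qed

section \<open>A state sum for the Conway polynomial\<close>

text \<open>
  \<open>Skein a b\<close> stands for \<open>a + b q\<close> in \<open>\<int>[z][q] / (q\<^sup>2 = z q + 1)\<close>, where \<open>q - z\<close> is the inverse of
  \<open>q\<close>. The projection \<open>re\<close> is linear over \<open>\<int>[z]\<close>; hence it preserves the skein relation, and it
  need not be shown that the state sum itself has its values in \<open>\<int>[z]\<close>.
\<close>

datatype skein = Skein (re: "int poly") (im: "int poly")

instantiation skein :: comm_ring_1
begin
definition "0 = Skein 0 0"
definition "1 = Skein 1 0"
definition "x + y = Skein (re x + re y) (im x + im y)"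
definition "x - y = Skein (re x - re y) (im x - im y)"
definition "- x = Skein (- re x) (- im x)"
definition "x * y = Skein (re x * re y + im x * im y) (re x * im y + im x * re y + [:0, 1:] * (im x * im y))"
instance
  by standard (auto simp: zero_skein_def one_skein_def plus_skein_def minus_skein_def
      uminus_skein_def times_skein_def algebra_simps)
end

definition qq :: skein where "qq = Skein 0 1"
definition pp :: skein where "pp = Skein [:0, -1:] 1"

lemma qq_pp: "qq * pp = 1" and re_skein: "re ((qq - pp) * x) = [:0, 1:] * re x"
  "re (x - y) = re x - re y" "re 1 = 1"
  by (auto simp: qq_def pp_def one_skein_def times_skein_def minus_skein_def zero_skein_def algebra_simps)

lemma qp_simps [simp]: "qq * pp = 1" "pp * qq = 1" "qq * (pp * x) = x" "pp * (qq * x) = x"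
  by (metis mult.assoc mult.commute mult_1_left qq_pp)+

text \<open>Coevaluation, and below it evaluation. The products
  \<open>cup_weight a t * cap_weight (\<not> a) t\<close> are 1, as straightening demands, while
  \<open>cup_weight a t * cap_weight a t\<close> sums to 0 over \<open>t\<close>: a circle has the
  value 0.\<close>

fun cup_weight :: "bool \<Rightarrow> bool \<Rightarrow> skein" where
  "cup_weight a t = (if a then if t then - pp else pp else 1)"

fun cap_weight :: "bool \<Rightarrow> bool \<Rightarrow> skein" where
  "cap_weight a t = (if a then 1 else if t then - qq else qq)"

text \<open>
  The states of a strand are the even one, \<^term>\<open>False\<close>, and the odd one, \<^term>\<open>True\<close>. Here \<open>x\<close>, \<open>y\<close> are
  the directions and \<open>s\<close>, \<open>t\<close> the states of the two strands below the crossing; \<open>f\<close> is the value of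
  the diagram above it.
\<close>

definition cross_sum :: "bool \<Rightarrow> bool \<Rightarrow> bool \<Rightarrow> (bool \<Rightarrow> bool \<Rightarrow> skein) \<Rightarrow> bool \<Rightarrow> bool \<Rightarrow> skein" where
  "cross_sum b x y f s t =
     (if s \<noteq> t then 1 else if s then if b = (x = y) then - pp else - qq
       else if b = (x = y) then qq else pp) * f t s +
     (if s = (b = x) \<and> (s = t) \<noteq> (x = y)
       then (if if x = y then b else \<not> s then qq - pp else pp - qq) * f (s = (x = y)) (t = (x = y)) else 0)"

text \<open>The rows with both directions upwards are the R-matrix and its inverse. The others are
  forced by turning a crossing with cups and caps.\<close>

lemma cross_sum_simps:
  "cross_sum True True True f True True = - (pp * f True True)"
  "cross_sum True True True f True False = f False True + (qq * f True False - pp * f True False)"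
  "cross_sum True True True f False True = f True False"
  "cross_sum True True True f False False = qq * f False False"
  "cross_sum True True False f True True = (pp * f False False - qq * f False False) + - (qq * f True True)"
  "cross_sum True True False f True False = f False True"
  "cross_sum True True False f False True = f True False"
  "cross_sum True True False f False False = pp * f False False"
  "cross_sum True False True f True True = - (qq * f True True)"
  "cross_sum True False True f True False = f False True"
  "cross_sum True False True f False True = f True False"
  "cross_sum True False True f False False = pp * f False False + (qq * f True True - pp * f True True)"
  "cross_sum True False False f True True = - (pp * f True True)"
  "cross_sum True False False f True False = f False True"
  "cross_sum True False False f False True = (qq * f False True - pp * f False True) + f True False"
  "cross_sum True False False f False False = qq * f False False"
  "cross_sum False True True f True True = - (qq * f True True)"
  "cross_sum False True True f True False = f False True"
  "cross_sum False True True f False True = f True False + (pp * f False True - qq * f False True)"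
  "cross_sum False True True f False False = pp * f False False"
  "cross_sum False True False f True True = - (pp * f True True)"
  "cross_sum False True False f True False = f False True"
  "cross_sum False True False f False True = f True False"
  "cross_sum False True False f False False = qq * f False False + (qq * f True True - pp * f True True)"
  "cross_sum False False True f True True = (pp * f False False - qq * f False False) + - (pp * f True True)"
  "cross_sum False False True f True False = f False True"
  "cross_sum False False True f False True = f True False"
  "cross_sum False False True f False False = qq * f False False"
  "cross_sum False False False f True True = - (qq * f True True)"
  "cross_sum False False False f True False = f False True + (pp * f True False - qq * f True False)"
  "cross_sum False False False f False True = f True False"
  "cross_sum False False False f False False = pp * f False False"
  by (simp_all add: cross_sum_def algebra_simps)

fun act :: "event \<Rightarrow> bool list \<Rightarrow> (bool list \<Rightarrow> skein) \<Rightarrow> bool list \<Rightarrow> skein" where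
  "act (Cup 0 a) xs f ss = cup_weight a False * f (False # False # ss) + cup_weight a True * f (True # True # ss)"
| "act (Cap 0) (x # y # xs) f (s # t # ss) = (if s = t then cap_weight x s * f ss else 0)"
| "act (Cross 0 b) (x # y # xs) f (s # t # ss) = cross_sum b x y (\<lambda>u v. f (u # v # ss)) s t"
| "act (Cup (Suc i) a) (x # xs) f (s # ss) = act (Cup i a) xs (\<lambda>t. f (s # t)) ss"
| "act (Cap (Suc i)) (x # xs) f (s # ss) = act (Cap i) xs (\<lambda>t. f (s # t)) ss"
| "act (Cross (Suc i) b) (x # xs) f (s # ss) = act (Cross i b) xs (\<lambda>t. f (s # t)) ss"
| "act e xs f ss = 0"

fun amp :: "diagram \<Rightarrow> bool list \<Rightarrow> (bool list \<Rightarrow> skein) \<Rightarrow> bool list \<Rightarrow> skein" where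
  "amp [] xs f = f"
| "amp (e # w) xs f = act e xs (amp w (the (step e xs)) f)"

lemma amp_append: "run u xs = Some ys \<Longrightarrow> amp (u @ v) xs f = amp u xs (amp v ys f)"
  by (induction u arbitrary: xs) (auto simp: bind_eq_Some_conv)

lemma act_shift: "act (shift e) (x # xs) f (s # ss) = act e xs (\<lambda>t. f (s # t)) ss"
  by (cases e) simp_all

lemma amp_shift: "run w xs = Some ys \<Longrightarrow> amp (map shift w) (x # xs) f (s # ss) = amp w xs (\<lambda>t. f (s # t)) ss"
proof (induction w arbitrary: xs ss f)
  case (Cons e w)
  then obtain zs where "step e xs = Some zs" "run w zs = Some ys" by (auto simp: bind_eq_Some_conv)
  with Cons.IH show ?case by (simp add: act_shift step_shift)
qed simp

lemma cross_sum_linear: "cross_sum b x y (\<lambda>u v. a * f u v + c * g u v) s t = a * cross_sum b x y f s t + c * cross_sum b x y g s t"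
  by (cases b; cases x; cases y; cases s; cases t; simp add: cross_sum_simps algebra_simps)

lemma act_linear: "act e xs (\<lambda>t. a * f t + c * g t) s = a * act e xs f s + c * act e xs g s"
  by (induction e xs f s arbitrary: g rule: act.induct) (simp_all add: cross_sum_linear, simp_all add: algebra_simps)

lemma act_cong: "step e xs = Some ys \<Longrightarrow> length s = length xs \<Longrightarrow> (\<And>t. length t = length ys \<Longrightarrow> f t = g t) \<Longrightarrow> act e xs f s = act e xs g s"
proof (induction e xs f s arbitrary: ys g rule: act.induct)
  case (4 i a x xs f s ss)
  then show ?case by (auto simp: step_Suc)
next
  case (5 i x xs f s ss)
  then show ?case by (auto simp: step_Suc)
next
  case (6 i a x xs f s ss)
  then show ?case by (auto simp: step_Suc)
qed (auto simp: step_Suc_Nil split: if_splits simp: cross_sum_def)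

lemma amp_cong: "run w xs = Some ys \<Longrightarrow> length s = length xs \<Longrightarrow> (\<And>t. length t = length ys \<Longrightarrow> f t = g t) \<Longrightarrow> amp w xs f s = amp w xs g s"
proof (induction w arbitrary: xs s)
  case (Cons e w)
  then obtain zs where "step e xs = Some zs" "run w zs = Some ys" by (auto simp: bind_eq_Some_conv)
  with Cons show ?case by (auto intro!: act_cong)
qed simp

definition same :: "diagram \<Rightarrow> diagram \<Rightarrow> bool" where
  "same l r \<longleftrightarrow> (\<forall>xs ys f s. run l xs = Some ys \<longrightarrow> length s = length xs \<longrightarrow> amp l xs f s = amp r xs f s)"

lemma same_shift: assumes "same l r" "fits l r" "l \<noteq> []" shows "same (map shift l) (map shift r)"
  unfolding same_def
proof (intro allI impI)
  fix xs ys f and s :: "bool list" assume *: "run (map shift l) xs = Some ys" "length s = length xs"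
  then obtain x zs where xs: "xs = x # zs" using run_shift_Nil assms by (cases xs) auto
  then obtain t ts where s: "s = t # ts" "length ts = length zs" using * by (cases s) auto
  obtain us where "run l zs = Some us" using * by (auto simp: xs run_shift)
  then show "amp (map shift l) xs f s = amp (map shift r) xs f s"
    using assms(1,2) s by (auto simp: xs amp_shift same_def fits_def)
qed

lemma same_check:
  assumes "run l [] = None \<or> (\<forall>f. amp l [] f [] = amp r [] f [])"
    "\<And>x s ys f. run l [x] = Some ys \<Longrightarrow> amp l [x] f [s] = amp r [x] f [s]"
    "\<And>x y s t ys f. run l [x, y] = Some ys \<Longrightarrow> amp l [x, y] f [s, t] = amp r [x, y] f [s, t]"
    "\<And>x y z zs s t u us ys f. run l (x # y # z # zs) = Some ys \<Longrightarrow>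
       amp l (x # y # z # zs) f (s # t # u # us) = amp r (x # y # z # zs) f (s # t # u # us)"
  shows "same l r"
  unfolding same_def
proof (intro allI impI)
  fix xs ys f and s :: "bool list" assume *: "run l xs = Some ys" "length s = length xs"
  show "amp l xs f s = amp r xs f s"
  proof (cases xs rule: list_cases3)
    case 1
    then show ?thesis using * assms(1) by simp
  next
    case (2 x)
    then obtain a where "s = [a]" using * by (cases s) auto
    then show ?thesis using 2 * assms(2) by blast
  next
    case (3 x y)
    then obtain a b where "s = [a, b]" using * by (cases s rule: list_cases3) auto
    then show ?thesis using 3 * assms(3) by blast
  next
    case (4 x y z zs)
    then obtain a b c d where "s = a # b # c # d" using * by (cases s rule: list_cases3) auto
    then show ?thesis using 4 * assms(4) by blast
  qed
qed

lemma same_R1_cup: "same [Cup i a, Cross i s] [Cup i (\<not> a)]"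
  by (induction i, (rule same_check; cases a; cases s; auto split: if_splits simp: cross_sum_def algebra_simps; fail),
    (drule same_shift[OF _ fits_R1_cup(1)]; simp))

lemma same_R1_cap: "same [Cross i s, Cap i] [Cap i]"
  by (induction i, (rule same_check; cases s; auto split: if_splits simp: cross_sum_def algebra_simps; fail),
    (drule same_shift[OF _ fits_R1_cap(1)]; simp))

lemma same_R2: "same [Cross i s, Cross i (\<not> s)] []"
  by (induction i, (rule same_check; cases s; auto split: if_splits simp: cross_sum_def algebra_simps; fail),
    (drule same_shift[OF _ fits_R2]; simp))

lemma same_straighten_right: "same [Cup i a, Cap (Suc i)] []"
  by (induction i, (rule same_check; cases a; auto split: if_splits simp: cross_sum_def algebra_simps; fail),
    (drule same_shift[OF _ fits_straighten_right]; simp))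

lemma same_straighten_left: "same [Cup (Suc i) a, Cap i] []"
  by (induction i, (rule same_check; cases a; auto split: if_splits simp: cross_sum_def algebra_simps step_Suc_Nil; fail),
    (drule same_shift[OF _ fits_straighten_left]; simp))

lemma same_slide_cup: "same [Cup i a, Cross (Suc i) s] [Cup (Suc i) a, Cross i (\<not> s)]"
  by (induction i, (rule same_check; cases a; cases s; auto split: if_splits simp: cross_sum_def algebra_simps; fail),
    (drule same_shift[OF _ fits_slide_cup(1)]; simp))

lemma same_slide_cap: "same [Cross i s, Cap (Suc i)] [Cross (Suc i) (\<not> s), Cap i]"
proof (induction i)
  case 0
  show ?case
  proof (rule same_check)
    fix x y z zs a b c us ys f assume "run [Cross 0 s, Cap (Suc 0)] (x # y # z # zs) = Some ys"
    then have "x \<noteq> z" by (auto split: if_splits)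
    then show "amp [Cross 0 s, Cap (Suc 0)] (x # y # z # zs) f (a # b # c # us) =
       amp [Cross (Suc 0) (\<not> s), Cap 0] (x # y # z # zs) f (a # b # c # us)"
      by (cases s; cases x; cases y; cases z; cases a; cases b; cases c; simp add: cross_sum_simps; simp add: algebra_simps)
  qed auto
next
  case (Suc i) then show ?case using same_shift[OF Suc fits_slide_cap(1)] by simp
qed

lemma same_R3: assumes "\<not> (r = s \<and> t \<noteq> s)"
  shows "same [Cross i s, Cross (Suc i) t, Cross i r] [Cross (Suc i) r, Cross i t, Cross (Suc i) s]"
proof (induction i)
  case 0
  show ?case
  proof (rule same_check)
    fix x y z zs a b c us ys f
    show "amp [Cross 0 s, Cross (Suc 0) t, Cross 0 r] (x # y # z # zs) f (a # b # c # us) =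
       amp [Cross (Suc 0) r, Cross 0 t, Cross (Suc 0) s] (x # y # z # zs) f (a # b # c # us)"
      using assms
      by (cases s; cases t; cases r; cases x; cases y; cases z; cases a; cases b; cases c; simp add: cross_sum_simps; simp add: algebra_simps)
  qed auto
next
  case (Suc i) then show ?case using same_shift[OF Suc fits_R3(1)] by simp
qed

text \<open>For fixed states below, at most two states occur above. A crossing is thus a linear
  combination of two values of \<open>f\<close> and commutes with every linear operation on the
  other strands.\<close>

lemma cross_sum_form: "\<exists>a c u v. \<forall>f. cross_sum b x y f s t = a * f t s + c * f u v"
  unfolding cross_sum_def
  by (intro exI[of _ "if s \<noteq> t then 1 else if s then if b = (x = y) then - pp else - qq else if b = (x = y) then qq else pp"]
       exI[of _ "if s = (b = x) \<and> (s = t) \<noteq> (x = y)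
         then if if x = y then b else \<not> s then qq - pp else pp - qq else 0"]
       exI[of _ "s = (x = y)"] exI[of _ "t = (x = y)"]) (simp split del: if_split, auto)

lemma act_cross_sum:
  "act e xs (\<lambda>r. cross_sum b x y (\<lambda>u v. f u v r) s t) ss = cross_sum b x y (\<lambda>u v. act e xs (f u v) ss) s t"
proof -
  obtain a c u v where *: "\<And>f. cross_sum b x y f s t = a * f t s + c * f u v"
    using cross_sum_form by blast
  show ?thesis by (simp add: * act_linear)
qed

lemma act_scale: "act e xs (\<lambda>t. a * f t) s = a * act e xs f s"
  using act_linear[of e xs a f 0 f] by simp

lemma act_minus: "act e xs (\<lambda>t. - f t) s = - act e xs f s"
  using act_scale[of e xs "-1"] by simp

lemma act_0: "act e xs (\<lambda>t. 0) s = 0"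
  using act_scale[of e xs 0] by simp

lemma same_exchange: assumes "position e + inputs e \<le> position f"
  shows "same [f, e] [e, move_to (position f - inputs e + outputs e) f]"
proof -
  have "same [f, e] [e, move_to (position f - inputs e + outputs e) f]"
    if "position e = n" "n + inputs e \<le> position f" for n e f
    using that
  proof (induction n arbitrary: e f)
    case 0
    show ?case
    proof (cases e)
      case (Cup i a)
      then have "e = Cup 0 a" "move_to (position f - inputs e + outputs e) f = shift (shift f)"
        using 0 by (auto simp: shift_move_to shift_def[of f] numeral_2_eq_2)
      moreover have "act (Cup 0 a) xs h = (\<lambda>s. cup_weight a False * h (False # False # s) +
          cup_weight a True * h (True # True # s))" for xs h by auto
      ultimately show ?thesis
        by (auto simp: same_def bind_eq_Some_conv act_shift act_linear simp del: cup_weight.simps)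
    next
      case (Cap i)
      then obtain g where "f = shift (shift g)" using 0 ex_shift2[of f] by auto
      then have g: "e = Cap 0" "f = shift (shift g)" "move_to (position f - inputs e + outputs e) f = g"
        using 0 Cap by (auto simp: position_shift move_to_position)
      show ?thesis unfolding same_def
      proof (intro allI impI)
        fix xs ys h and s :: "bool list" assume *: "run [f, e] xs = Some ys" "length s = length xs"
        then obtain x y zs where xs: "xs = x # y # zs"
          using g run_shift_Nil[of "[shift g]"] run_shift_Nil[of "[g]"]
          by (cases xs rule: list_cases3) (auto simp: bind_eq_Some_conv step_shift)
        obtain a b r where "s = a # b # r" using * xs by (cases s rule: list_cases3) auto
        with * xs g show "amp [f, e] xs h s = amp [e, move_to (position f - inputs e + outputs e) f] xs h s"
          by (auto simp: step_shift act_shift act_scale act_minus act_0 bind_eq_Some_conv split: if_splits)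
      qed
    next
      case (Cross i c)
      then obtain g where "f = shift (shift g)" using 0 ex_shift2[of f] by auto
      then have g: "e = Cross 0 c" "f = shift (shift g)" "move_to (position f - inputs e + outputs e) f = f"
        using 0 Cross move_to_position[of f] by (auto simp: position_shift)
      show ?thesis unfolding same_def
      proof (intro allI impI)
        fix xs ys h and s :: "bool list" assume *: "run [f, e] xs = Some ys" "length s = length xs"
        then obtain x y zs where xs: "xs = x # y # zs"
          using g run_shift_Nil[of "[shift g]"] run_shift_Nil[of "[g]"]
          by (cases xs rule: list_cases3) (auto simp: bind_eq_Some_conv step_shift)
        obtain a b r where "s = a # b # r" using * xs by (cases s rule: list_cases3) auto
        with * xs g show "amp [f, e] xs h s = amp [e, move_to (position f - inputs e + outputs e) f] xs h s"
          by (auto simp: step_shift act_shift act_cross_sum bind_eq_Some_conv)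
      qed
    qed
  next
    case (Suc n)
    from Suc.prems obtain e' where e: "e = shift e'" "position e' = n" using ex_shift by blast
    from Suc.prems obtain f' where f: "f = shift f'" using ex_shift[of f "position f - 1"] by fastforce
    have le: "position e' + inputs e' \<le> position f'" using Suc.prems e f by (auto simp: position_shift)
    then have *: "same [f', e'] [e', move_to (position f' - inputs e' + outputs e') f']"
      using Suc.IH e(2) by auto
    have N: "move_to (position f - inputs e + outputs e) f = shift (move_to (position f' - inputs e' + outputs e') f')"
      using Suc.prems e f by (simp add: position_shift shift_move_to Suc_diff_le)
    have "same (map shift [f', e']) (map shift [e', move_to (position f' - inputs e' + outputs e') f'])"
      by (rule same_shift[OF * fits_exchange(1)[OF le]]) simp
    then show ?case unfolding N by (simp add: e f)
  qed
  from this[OF refl assms] show ?thesis .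
qed

lemma isotopy_rule_same: assumes "isotopy_rule l r" shows "same l r"
  using assms
proof cases
  case (exchange e f) then show ?thesis using same_exchange by blast
next case (straighten_right i a) then show ?thesis by (simp add: same_straighten_right)
next case (straighten_left i a) then show ?thesis by (simp add: same_straighten_left)
next case (R1_cup i a s) then show ?thesis by (simp add: same_R1_cup)
next case (R1_cap i s) then show ?thesis by (simp add: same_R1_cap)
next case (R2 i s) then show ?thesis by (simp add: same_R2)
next case (R3 r s t i) then show ?thesis by (simp add: same_R3)
next case (slide_cup i a s) then show ?thesis by (simp add: same_slide_cup)
next case (slide_cap i s) then show ?thesis by (simp add: same_slide_cap)
qed

text \<open>
  The odd generators of \<open>U\<^sub>q(gl(1|1))\<close>. They commute with all events and vanish on the empty level, so
  they annihilate the values of a diagram which is closed at the top.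
\<close>

fun gen :: "bool \<Rightarrow> bool list \<Rightarrow> (bool list \<Rightarrow> skein) \<Rightarrow> bool list \<Rightarrow> skein" where
  "gen g (x # xs) f (s # ss) =
     (if (s = x) = g then 0 else (if x then 1 else if g then - qq else qq) * f ((\<not> s) # ss)) +
     (if x then if s then - pp else pp else if s then - qq else qq) * gen g xs (\<lambda>t. f (s # t)) ss"
| "gen g xs f ss = 0"

lemma gen_linear: "gen g xs (\<lambda>t. a * f t + c * h t) s = a * gen g xs f s + c * gen g xs h s"
  by (induction g xs f s arbitrary: h rule: gen.induct) (simp_all, simp add: algebra_simps)

lemma gen_scale: "gen g xs (\<lambda>t. a * f t) s = a * gen g xs f s"
  using gen_linear[of g xs a f 0 f] by simp

lemma gen_minus: "gen g xs (\<lambda>t. - f t) s = - gen g xs f s"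
  using gen_scale[of g xs "-1"] by simp

lemma gen_0: "gen g xs (\<lambda>t. 0) s = 0"
  using gen_scale[of g xs 0] by simp

lemma gen_cross_sum:
  "gen g xs (\<lambda>r. cross_sum b x y (\<lambda>u v. f u v r) s t) ss = cross_sum b x y (\<lambda>u v. gen g xs (f u v) ss) s t"
proof -
  obtain a c u v where *: "\<And>f. cross_sum b x y f s t = a * f t s + c * f u v"
    using cross_sum_form by blast
  show ?thesis by (simp add: * gen_linear)
qed

lemma gen_act: assumes "step e xs = Some ys" "length s = length xs"
  shows "gen g xs (act e xs f) s = act e xs (gen g ys f) s"
proof -
  have "gen g xs (act e xs f) s = act e xs (gen g ys f) s" if "position e = n" "step e xs = Some ys" "length s = length xs" for n e xs ys s f
    using that
  proof (induction n arbitrary: e xs ys s f)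
    case 0
    show ?case
    proof (cases e)
      case (Cup i a)
      have "act (Cup 0 a) xs h = (\<lambda>s. cup_weight a False * h (False # False # s) +
          cup_weight a True * h (True # True # s))" for xs h by auto
      with 0 Cup have "gen g xs (act e xs f) s = cup_weight a False * gen g xs (\<lambda>t. f (False # False # t)) s +
          cup_weight a True * gen g xs (\<lambda>t. f (True # True # t)) s" by (simp add: gen_linear del: cup_weight.simps)
      also have "... = act e xs (gen g ys f) s"
      proof -
        have ys: "ys = a # (\<not> a) # xs" and e: "e = Cup 0 a" using 0 Cup by auto
        show ?thesis unfolding ys e by (cases a; cases g; simp; simp add: algebra_simps)
      qed
      finally show ?thesis .
    next
      case (Cap i)
      with 0 obtain x y where x: "xs = x # y # ys" "x \<noteq> y" "e = Cap 0" by (cases xs rule: list_cases3) (auto split: if_splits)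
      then obtain a b r where s: "s = a # b # r" using 0 by (cases s rule: list_cases3) auto
      show ?thesis unfolding x(1,3) s using x(2)
        by (cases x; cases y; cases a; cases b; cases g; simp add: gen_0 gen_scale gen_minus; simp add: algebra_simps)
    next
      case (Cross i c)
      with 0 obtain x y zs where x: "xs = x # y # zs" "e = Cross 0 c" "ys = y # x # zs" by (cases xs rule: list_cases3) (auto split: if_splits)
      then obtain a b r where s: "s = a # b # r" using 0 by (cases s rule: list_cases3) auto
      show ?thesis unfolding x s
        by (cases x; cases y; cases a; cases b; cases g; cases c; simp add: gen_cross_sum; simp add: cross_sum_simps; simp add: algebra_simps)
    qed
  next
    case (Suc n)
    from Suc.prems obtain e' where e: "e = shift e'" "position e' = n" using ex_shift by blast
    from Suc.prems e obtain x xs' where xs: "xs = x # xs'" using run_shift_Nil[of "[e']"] by (cases xs) auto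
    then obtain a s' where s: "s = a # s'" "length s' = length xs'" using Suc.prems by (cases s) auto
    obtain ys' where ys: "step e' xs' = Some ys'" "ys = x # ys'"
      using Suc.prems by (auto simp: e xs step_shift)
    have IH: "gen g xs' (act e' xs' h) s' = act e' xs' (gen g ys' h) s'" for h
      using Suc.IH[OF e(2) ys(1) s(2)] .
    show ?case
      by (auto simp: e xs s(1) ys(2) act_shift IH act_linear act_scale)
  qed
  from this[OF refl assms] show ?thesis .
qed

lemma gen_amp: assumes "run w xs = Some ys" "length s = length xs"
  shows "gen g xs (amp w xs f) s = amp w xs (gen g ys f) s"
  using assms
proof (induction w arbitrary: xs s)
  case (Cons e w)
  then obtain zs where zs: "step e xs = Some zs" "run w zs = Some ys" by (auto simp: bind_eq_Some_conv)
  show ?case using zs gen_act[OF zs(1) Cons.prems(2)] Cons.IH[OF zs(2)] Cons.prems(2)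
    by (auto intro: act_cong)
qed simp

lemma amp_0: "amp w xs (\<lambda>t. 0) = (\<lambda>t. 0)"
  by (induction w arbitrary: xs) (auto simp: act_0)

lemma gen_closed: "run w xs = Some [] \<Longrightarrow> length s = length xs \<Longrightarrow> gen g xs (amp w xs f) s = 0"
proof -
  have "gen g [] f = (\<lambda>t. 0)" by auto
  then show "run w xs = Some [] \<Longrightarrow> length s = length xs \<Longrightarrow> ?thesis"
    by (simp add: gen_amp amp_0)
qed

text \<open>
  The state sum of a link diagram is 0, as the representation has superdimension 0. Therefore
  \<open>cut\<close> opens the diagram at its first cup, whose strands get the state \<^term>\<open>False\<close>. That another
  choice of the first cup gives the same value follows from the relations given by \<^term>\<open>gen\<close>.
\<close>

definition unit_weight :: "bool \<Rightarrow> skein" where "unit_weight a = (if a then 1 else pp)"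

definition closed_amp :: "diagram \<Rightarrow> bool list \<Rightarrow> bool list \<Rightarrow> skein" where
  "closed_amp w xs = amp w xs (\<lambda>t. 1)"

lemma closed_amp_gen: "run w xs = Some [] \<Longrightarrow> length s = length xs \<Longrightarrow> gen g xs (closed_amp w xs) s = 0"
  unfolding closed_amp_def by (rule gen_closed)

text \<open>A generator applied at a state with a single odd strand flips either of the two strands,
  which relates the two states of equal parity.\<close>

lemma closed_amp_pair: assumes "run v [b, \<not> b] = Some []"
  shows "closed_amp v [b, \<not> b] [True, True] = (if b then 1 else - 1) * closed_amp v [b, \<not> b] [False, False]"
proof (cases b)
  case True
  with closed_amp_gen[OF assms, of "[False, True]" True] show ?thesis by simp
next
  case False
  with closed_amp_gen[OF assms, of "[True, False]" True]
  have "pp * (qq * closed_amp v [False, True] [True, True]) = pp * (- (qq * closed_amp v [False, True] [False, False]))"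
    by simp
  with False show ?thesis by (simp del: mult_minus_right add: mult_minus_right[symmetric])
qed

text \<open>The crossing may bring in the odd state of the strands of the first cup;
  \<open>closed_amp_pair\<close> reduces it to the even one.\<close>

lemma cut_R1: assumes "run v [\<not> a, a] = Some []"
  shows "unit_weight a * closed_amp (Cross 0 s # v) [a, \<not> a] [False, False] =
    unit_weight (\<not> a) * closed_amp v [\<not> a, a] [False, False]"
  using closed_amp_pair[of v "\<not> a"] assms
  by (cases a; cases s) (simp_all add: closed_amp_def unit_weight_def cross_sum_simps algebra_simps)

lemma cut_exchange: assumes "run v [a, \<not> a, b, \<not> b] = Some []"
  shows "unit_weight b * closed_amp (Cup 0 a # v) [b, \<not> b] [False, False] =
    unit_weight a * closed_amp (Cup 2 b # v) [a, \<not> a] [False, False]"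
proof -
  let ?f = "closed_amp v [a, \<not> a, b, \<not> b]"
  have *: "closed_amp (Cup 0 a # v) [b, \<not> b] [False, False] = cup_weight a False * ?f [False, False, False, False] +
       cup_weight a True * ?f [True, True, False, False]"
    "closed_amp (Cup 2 b # v) [a, \<not> a] [False, False] = cup_weight b False * ?f [False, False, False, False] +
       cup_weight b True * ?f [False, False, True, True]"
    by (simp_all add: closed_amp_def numeral_2_eq_2 step_Suc)
  \<comment> \<open>The two relations are chosen such that the states with one odd strand in each
    cup, which occur in both of them, cancel; the states in which just one cup is odd
    remain.\<close>
  have "unit_weight b * (cup_weight a False * ?f [False, False, False, False] + cup_weight a True * ?f [True, True, False, False])
      - unit_weight a * (cup_weight b False * ?f [False, False, False, False] + cup_weight b True * ?f [False, False, True, True])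
    = pp * unit_weight a * gen True [a, \<not> a, b, \<not> b] ?f [False, False, \<not> b, b] +
      pp * unit_weight b * gen False [a, \<not> a, b, \<not> b] ?f [a, \<not> a, False, False]"
    by (cases a; cases b; simp add: unit_weight_def; simp add: algebra_simps)
  then show ?thesis unfolding * by (simp add: closed_amp_gen assms del: cup_weight.simps gen.simps)
qed

fun cut :: "diagram \<Rightarrow> skein" where
  "cut (Cup i a # w) = unit_weight a * closed_amp w [a, \<not> a] [False, False]"
| "cut w = 0"

lemma cut_local: assumes "same l r" "fits l r" "run u [] = Some xs" "run l xs = Some ys" "run v ys = Some []" "u \<noteq> []"
  shows "cut (u @ l @ v) = cut (u @ r @ v)"
proof -
  obtain e u' where u: "u = e # u'" using assms(6) by (cases u) auto
  obtain i a where e: "e = Cup i a" using assms(3) u by (cases e) (auto simp: step_Suc_Nil)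
  have i: "i = 0" using assms(3) u e by (cases i) (auto simp: step_Suc_Nil)
  have u': "run u' [a, \<not> a] = Some xs" using assms(3) u e i by auto
  have r: "run r xs = Some ys" using assms by (auto simp: fits_def)
  have "amp (l @ v) xs f s = amp (r @ v) xs f s" if "length s = length xs" for f s
    using assms that r by (simp add: amp_append same_def)
  then have "amp (u' @ l @ v) [a, \<not> a] f [False, False] = amp (u' @ r @ v) [a, \<not> a] f [False, False]" for f
    unfolding amp_append[OF u'] by (intro amp_cong[OF u']) auto
  then show ?thesis by (simp add: u e closed_amp_def)
qed

text \<open>On the empty level only the exchange of two cups and the curl at a cup are applicable,
  and these are the rules that alter the cup at which the diagram is opened.\<close>

lemma cut_start: assumes "isotopy_rule l r" "run l [] = Some ys" "run r [] = Some ys" "run v ys = Some []"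
  shows "cut (l @ v) = cut (r @ v)"
  using assms(1)
proof cases
  case (exchange e f)
  from exchange assms(2) obtain i b where f: "f = Cup i b" by (cases f) (auto simp: step_Suc_Nil)
  have i: "i = 0" using assms(2) exchange f by (cases i) (auto simp: step_Suc_Nil)
  then obtain a where e: "e = Cup 0 a" using exchange f by (cases e) auto
  have "run v [a, \<not> a, b, \<not> b] = Some []" using assms exchange f e i by auto
  from cut_exchange[OF this] show ?thesis by (simp add: exchange f e i numeral_2_eq_2)
next case (straighten_right i a) then show ?thesis using assms(2) by (cases i) (auto simp: step_Suc_Nil)
next case (straighten_left i a) then show ?thesis using assms(2) by (auto simp: step_Suc_Nil)
next case (R1_cup i a s)
  then have "i = 0" using assms(2) by (cases i) (auto simp: step_Suc_Nil)
  then show ?thesis using cut_R1[of v a s] R1_cup assms by simp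
next case (R1_cap i s) then show ?thesis using assms(2) by (auto simp: step_Suc_Nil)
next case (R2 i s) then show ?thesis using assms(2) by (auto simp: step_Suc_Nil)
next case (R3 r s t i) then show ?thesis using assms(2) by (auto simp: step_Suc_Nil)
next case (slide_cup i a s) then show ?thesis using assms(2) by (cases i) (auto simp: step_Suc_Nil)
next case (slide_cap i s) then show ?thesis using assms(2) by (auto simp: step_Suc_Nil)
qed

lemma cut_local_move: assumes "local_move isotopy_rule D E" shows "cut D = cut E"
  using assms
proof cases
  case (1 l r u xs ys v)
  have *: "cut (u @ l @ v) = cut (u @ r @ v)" if "isotopy_rule l r" "run l xs = Some ys" "run r xs = Some ys" for l r
  proof (cases "u = []")
    case True with that 1 show ?thesis using cut_start by auto
  next
    case False with that 1 show ?thesis using cut_local isotopy_rule_same isotopy_rule_fits by blast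
  qed
  from 1 *[of l r] *[of r l] show ?thesis by auto
qed

lemma cut_isotopic: "isotopic D E \<Longrightarrow> cut D = cut E"
  unfolding isotopic_def by (induction rule: rtranclp_induct) (auto dest: cut_local_move)

section \<open>The skein relation for the state sum\<close>

lemma amp_linear: "amp w xs (\<lambda>t. a * f t + c * g t) s = a * amp w xs f s + c * amp w xs g s"
proof (induction w arbitrary: xs s)
  case (Cons e w)
  have "amp w ys (\<lambda>t. a * f t + c * g t) = (\<lambda>s. a * amp w ys f s + c * amp w ys g s)" for ys
    using Cons by auto
  then show ?case by (simp add: act_linear)
qed simp

text \<open>The R-matrix and its inverse differ by \<open>qq - pp\<close> times the identity, and
  \<open>qq - pp\<close> is the variable z.\<close>

lemma act_skein: assumes "i + 1 < length xs" "xs ! i" "xs ! (i + 1)" "length s = length xs"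
  shows "act (Cross i True) xs f s = act (Cross i False) xs f s + (qq - pp) * f s"
  using assms
proof (induction i arbitrary: xs s f)
  case 0
  then obtain x y zs where xs: "xs = x # y # zs" by (cases xs rule: list_cases3) auto
  then obtain a b r where s: "s = a # b # r" using 0 by (cases s rule: list_cases3) auto
  show ?case using 0 by (cases a; cases b) (auto simp: xs s cross_sum_simps algebra_simps)
next
  case (Suc i)
  then obtain x zs where xs: "xs = x # zs" by (cases xs) auto
  then obtain a r where s: "s = a # r" using Suc by (cases s) auto
  show ?case using Suc by (auto simp: xs s)
qed

lemma step_parallel: assumes "i + 1 < length xs" "xs ! i = xs ! (i + 1)"
  shows "step (Cross i s) xs = Some xs"
  using assms
proof (induction i arbitrary: xs)
  case 0 then show ?case by (cases xs rule: list_cases3) auto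
next
  case (Suc i)
  then show ?case by (cases xs) (auto simp: step_Suc)
qed

lemma cut_skein: assumes "run u [] = Some xs" "i + 1 < length xs" "xs ! i" "xs ! (i + 1)"
  shows "cut (u @ Cross i True # v) = cut (u @ Cross i False # v) + (qq - pp) * cut (u @ v)"
proof -
  obtain e u' where u: "u = e # u'" using assms by (cases u) auto
  obtain j a where e: "e = Cup j a" using assms u by (cases e) (auto simp: step_Suc_Nil)
  have i: "j = 0" using assms u e by (cases j) (auto simp: step_Suc_Nil)
  have u': "run u' [a, \<not> a] = Some xs" using assms u e i by auto
  have "amp (Cross i True # v) xs f s = 1 * amp (Cross i False # v) xs f s + (qq - pp) * amp v xs f s"
     if "length s = length xs" for f s
    using step_parallel[of i xs] assms(2-4) act_skein[OF assms(2-4) that] by simp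
  then have "amp (u' @ Cross i True # v) [a, \<not> a] f [False, False] =
     amp u' [a, \<not> a] (\<lambda>s. 1 * amp (Cross i False # v) xs f s + (qq - pp) * amp v xs f s) [False, False]" for f
    unfolding amp_append[OF u'] by (intro amp_cong[OF u']) auto
  also have "... f = amp (u' @ Cross i False # v) [a, \<not> a] f [False, False] +
       (qq - pp) * amp (u' @ v) [a, \<not> a] f [False, False]" for f
    unfolding amp_append[OF u'] amp_linear by simp
  finally have *: "amp (u' @ Cross i True # v) [a, \<not> a] f [False, False] =
      amp (u' @ Cross i False # v) [a, \<not> a] f [False, False] + (qq - pp) * amp (u' @ v) [a, \<not> a] f [False, False]" for f .
  show ?thesis by (simp add: u e closed_amp_def * distrib_left mult.left_commute)
qed

theorem conway_polynomial_exists: "is_conway_polynomial (\<lambda>D. re (cut D))"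
  unfolding is_conway_polynomial_def
proof (intro conjI allI impI; (elim conjE)?)
  show "re (cut unknot) = 1" by (simp add: unknot_def unit_weight_def closed_amp_def re_skein)
next
  fix D E assume "isotopic D E" then show "re (cut D) = re (cut E)" using cut_isotopic by metis
next
  fix u v i xs
  assume *: "run u [] = Some xs" "i + 1 < length xs" "xs ! i" "xs ! (i + 1)"
  show "re (cut (u @ [Cross i True] @ v)) - re (cut (u @ [Cross i False] @ v)) = [:0, 1:] * re (cut (u @ v))"
    using cut_skein[OF *, of v] re_skein(1)[of "cut (u @ v)"]
      re_skein(2)[of "cut (u @ Cross i True # v)" "cut (u @ Cross i False # v)"] by simp
qed

abbreviation (input) SS :: "nat \<Rightarrow> nat" where "SS i \<equiv> Suc (Suc i)"
abbreviation (input) X :: "nat \<Rightarrow> event" where "X i \<equiv> Cross i True"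
abbreviation (input) Y :: "nat \<Rightarrow> event" where "Y i \<equiv> Cross i False"

section \<open>Tangles up to Delta-moves\<close>

definition ddist :: "nat \<Rightarrow> diagram \<Rightarrow> diagram \<Rightarrow> bool" where
  "ddist k = ((isotopic OO delta_move) ^^ k) OO isotopic"

lemma isotopic_refl [simp]: "isotopic D D"
  and isotopic_trans: "isotopic D E \<Longrightarrow> isotopic E F \<Longrightarrow> isotopic D F"
  by (auto simp: isotopic_def)

lemma local_move_sym: "local_move R D E \<Longrightarrow> local_move R E D"
  by (induction rule: local_move.induct) (metis local_move.intros)

lemma isotopic_sym: "isotopic D E \<Longrightarrow> isotopic E D"
  unfolding isotopic_def
  by (induction rule: rtranclp_induct) (auto intro: converse_rtranclp_into_rtranclp local_move_sym)

lemma ddist_0: "ddist 0 = isotopic" by (auto simp: ddist_def fun_eq_iff OO_def)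

lemma ddist_Suc: "ddist (Suc k) D E \<longleftrightarrow> (\<exists>F G. isotopic D F \<and> delta_move F G \<and> ddist k G E)"
proof -
  have "(isotopic OO delta_move) ^^ Suc k = (isotopic OO delta_move) OO ((isotopic OO delta_move) ^^ k)"
    by (metis relpowp.simps(2) relpowp_commute)
  then show ?thesis unfolding ddist_def by auto
qed

lemma ddist_isotopic: "isotopic D E \<Longrightarrow> ddist k E F \<Longrightarrow> ddist k D F"
  by (cases k) (auto simp: ddist_0 ddist_Suc intro: isotopic_trans)

lemma ddist_trans: "ddist j D E \<Longrightarrow> ddist k E F \<Longrightarrow> ddist (j + k) D F"
proof (induction j arbitrary: D)
  case 0 then show ?case by (simp add: ddist_0 ddist_isotopic)
next
  case (Suc j) then show ?case by (fastforce simp: ddist_Suc)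
qed

lemma ddist_1: "delta_move D E \<Longrightarrow> ddist 1 D E"
  by (simp add: ddist_Suc ddist_0) (use isotopic_refl in blast)

lemma delta_move_sym: "delta_move D E \<Longrightarrow> delta_move E D"
  unfolding delta_move_def by (rule local_move_sym)

lemma ddist_sym: "ddist k D E \<Longrightarrow> ddist k E D"
proof (induction k arbitrary: D)
  case 0 then show ?case by (simp add: ddist_0 isotopic_sym)
next
  case (Suc k)
  then obtain F G where *: "isotopic D F" "delta_move F G" "ddist k G E" by (auto simp: ddist_Suc)
  have "ddist 1 G D" using ddist_trans[OF ddist_1[OF delta_move_sym[OF *(2)]], of 0 D] *(1) by (simp add: ddist_0 isotopic_sym)
  from ddist_trans[OF Suc.IH[OF *(3)] this] show ?case by simp
qed

text \<open>
  Words which are exchanged by a move need not be applicable to the same levels: \<open>[Cross i s, Cross i (\<not> s)]\<close>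
  fails if there are not enough strands, and \<open>[Cup i a, Cap (i + 1)]\<close> forces the direction of a strand.
  In the first case it suffices to bound the number of strands from below by \<open>n\<close>, as in \<open>teq n\<close>; the one-sided
  relation \<open>deq\<close> also admits the second case.
\<close>

definition tangle_rel :: "nat \<Rightarrow> (diagram \<Rightarrow> diagram \<Rightarrow> bool) \<Rightarrow> diagram \<Rightarrow> diagram \<Rightarrow> bool" where
  "tangle_rel n R l r \<longleftrightarrow> (\<forall>u v xs. run u [] = Some xs \<longrightarrow> n \<le> length xs \<longrightarrow>
     (link_diagram (u @ l @ v) \<longleftrightarrow> link_diagram (u @ r @ v)) \<and>
     (link_diagram (u @ l @ v) \<longrightarrow> R (u @ l @ v) (u @ r @ v)))"

abbreviation teq :: "nat \<Rightarrow> nat \<Rightarrow> diagram \<Rightarrow> diagram \<Rightarrow> bool" where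
  "teq n k \<equiv> tangle_rel n (ddist k)"

definition deq :: "nat \<Rightarrow> diagram \<Rightarrow> diagram \<Rightarrow> bool" where
  "deq k l r \<longleftrightarrow> (\<forall>u v. link_diagram (u @ l @ v) \<longrightarrow>
     link_diagram (u @ r @ v) \<and> ddist k (u @ l @ v) (u @ r @ v))"

lemma link_diagram_append: "link_diagram (u @ v) \<longleftrightarrow> (\<exists>xs. run u [] = Some xs \<and> run v xs = Some [])"
  by (auto simp: link_diagram_def run_append bind_eq_Some_conv)

lemma teq_refl: "teq n 0 l l" by (simp add: ddist_0 tangle_rel_def)

lemma teq_sym: "teq n k l r \<Longrightarrow> teq n k r l"
  unfolding tangle_rel_def using ddist_sym by blast

lemma teq_trans [trans]: "teq n j l m \<Longrightarrow> teq n k m r \<Longrightarrow> teq n (j + k) l r"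
  unfolding tangle_rel_def using ddist_trans by blast

lemma teq_trans0 [trans]: "teq n 0 l m \<Longrightarrow> teq n k m r \<Longrightarrow> teq n k l r"
  using teq_trans by fastforce

lemma teq_trans1 [trans]: "teq n k l m \<Longrightarrow> teq n 0 m r \<Longrightarrow> teq n k l r"
  using teq_trans by fastforce

lemma teq_mono: "tangle_rel m R l r \<Longrightarrow> m \<le> n \<Longrightarrow> tangle_rel n R l r"
  unfolding tangle_rel_def using le_trans by blast

lemma teq_append_right: "tangle_rel n R l r \<Longrightarrow> tangle_rel n R (l @ w) (r @ w)"
  unfolding tangle_rel_def by simp

lemma teq_append_left:
  assumes "tangle_rel m R l r" "\<And>xs ys. run w xs = Some ys \<Longrightarrow> n \<le> length xs \<Longrightarrow> m \<le> length ys"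
  shows "tangle_rel n R (w @ l) (w @ r)"
  unfolding tangle_rel_def
proof (intro allI impI)
  fix u v xs assume *: "run u [] = Some xs" "n \<le> length xs"
  show "(link_diagram (u @ (w @ l) @ v) \<longleftrightarrow> link_diagram (u @ (w @ r) @ v)) \<and>
     (link_diagram (u @ (w @ l) @ v) \<longrightarrow> R (u @ (w @ l) @ v) (u @ (w @ r) @ v))"
  proof (cases "run w xs")
    case None
    then have "run (u @ w) [] = None" using * by (simp add: run_append)
    then show ?thesis using link_diagram_append[of "u @ w"] by auto
  next
    case (Some ys)
    then have "run (u @ w) [] = Some ys" "m \<le> length ys" using * assms(2) by (auto simp: run_append)
    then show ?thesis using assms(1) unfolding tangle_rel_def by (metis append_assoc)
  qed
qed

lemma length_step: "step e xs = Some ys \<Longrightarrow> length ys + inputs e = length xs + outputs e"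
  by (cases e) (auto simp: step.simps split: if_splits)

lemma teq_Cross: "tangle_rel n R l r \<Longrightarrow> tangle_rel n R (Cross i s # l) (Cross i s # r)"
  using teq_append_left[of n R l r "[Cross i s]" n] length_step[of "Cross i s"] by (force simp: bind_eq_Some_conv)

lemma teq_Cup: "tangle_rel (SS n) R l r \<Longrightarrow> tangle_rel n R (Cup i a # l) (Cup i a # r)"
  using teq_append_left[of "SS n" R l r "[Cup i a]" n] length_step[of "Cup i a"] by (force simp: bind_eq_Some_conv)

lemma teq_Cap: "tangle_rel (n - 2) R l r \<Longrightarrow> tangle_rel n R (Cap i # l) (Cap i # r)"
  using teq_append_left[of "n - 2" R l r "[Cap i]" n] length_step[of "Cap i"] by (force simp: bind_eq_Some_conv)

lemma deq_trans [trans]: "deq j l m \<Longrightarrow> deq k m r \<Longrightarrow> deq (j + k) l r"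
  unfolding deq_def using ddist_trans by blast

lemma deq_trans0 [trans]: "deq 0 l m \<Longrightarrow> deq k m r \<Longrightarrow> deq k l r"
  using deq_trans by fastforce

lemma deq_trans1 [trans]: "deq k l m \<Longrightarrow> deq 0 m r \<Longrightarrow> deq k l r"
  using deq_trans by fastforce

lemma deq_context: "deq k l r \<Longrightarrow> deq k (u @ l @ v) (u @ r @ v)"
  unfolding deq_def by (metis append_assoc)

lemma deq_append_right: "deq k l r \<Longrightarrow> deq k (l @ v) (r @ v)"
  using deq_context[of k l r "[]" v] by simp

lemma deq_append_left: "deq k l r \<Longrightarrow> deq k (u @ l) (u @ r)"
  using deq_context[of k l r u "[]"] by simp

lemma deq_Cons: "deq k l r \<Longrightarrow> deq k (e # l) (e # r)"
  using deq_append_left[of k l r "[e]"] by simp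

lemma deq_refl: "deq 0 l l" by (simp add: ddist_0 deq_def)

lemma teq_deq: assumes "teq n k l r" "\<And>xs ys. run l xs = Some ys \<Longrightarrow> n \<le> length xs" shows "deq k l r"
  unfolding deq_def
proof (intro allI impI)
  fix u v assume *: "link_diagram (u @ l @ v)"
  then obtain xs ys where "run u [] = Some xs" "run l xs = Some ys"
    by (auto simp: link_diagram_def run_append bind_eq_Some_conv)
  with assms * show "link_diagram (u @ r @ v) \<and> ddist k (u @ l @ v) (u @ r @ v)" unfolding tangle_rel_def by blast
qed

lemma teq_deq0: "teq 0 k l r \<Longrightarrow> deq k l r" by (rule teq_deq) auto

lemma isotopy_rule_ddist:
  assumes "isotopy_rule l r" "run u [] = Some xs" "run l xs = Some ys" "run r xs = Some ys" "run v ys = Some []"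
  shows "ddist 0 (u @ l @ v) (u @ r @ v)"
proof -
  have "local_move isotopy_rule (u @ l @ v) (u @ r @ v)"
    by (rule local_move.intros[OF disjI1]) fact+
  then show ?thesis unfolding ddist_0 isotopic_def by (rule r_into_rtranclp)
qed

lemma deq_rule: assumes "isotopy_rule l r" shows "deq 0 l r"
  unfolding deq_def
proof (intro allI impI)
  fix u v assume *: "link_diagram (u @ l @ v)"
  then obtain xs ys where 1: "run u [] = Some xs" "run l xs = Some ys" "run v ys = Some []"
    by (auto simp: link_diagram_def run_append bind_eq_Some_conv)
  then have 2: "run r xs = Some ys" using isotopy_rule_fits[OF assms] by (auto simp: fits_def)
  then have "ddist 0 (u @ l @ v) (u @ r @ v)" using isotopy_rule_ddist[OF assms] 1 by blast
  then show "link_diagram (u @ r @ v) \<and> ddist 0 (u @ l @ v) (u @ r @ v)"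
    using 1 2 by (simp add: link_diagram_def run_append)
qed

lemma teq_local:
  assumes "\<And>xs ys. n \<le> length xs \<Longrightarrow> run l xs = Some ys \<longleftrightarrow> run r xs = Some ys"
    "\<And>u v xs ys. run u [] = Some xs \<Longrightarrow> run l xs = Some ys \<Longrightarrow> run r xs = Some ys \<Longrightarrow>
       run v ys = Some [] \<Longrightarrow> R (u @ l @ v) (u @ r @ v)"
  shows "tangle_rel n R l r"
  unfolding tangle_rel_def
proof (intro allI impI)
  fix u v xs assume *: "run u [] = Some xs" "n \<le> length xs"
  have "run l xs = run r xs" using assms(1)[OF *(2)] by (metis not_None_eq)
  with * show "(link_diagram (u @ l @ v) \<longleftrightarrow> link_diagram (u @ r @ v)) \<and>
     (link_diagram (u @ l @ v) \<longrightarrow> R (u @ l @ v) (u @ r @ v))"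
    using assms(2)[OF *(1), of _ v] by (auto simp: link_diagram_def run_append bind_eq_Some_conv)
qed

lemma teq_rule: assumes "isotopy_rule l r" "fits r l" shows "teq n 0 l r"
proof (rule teq_local)
  show "run l xs = Some ys \<longleftrightarrow> run r xs = Some ys" for xs ys
    using assms(2) isotopy_rule_fits[OF assms(1)] unfolding fits_def by blast
qed (rule isotopy_rule_ddist[OF assms(1)])

lemma teq_rule_append: "isotopy_rule l r \<Longrightarrow> fits r l \<Longrightarrow> teq n 0 (l @ v) (r @ v)"
  by (intro teq_append_right teq_rule)

lemma teq_R1_cup: "teq n 0 (Cup i a # Cross i s # v) (Cup i (\<not> a) # v)"
  using teq_rule_append[OF isotopy_rule.R1_cup fits_R1_cup(2)] by simp

lemma teq_R1_cap: "teq n 0 (Cross i s # Cap i # v) (Cap i # v)"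
  using teq_rule_append[OF isotopy_rule.R1_cap fits_R1_cap(2)] by simp

lemma teq_R3: "\<not> (r = s \<and> t \<noteq> s) \<Longrightarrow>
   teq n 0 (Cross i s # Cross (Suc i) t # Cross i r # v) (Cross (Suc i) r # Cross i t # Cross (Suc i) s # v)"
  using teq_rule_append[OF isotopy_rule.R3[of r s t i, folded Suc_eq_plus1] fits_R3(2)[of i], of n v] by simp

lemma teq_slide_cup: "teq n 0 (Cup i a # Cross (Suc i) s # v) (Cup (Suc i) a # Cross i (\<not> s) # v)"
  using teq_rule_append[OF isotopy_rule.slide_cup[of i a s, folded Suc_eq_plus1] fits_slide_cup(2)[of i], of n v] by simp

lemma teq_slide_cap: "teq n 0 (Cross i s # Cap (Suc i) # v) (Cross (Suc i) (\<not> s) # Cap i # v)"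
  using teq_rule_append[OF isotopy_rule.slide_cap[of i s, folded Suc_eq_plus1] fits_slide_cap(2)[of i], of n v] by simp

lemma teq_exchange: "position e + inputs e \<le> position f \<Longrightarrow>
    teq n 0 (f # e # v) (e # move_to (position f - inputs e + outputs e) f # v)"
  using teq_rule_append[OF isotopy_rule.exchange[of e f] fits_exchange(2)[of e f], of n v] by simp

lemma step_Cross_long: "SS i \<le> length xs \<Longrightarrow> step (Cross i s) xs = Some (take i xs @ [xs ! (i + 1), xs ! i] @ drop (i + 2) xs)"
  by (simp add: step.simps)

lemma teq_R2: assumes "SS i \<le> n" shows "teq n 0 (Cross i s # Cross i (\<not> s) # v) v"
proof -
  have "teq n 0 [Cross i s, Cross i (\<not> s)] []"
  proof (rule teq_local)
    fix xs ys :: "bool list" assume n: "n \<le> length xs"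
    have "length (take i xs @ [xs ! (i + 1), xs ! i] @ drop (i + 2) xs) = length xs" using assms n by simp
    then have "\<exists>ys. run [Cross i s, Cross i (\<not> s)] xs = Some ys"
      using assms n by (simp add: step_Cross_long del: append_Cons)
    then show "run [Cross i s, Cross i (\<not> s)] xs = Some ys \<longleftrightarrow> run [] xs = Some ys"
      using fits_R2[of i s "\<not> s"] unfolding fits_def by (metis option.inject)
  qed (rule isotopy_rule_ddist[OF isotopy_rule.R2])
  from teq_append_right[OF this, of v] show ?thesis by simp
qed

lemma teq_R2_gen: "SS i \<le> n \<Longrightarrow> t \<noteq> s \<Longrightarrow> teq n 0 (Cross i s # Cross i t # v) v"
  using teq_R2[of i n s v] by (cases t; cases s) auto

lemma teq_Delta: "t = (\<not> s) \<Longrightarrow>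
   teq n 1 (Cross i s # Cross (Suc i) t # Cross i s # v) (Cross (Suc i) s # Cross i t # Cross (Suc i) s # v)"
proof -
  have "teq n 1 [Cross i s, Cross (Suc i) (\<not> s), Cross i s] [Cross (Suc i) s, Cross i (\<not> s), Cross (Suc i) s]"
  proof (rule teq_local)
    show "run [Cross i s, Cross (Suc i) (\<not> s), Cross i s] xs = Some ys \<longleftrightarrow>
       run [Cross (Suc i) s, Cross i (\<not> s), Cross (Suc i) s] xs = Some ys" for xs ys
      using fits_R3[of i] unfolding fits_def by blast
  next
    fix u v xs ys
    assume "run u [] = Some xs" "run [Cross i s, Cross (Suc i) (\<not> s), Cross i s] xs = Some ys"
      "run [Cross (Suc i) s, Cross i (\<not> s), Cross (Suc i) s] xs = Some ys" "run v ys = Some []"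
    then have "delta_move (u @ [Cross i s, Cross (Suc i) (\<not> s), Cross i s] @ v)
         (u @ [Cross (Suc i) s, Cross i (\<not> s), Cross (Suc i) s] @ v)"
      unfolding delta_move_def using delta_rule.intros[of i s] local_move.intros[of delta_rule] by (metis Suc_eq_plus1)
    then show "ddist 1 (u @ [Cross i s, Cross (Suc i) (\<not> s), Cross i s] @ v)
         (u @ [Cross (Suc i) s, Cross i (\<not> s), Cross (Suc i) s] @ v)"
      by (rule ddist_1)
  qed
  from teq_append_right[OF this, of v] show "t = (\<not> s) \<Longrightarrow> ?thesis" by simp
qed

lemma deq_straighten_right: "deq 0 (Cup i a # Cap (Suc i) # v) v"
  using deq_append_right[OF deq_rule[OF isotopy_rule.straighten_right[of i a, folded Suc_eq_plus1]], of v] by simp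

lemma deq_straighten_left: "deq 0 (Cup (Suc i) a # Cap i # v) v"
  using deq_append_right[OF deq_rule[OF isotopy_rule.straighten_left[of i a, folded Suc_eq_plus1]], of v] by simp

lemma slide_cup: "t \<noteq> s \<Longrightarrow> teq n 0 (Cup i a # Cross (Suc i) s # v) (Cup (Suc i) a # Cross i t # v)"
  using teq_slide_cup[of n i a s v] by (cases t; cases s) auto

lemma slide_cap: "t \<noteq> s \<Longrightarrow> teq n 0 (Cross i s # Cap (Suc i) # v) (Cross (Suc i) t # Cap i # v)"
  using teq_slide_cap[of n i s v] by (cases t; cases s) auto

lemma R1_cup: "b \<noteq> a \<Longrightarrow> teq n 0 (Cup i a # Cross i s # v) (Cup i b # v)"
  using teq_R1_cup[of n i a s v] by (cases a; cases b) auto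

lemma far_Cross_Cross: "SS i \<le> j \<Longrightarrow> teq n 0 (Cross j t # Cross i s # v) (Cross i s # Cross j t # v)"
  using teq_exchange[of "Cross i s" "Cross j t" n v]
  by (subgoal_tac "SS (j - 2) = j") auto

lemma far_Cup_Cross: "SS i \<le> j \<Longrightarrow> teq n 0 (Cup j a # Cross i s # v) (Cross i s # Cup j a # v)"
  using teq_exchange[of "Cross i s" "Cup j a" n v]
  by (subgoal_tac "SS (j - 2) = j") auto

lemma far_Cap_Cross: "SS i \<le> j \<Longrightarrow> teq n 0 (Cap j # Cross i s # v) (Cross i s # Cap j # v)"
  using teq_exchange[of "Cross i s" "Cap j" n v]
  by (subgoal_tac "SS (j - 2) = j") auto

lemma far_Cross_Cup: "i \<le> j \<Longrightarrow> teq n 0 (Cross j s # Cup i a # v) (Cup i a # Cross (SS j) s # v)"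
  using teq_exchange[of "Cup i a" "Cross j s" n v] by simp

lemma far_Cup_Cup: "i \<le> j \<Longrightarrow> teq n 0 (Cup j b # Cup i a # v) (Cup i a # Cup (SS j) b # v)"
  using teq_exchange[of "Cup i a" "Cup j b" n v] by simp

lemma far_Cap_Cup: "i \<le> j \<Longrightarrow> teq n 0 (Cap j # Cup i a # v) (Cup i a # Cap (SS j) # v)"
  using teq_exchange[of "Cup i a" "Cap j" n v] by simp

lemma far_Cross_Cap: "i \<le> j \<Longrightarrow> teq n 0 (Cross (SS j) s # Cap i # v) (Cap i # Cross j s # v)"
  using teq_exchange[of "Cap i" "Cross (SS j) s" n v] by simp

lemma far_Cup_Cap: "i \<le> j \<Longrightarrow> teq n 0 (Cup (SS j) a # Cap i # v) (Cap i # Cup j a # v)"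
  using teq_exchange[of "Cap i" "Cup (SS j) a" n v] by simp

lemma far_Cap_Cap: "i \<le> j \<Longrightarrow> teq n 0 (Cap (SS j) # Cap i # v) (Cap i # Cap j # v)"
  using teq_exchange[of "Cap i" "Cap (SS j)" n v] by simp

lemmas moves = slide_cup slide_cap R1_cup teq_R1_cap teq_R3 teq_R2_gen
  far_Cross_Cross far_Cup_Cross far_Cap_Cross far_Cross_Cup far_Cup_Cup far_Cap_Cup
  far_Cross_Cap far_Cup_Cap far_Cap_Cap

text \<open>Each link of the following calculations is one planar move, found by unification in
  either direction.\<close>

lemmas mv = moves moves[THEN teq_sym]

section \<open>Twisted columns\<close>

abbreviation (input) rep :: "nat \<Rightarrow> event \<Rightarrow> diagram" where "rep \<equiv> replicate"

text \<open>Two crossings of the same sign \<open>s\<close> make one strand pass entirely over or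
  entirely under the twisted pair, so every third Reidemeister move is admissible whatever
  \<open>t\<close> is.\<close>

lemma braid_slide_up: "teq n 0 (Cross (Suc i) s # Cross i s # rep k (Cross (Suc i) t) @ v)
   (rep k (Cross i t) @ Cross (Suc i) s # Cross i s # v)"
proof (induction k)
  case (Suc k)
  have "teq n 0 (Cross (Suc i) s # Cross i s # Cross (Suc i) t # rep k (Cross (Suc i) t) @ v)
    (Cross i t # Cross (Suc i) s # Cross i s # rep k (Cross (Suc i) t) @ v)"
    by (rule mv; auto; fail)
  also have "teq n 0 ... (Cross i t # rep k (Cross i t) @ Cross (Suc i) s # Cross i s # v)"
    by (rule teq_Cross[OF Suc])
  finally show ?case by simp
qed (simp add: teq_refl)

lemma braid_slide_down: "teq n 0 (Cross i s # Cross (Suc i) s # rep k (Cross i t) @ v)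
   (rep k (Cross (Suc i) t) @ Cross i s # Cross (Suc i) s # v)"
proof (induction k)
  case (Suc k)
  have "teq n 0 (Cross i s # Cross (Suc i) s # Cross i t # rep k (Cross i t) @ v)
    (Cross (Suc i) t # Cross i s # Cross (Suc i) s # rep k (Cross i t) @ v)"
    by (rule mv; auto; fail)
  also have "teq n 0 ... (Cross (Suc i) t # rep k (Cross (Suc i) t) @ Cross i s # Cross (Suc i) s # v)"
    by (rule teq_Cross[OF Suc])
  finally show ?case by simp
qed (simp add: teq_refl)

lemma teq_rep: "tangle_rel n R l r \<Longrightarrow> tangle_rel n R (rep j (Cross i s) @ l) (rep j (Cross i s) @ r)"
  by (induction j) (auto intro: teq_Cross)

lemma conj_power: assumes "s' \<noteq> s"
  shows "teq (SS (Suc i)) 0 (Cross i s # rep k (Cross (Suc i) t) @ Cross i s' # v)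
    (Cross (Suc i) s' # rep k (Cross i t) @ Cross (Suc i) s # v)"
proof -
  have "teq (SS (Suc i)) 0 (Cross i s # rep k (Cross (Suc i) t) @ Cross i s' # v)
     (Cross (Suc i) s' # Cross (Suc i) s # Cross i s # rep k (Cross (Suc i) t) @ Cross i s' # v)"
    by (rule mv; auto simp: assms assms[symmetric]; fail)
  also have "teq (SS (Suc i)) 0 ...
     (Cross (Suc i) s' # rep k (Cross i t) @ Cross (Suc i) s # Cross i s # Cross i s' # v)"
    by (rule teq_Cross braid_slide_up)+
  also have "teq (SS (Suc i)) 0 ... (Cross (Suc i) s' # rep k (Cross i t) @ Cross (Suc i) s # v)"
    by ((rule teq_R2_gen; auto simp: assms; fail) | rule teq_Cross teq_rep)+
  finally show ?thesis .
qed

text \<open>The strand \<open>i + 2\<close> reaches past the strand \<open>i + 1\<close> to be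
  hooked to the strand \<open>i\<close>. One move carries this hook from one side of the strand
  \<open>i + 1\<close> to the other.\<close>

lemma conj_Delta1: "s' \<noteq> s \<Longrightarrow> teq (SS (Suc i)) 1
    (Cross (Suc i) s # Cross i s # Cross i s # Cross (Suc i) s' # v)
    (Cross (Suc i) s' # Cross i s # Cross i s # Cross (Suc i) s # v)"
proof -
  assume s: "s' \<noteq> s"
  let ?n = "SS (Suc i)" and ?a = "Cross i s" and ?b = "Cross (Suc i) s" and ?A = "Cross i s'" and ?B = "Cross (Suc i) s'"
  have "teq ?n 0 (?b # ?a # ?a # ?B # v) (?b # ?a # ?a # ?B # ?a # ?A # v)"
    by ((rule mv; auto simp: s; fail) | rule teq_Cross)+
  also have "teq ?n 1 ... (?b # ?a # ?b # ?A # ?b # ?A # v)"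
    by (intro teq_Cross teq_Delta) (use s in auto)
  also have "teq ?n 0 ... (?a # ?b # ?a # ?A # ?b # ?A # v)"
    by ((rule mv; auto simp: s; fail) | rule teq_Cross)+
  also have "teq ?n 0 ... (?a # ?b # ?b # ?A # v)"
    by ((rule mv; auto simp: s s[symmetric]; fail) | rule teq_Cross)+
  also have "teq ?n 0 ... (?B # ?a # ?a # ?b # v)"
    using conj_power[OF s, of i 2 s v] by (simp add: numeral_2_eq_2)
  finally show "teq ?n 1 (?b # ?a # ?a # ?B # v) (?B # ?a # ?a # ?b # v)" by simp
qed

lemma conj_Delta: "u' \<noteq> u \<Longrightarrow> teq (SS (Suc i)) 1
    (Cross (Suc i) u # Cross i s # Cross i s # Cross (Suc i) u' # v)
    (Cross (Suc i) u' # Cross i s # Cross i s # Cross (Suc i) u # v)"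
  using conj_Delta1[of u' s i v] teq_sym[OF conj_Delta1[of u s i v]] by (cases "u = s"; cases "u' = s") auto

text \<open>Full twists of overlapping pairs commute at the price of one move: conjugating
  \<open>a a\<close> by \<open>b\<close> or by its inverse differs by \<open>conj_Delta\<close>.
  This is the source of all further counts.\<close>

lemma comm_Delta: "teq (SS (Suc i)) 1
    (Cross i s # Cross i s # Cross (Suc i) t # Cross (Suc i) t # v)
    (Cross (Suc i) t # Cross (Suc i) t # Cross i s # Cross i s # v)"
proof -
  let ?n = "SS (Suc i)" and ?a = "Cross i s" and ?b = "Cross (Suc i) t" and ?B = "Cross (Suc i) (\<not> t)"
  have "teq ?n 0 (?a # ?a # ?b # ?b # v) (?b # ?B # ?a # ?a # ?b # ?b # v)"
    by ((rule mv; auto; fail) | rule teq_Cross)+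
  also have "teq ?n 1 ... (?b # ?b # ?a # ?a # ?B # ?b # v)"
    by (intro teq_Cross conj_Delta) auto
  also have "teq ?n 0 ... (?b # ?b # ?a # ?a # v)"
    by ((rule mv; auto; fail) | rule teq_Cross)+
  finally show ?thesis by simp
qed

lemma comm_Delta_power: "teq (SS (Suc i)) k
    (Cross i s # Cross i s # rep (2 * k) (Cross (Suc i) t) @ v)
    (rep (2 * k) (Cross (Suc i) t) @ Cross i s # Cross i s # v)"
proof (induction k)
  case (Suc k)
  let ?n = "SS (Suc i)" and ?a = "Cross i s" and ?b = "Cross (Suc i) t"
  have "teq ?n 1 (?a # ?a # ?b # ?b # rep (2 * k) ?b @ v) (?b # ?b # ?a # ?a # rep (2 * k) ?b @ v)"
    by (rule comm_Delta)
  also have "teq ?n k ... (?b # ?b # rep (2 * k) ?b @ ?a # ?a # v)"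
    by (intro teq_Cross Suc)
  finally show ?case by simp
qed (simp add: teq_refl)

lemma comm_Delta_power': "teq (SS (Suc i)) k
    (Cross (Suc i) s # Cross (Suc i) s # rep (2 * k) (Cross i t) @ v)
    (rep (2 * k) (Cross i t) @ Cross (Suc i) s # Cross (Suc i) s # v)"
proof (induction k)
  case (Suc k)
  let ?n = "SS (Suc i)" and ?a = "Cross i t" and ?b = "Cross (Suc i) s"
  have "teq ?n 1 (?b # ?b # ?a # ?a # rep (2 * k) ?a @ v) (?a # ?a # ?b # ?b # rep (2 * k) ?a @ v)"
    by (rule teq_sym[OF comm_Delta])
  also have "teq ?n k ... (?a # ?a # rep (2 * k) ?a @ ?b # ?b # v)"
    by (intro teq_Cross Suc)
  finally show ?case by simp
qed (simp add: teq_refl)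

lemma rep_snoc: "rep k e @ e # v = e # rep k e @ v"
  by (induction k) auto

text \<open>The first and the last crossing slide around the cup and the cap. One Delta-move then
  allows the rest to be rewritten with crossings of the other pair, except for a full twist
  \<open>?B # ?B\<close>; this passes the \<open>2 * r\<close> crossings in \<open>r\<close> moves
  and untwists at the cap.\<close>

lemma left_loop_step: "teq (Suc i) (Suc r)
    (Cup i c # rep (2 * r + 3) (Cross (Suc i) s) @ Cap i # v)
    (Cup (Suc i) (\<not> c) # rep (2 * r + 1) (Cross i s) @ Cap (Suc i) # v)"
proof -
  define s' where "s' = (\<not> s)"
  have s: "s' \<noteq> s" "s \<noteq> s'" "s = (\<not> s')" by (auto simp: s'_def)
  let ?n = "Suc i" and ?a = "Cross i s" and ?b = "Cross (Suc i) s" and ?A = "Cross i s'" and ?B = "Cross (Suc i) s'"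
  have e: "rep (2 * r + 3) ?b @ Cap i # v = ?b # ?b # rep (2 * r) ?b @ ?b # Cap i # v"
    by (simp add: rep_snoc numeral_3_eq_3)
  have "teq ?n 0 (Cup i c # ?b # ?b # rep (2 * r) ?b @ ?b # Cap i # v)
      (Cup (Suc i) c # ?A # ?b # rep (2 * r) ?b @ ?b # Cap i # v)"
    by (rule slide_cup) (use s in auto)
  also have "teq ?n 0 ... (Cup (Suc i) c # ?A # ?b # rep (2 * r) ?b @ ?A # Cap (Suc i) # v)"
    by ((rule mv; auto simp: s'_def; fail) | rule teq_Cross teq_Cup teq_rep)+
  also have "teq ?n 0 ... (Cup (Suc i) c # ?A # ?b # ?A # ?a # rep (2 * r) ?b @ ?A # Cap (Suc i) # v)"
    by ((rule mv; auto simp: s'_def; fail) | rule teq_Cross teq_Cup teq_rep)+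
  also have "teq ?n 1 ... (Cup (Suc i) c # ?B # ?a # ?B # ?a # rep (2 * r) ?b @ ?A # Cap (Suc i) # v)"
    by (intro teq_Cup teq_Delta) (rule s)
  also have "teq ?n 0 ... (Cup (Suc i) c # ?B # ?a # ?B # ?B # rep (2 * r) ?a @ ?b # Cap (Suc i) # v)"
    by (intro teq_Cross teq_Cup conj_power s)
  also have "teq ?n 0 ... (Cup (Suc i) (\<not> c) # ?a # ?B # ?B # rep (2 * r) ?a @ ?b # Cap (Suc i) # v)"
    by (rule mv; auto; fail)
  also have "teq ?n 0 ... (Cup (Suc i) (\<not> c) # ?a # ?B # ?B # rep (2 * r) ?a @ Cap (Suc i) # v)"
    by ((rule mv; auto simp: s'_def; fail) | rule teq_Cross teq_Cup teq_rep)+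
  also have "teq ?n r ... (Cup (Suc i) (\<not> c) # ?a # rep (2 * r) ?a @ ?B # ?B # Cap (Suc i) # v)"
    by (intro teq_Cross teq_Cup comm_Delta_power')
  also have "teq ?n 0 ... (Cup (Suc i) (\<not> c) # ?a # rep (2 * r) ?a @ ?B # Cap (Suc i) # v)"
    by ((rule mv; auto simp: s'_def; fail) | rule teq_Cross teq_Cup teq_rep)+
  also have "teq ?n 0 ... (Cup (Suc i) (\<not> c) # ?a # rep (2 * r) ?a @ Cap (Suc i) # v)"
    by ((rule mv; auto simp: s'_def; fail) | rule teq_Cross teq_Cup teq_rep)+
  finally show ?thesis unfolding e by simp
qed

text \<open>Half a turn of the whole loop about the vertical strand: conjugation by two crossings
  moves the twists to the other pair, and the crossings introduced for this become curls at the cup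
  and the cap or cancel.\<close>

lemma loop_flip: "teq (Suc i) 0 (Cup (Suc i) (\<not> c) # rep m (Cross i s) @ Cap (Suc i) # v)
    (Cup i c # rep m (Cross (Suc i) s) @ Cap i # v)"
proof -
  let ?n = "Suc i" and ?a = "X i" and ?b = "X (Suc i)" and ?A = "Y i" and ?B = "Y (Suc i)"
  let ?y = "Cross i s" and ?z = "Cross (Suc i) s"
  have "teq ?n 0 (Cup (Suc i) (\<not> c) # rep m ?y @ Cap (Suc i) # v)
     (Cup (Suc i) (\<not> c) # rep m ?y @ ?b # ?B # Cap (Suc i) # v)"
    by ((rule mv; auto; fail) | rule teq_Cross teq_Cup teq_rep)+
  also have "teq ?n 0 ... (Cup (Suc i) (\<not> c) # rep m ?y @ ?b # ?a # ?A # ?B # Cap (Suc i) # v)"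
    by ((rule mv; auto; fail) | rule teq_Cross teq_Cup teq_rep)+
  also have "teq ?n 0 ... (Cup (Suc i) (\<not> c) # ?b # ?a # rep m ?z @ ?A # ?B # Cap (Suc i) # v)"
    by (intro teq_Cup teq_sym[OF braid_slide_up])
  also have "teq ?n 0 ... (Cup (Suc i) c # ?a # rep m ?z @ ?A # ?B # Cap (Suc i) # v)"
    by (rule mv; auto; fail)
  also have "teq ?n 0 ... (Cup (Suc i) c # ?a # rep m ?z @ ?A # Cap (Suc i) # v)"
    by ((rule mv; auto; fail) | rule teq_Cross teq_Cup teq_rep)+
  also have "teq ?n 0 ... (Cup i c # ?B # rep m ?z @ ?A # Cap (Suc i) # v)"
    by (rule mv; auto; fail)
  also have "teq ?n 0 ... (Cup i c # ?B # rep m ?z @ ?b # Cap i # v)"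
    by ((rule mv; auto; fail) | rule teq_Cross teq_Cup teq_rep)+
  also have "teq ?n 0 ... (Cup i c # rep m ?z @ Cap i # v)"
  proof (cases s)
    \<comment> \<open>Of the two remaining opposite crossings, the one equal to the crossings of the
      column is moved through the column, where nothing has to be changed.\<close>
    case True
    then have e: "?B # rep m ?z @ ?b # Cap i # v = ?B # ?b # rep m ?z @ Cap i # v" by (simp add: rep_snoc)
    have "teq ?n 0 (Cup i c # ?B # ?b # rep m ?z @ Cap i # v) (Cup i c # rep m ?z @ Cap i # v)"
      by ((rule mv; auto; fail) | rule teq_Cross teq_Cup teq_rep)+
    then show ?thesis unfolding e .
  next
    case False
    then have e: "?B # rep m ?z @ ?b # Cap i # v = rep m ?z @ ?B # ?b # Cap i # v" by (simp add: rep_snoc)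
    have "teq ?n 0 (Cup i c # rep m ?z @ ?B # ?b # Cap i # v) (Cup i c # rep m ?z @ Cap i # v)"
      by ((rule mv; auto; fail) | rule teq_Cross teq_Cup teq_rep)+
    then show ?thesis unfolding e .
  qed
  finally show ?thesis .
qed

lemma left_loop_reduce: "teq (Suc i) (Suc r)
    (Cup i c # rep (2 * r + 3) (Cross (Suc i) s) @ Cap i # v)
    (Cup i c # rep (2 * r + 1) (Cross (Suc i) s) @ Cap i # v)"
  using teq_trans1[OF left_loop_step loop_flip] .

lemma left_loop_unknot: "teq (Suc i) (\<Sum>j\<le>r. j)
    (Cup i c # rep (2 * r + 1) (Cross (Suc i) s) @ Cap i # v)
    (Cup i c # Cross (Suc i) s # Cap i # v)"
proof (induction r)
  case (Suc r)
  from teq_trans[OF left_loop_reduce[of i r c s v] Suc] show ?case by (simp add: numeral_3_eq_3 add.commute)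
qed (simp add: teq_refl)

lemma deq_left_curl: "deq 0 (Cup i c # Cross (Suc i) s # Cap i # v) v"
proof -
  have "teq 0 0 (Cup i c # Cross (Suc i) s # Cap i # v) (Cup (Suc i) c # Cross i (\<not> s) # Cap i # v)"
    by (rule slide_cup) auto
  also have "teq 0 0 ... (Cup (Suc i) c # Cap i # v)"
    by (rule teq_Cup teq_R1_cap)+
  finally have "deq 0 (Cup i c # Cross (Suc i) s # Cap i # v) (Cup (Suc i) c # Cap i # v)"
    by (rule teq_deq0)
  also have "deq 0 (Cup (Suc i) c # Cap i # v) v" by (rule deq_straighten_left)
  finally show ?thesis .
qed

lemma deq_right_curl: "deq 0 (Cup (Suc i) c # Cross i s # Cap (Suc i) # v) v"
proof -
  have "teq 0 0 (Cup (Suc i) c # Cross i s # Cap (Suc i) # v) (Cup i c # Cross (Suc i) (\<not> s) # Cap (Suc i) # v)"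
    by (rule teq_sym[OF slide_cup]) auto
  also have "teq 0 0 ... (Cup i c # Cap (Suc i) # v)"
    by (rule teq_Cup teq_R1_cap)+
  finally have "deq 0 (Cup (Suc i) c # Cross i s # Cap (Suc i) # v) (Cup i c # Cap (Suc i) # v)"
    by (rule teq_deq0)
  also have "deq 0 (Cup i c # Cap (Suc i) # v) v" by (rule deq_straighten_right)
  finally show ?thesis .
qed

lemma deq_left_loop: "deq (\<Sum>j\<le>r. j) (Cup i c # rep (2 * r + 1) (Cross (Suc i) s) @ Cap i # v) v"
proof -
  have "deq (\<Sum>j\<le>r. j) (Cup i c # rep (2 * r + 1) (Cross (Suc i) s) @ Cap i # v) (Cup i c # Cross (Suc i) s # Cap i # v)"
    by (rule teq_deq[OF left_loop_unknot]) (auto simp: step.simps bind_eq_Some_conv split: if_splits)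
  also have "deq 0 ... v" by (rule deq_left_curl)
  finally show ?thesis .
qed

section \<open>Sweeping a hook along the columns\<close>

definition col :: "nat \<Rightarrow> int \<Rightarrow> diagram" where "col i p = replicate (nat \<bar>p\<bar>) (Cross i (p > 0))"

text \<open>
  The cap and the cup of the empty word form a zigzag in a strand of the last column. The hook turns
  around at this cap.
\<close>

fun cols :: "nat \<Rightarrow> bool \<Rightarrow> int list \<Rightarrow> diagram" where
  "cols i a [] = [Cap i, Cup i a]"
| "cols i a (p # ps) = Cup (Suc i) a # col i p @ cols (SS i) (\<not> a) ps @ [Cap (Suc i)]"

lemma position_col: "e \<in> set (col i p) \<Longrightarrow> position e = i"
  by (auto simp: col_def)

lemma position_cols: "e \<in> set (cols i a ps) \<Longrightarrow> i \<le> position e"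
  by (induction i a ps rule: cols.induct) (auto dest: position_col)

lemma slide_word: "(\<And>n e v. e \<in> set w \<Longrightarrow> teq n 0 (g e # c # v) (c # h e # v)) \<Longrightarrow>
    teq n 0 (map g w @ c # v) (c # map h w @ v)"
proof (induction w arbitrary: n)
  case (Cons e w)
  have "teq n 0 (g e # map g w @ c # v) (g e # c # map h w @ v)"
    using teq_append_left[OF Cons.IH, of "[g e]" n "n + outputs (g e) - inputs (g e)"] Cons.prems length_step[of "g e"]
    by (force simp: bind_eq_Some_conv)
  also have "teq n 0 ... (c # h e # map h w @ v)" using Cons.prems by simp
  finally show ?case by simp
qed (simp add: teq_refl)

lemma far_word: assumes "\<And>e. e \<in> set w \<Longrightarrow> SS i \<le> position e"
  shows "teq n 0 (w @ Cross i s # v) (Cross i s # w @ v)"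
proof -
  have "teq n 0 (e # Cross i s # v) (Cross i s # e # v)" if "e \<in> set w" for n e v
    using assms[OF that] by (cases e) (auto intro: far_Cross_Cross far_Cup_Cross far_Cap_Cross)
  from slide_word[where g = "\<lambda>e. e" and h = "\<lambda>e. e", OF this] show ?thesis by simp
qed

text \<open>
  In \<open>overL i s\<close> the strands \<open>i\<close> and \<open>i + 1\<close> are hooked. In \<open>overR i s\<close> the strand \<open>i\<close> is hooked to
  the strand \<open>i + 2\<close> after passing over the strand \<open>i + 1\<close>.
\<close>

definition overL :: "nat \<Rightarrow> bool \<Rightarrow> diagram" where "overL i s = [Cross i s, Cross i s]"
definition overR :: "nat \<Rightarrow> bool \<Rightarrow> diagram" where "overR i s = [X i, Cross (Suc i) s, Cross (Suc i) s, Y i]"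

text \<open>The hook slides around the turning point of the strand it grips, from one leg to the
  other. It has to reach over the first leg now, and its sign changes.\<close>

lemma cup_transfer: "teq (Suc i) 0 (Cup (Suc i) a # Y i # Y i # v)
    (Cup (Suc i) a # X i # X (Suc i) # X (Suc i) # Y i # v)"
proof -
  let ?n = "Suc i" and ?a = "X i" and ?b = "X (Suc i)" and ?A = "Y i" and ?B = "Y (Suc i)"
  have "teq ?n 0 (Cup (Suc i) a # ?A # ?A # v) (Cup (Suc i) a # ?A # ?a # ?A # ?A # v)"
    by ((rule mv; auto; fail) | rule teq_Cross teq_Cup)+
  also have "teq ?n 0 ... (Cup i a # ?b # ?a # ?A # ?A # v)"
    by (rule mv; auto; fail)
  also have "teq ?n 0 ... (Cup i a # ?B # ?b # ?b # ?a # ?A # ?A # v)"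
    by (intro teq_Cup) (rule mv; auto; fail)
  also have "teq ?n 0 ... (Cup (Suc i) a # ?a # ?b # ?b # ?a # ?A # ?A # v)"
    by (rule mv; auto; fail)
  also have "teq ?n 0 ... (Cup (Suc i) a # ?a # ?b # ?b # ?A # v)"
    by (intro teq_Cup teq_Cross) (rule mv; auto; fail)
  finally show ?thesis .
qed

lemma cap_transfer: "teq (SS (Suc i)) 0 (X i # X i # Cap (Suc i) # v)
    (X i # Y (Suc i) # Y (Suc i) # Y i # Cap (Suc i) # v)"
proof -
  let ?n = "SS (Suc i)" and ?a = "X i" and ?b = "X (Suc i)" and ?A = "Y i" and ?B = "Y (Suc i)"
  have "teq ?n 0 (?a # ?a # Cap (Suc i) # v) (?a # ?a # ?A # ?a # Cap (Suc i) # v)"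
    by (intro teq_Cross) (rule mv; auto; fail)
  also have "teq ?n 0 ... (?a # ?a # ?A # ?B # Cap i # v)"
    by (intro teq_Cross) (rule mv; auto; fail)
  also have "teq ?n 0 ... (?a # ?a # ?A # ?B # ?B # ?b # Cap i # v)"
    by (intro teq_Cross) (rule mv; auto; fail)
  also have "teq ?n 0 ... (?a # ?a # ?A # ?B # ?B # ?A # Cap (Suc i) # v)"
    by (intro teq_Cross) (rule mv; auto; fail)
  also have "teq ?n 0 ... (?a # ?B # ?B # ?A # Cap (Suc i) # v)"
    by (intro teq_Cross) (rule mv; auto; fail)
  finally show ?thesis .
qed

text \<open>Instead of the strand \<open>i\<close> reaching out, the strand \<open>i + 2\<close> is
  brought to it, so that the hook becomes a full twist of the strands \<open>i\<close> and
  \<open>i + 1\<close>, ready for \<open>comm_Delta\<close>.\<close>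

lemma overR_alt: "teq (SS (Suc i)) 0 (overR i s @ v)
    (Y (Suc i) # Cross i s # Cross i s # X (Suc i) # v)"
  using conj_power[of False True i 2 s v] by (simp add: overR_def numeral_2_eq_2)

text \<open>The \<open>k\<close> full twists of the column cost one move each. Behind the remaining
  crossing the hook would pass under the strand \<open>i + 1\<close>; one additional move puts it
  over.\<close>

lemma col_down: "teq (SS (Suc i)) (Suc k) (rep (2 * k + 1) (X (Suc i)) @ overL i False @ v)
    (overR i False @ rep (2 * k + 1) (X (Suc i)) @ v)"
proof -
  let ?n = "SS (Suc i)" and ?b = "X (Suc i)" and ?A = "Y i" and ?B = "Y (Suc i)"
  have "teq ?n 0 (rep (2 * k) ?b @ ?b # ?A # ?A # v) (rep (2 * k) ?b @ ?b # ?A # ?A # ?B # ?b # v)"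
    by (intro teq_rep teq_Cross) (rule mv; auto; fail)
  also have "teq ?n 1 ... (rep (2 * k) ?b @ ?B # ?A # ?A # ?b # ?b # v)"
    by (intro teq_rep conj_Delta) auto
  also have "teq ?n 0 ... (?B # rep (2 * k) ?b @ ?A # ?A # ?b # ?b # v)"
  proof -
    have "teq ?n 0 (rep (2 * k) ?b @ ?B # w) (?B # rep (2 * k) ?b @ w)" for w
    proof -
      have "teq ?n 0 (rep (2 * k) ?b @ ?B # w) (?B # ?b # rep (2 * k) ?b @ ?B # w)"
        by (rule mv; auto; fail)
      also have e: "?b # rep (2 * k) ?b @ ?B # w = rep (2 * k) ?b @ ?b # ?B # w" by (simp add: rep_snoc)
      also have "teq ?n 0 (?B # rep (2 * k) ?b @ ?b # ?B # w) (?B # rep (2 * k) ?b @ w)"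
        by (intro teq_Cross teq_rep) (rule mv; auto; fail)
      finally show ?thesis .
    qed
    then show ?thesis .
  qed
  also have "teq ?n k ... (?B # ?A # ?A # rep (2 * k) ?b @ ?b # ?b # v)"
    by (intro teq_Cross teq_sym[OF comm_Delta_power])
  also have "?B # ?A # ?A # rep (2 * k) ?b @ ?b # ?b # v = ?B # ?A # ?A # ?b # rep (2 * k + 1) ?b @ v"
    by (simp add: rep_snoc)
  also have "teq ?n 0 ... (overR i False @ rep (2 * k + 1) ?b @ v)"
    by (rule teq_sym[OF overR_alt])
  finally show ?thesis by (simp add: overL_def rep_snoc)
qed

text \<open>In this direction the odd crossing leaves the hook on the right side, over the strand
  \<open>i + 1\<close>, so only the \<open>k\<close> full twists are paid for.\<close>

lemma col_up: "teq (SS (Suc i)) k (overL i True @ rep (2 * k + 1) (X (Suc i)) @ v)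
    (rep (2 * k + 1) (X (Suc i)) @ overR i True @ v)"
proof -
  let ?n = "SS (Suc i)" and ?b = "X (Suc i)" and ?a = "X i" and ?B = "Y (Suc i)"
  have "teq ?n k (?a # ?a # rep (2 * k) ?b @ ?b # v) (rep (2 * k) ?b @ ?a # ?a # ?b # v)"
    by (rule comm_Delta_power)
  also have "teq ?n 0 ... (rep (2 * k) ?b @ ?b # ?B # ?a # ?a # ?b # v)"
    by (intro teq_rep) (rule mv; auto; fail)
  also have "teq ?n 0 ... (rep (2 * k) ?b @ ?b # overR i True @ v)"
    by (intro teq_rep teq_Cross teq_sym[OF overR_alt])
  finally show ?thesis by (simp add: overL_def rep_snoc)
qed

text \<open>The strand \<open>i\<close> reaches over both legs of the cap, so it can be lifted past
  the cap, where these legs no longer exist.\<close>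

lemma cap_pass: "teq (SS (SS (Suc i))) 0
   (X i # X (Suc i) # overR (SS i) s @ Y (Suc i) # Y i # Cap (SS i) # v)
   (Cap (SS i) # overR i s @ v)"
proof -
  let ?n = "SS (SS (Suc i))" and ?a = "X i" and ?b = "X (Suc i)" and ?c = "X (SS i)"
  let ?A = "Y i" and ?B = "Y (Suc i)" and ?C = "Y (SS i)"
  let ?d = "Cross (SS (Suc i)) s" and ?y = "Cross (Suc i) s"
  have "teq ?n 0 (?a # ?b # ?c # ?d # ?d # ?C # ?B # ?A # Cap (SS i) # v)
     (?a # ?b # ?c # ?d # ?d # ?C # ?B # Cap (SS i) # ?A # v)"
    by (intro teq_Cross) (rule mv; auto; fail)
  also have "teq ?n 0 ... (?a # ?b # ?c # ?d # ?d # ?C # ?c # Cap (Suc i) # ?A # v)"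
    by (intro teq_Cross) (rule mv; auto; fail)
  also have "teq ?n 0 ... (?a # ?b # ?c # ?d # ?d # Cap (Suc i) # ?A # v)"
    by (intro teq_Cross) (rule mv; auto; fail)
  also have "teq ?n 0 ... (?a # ?b # ?c # ?d # Cap (Suc i) # ?y # ?A # v)"
    by (intro teq_Cross) (rule mv; auto; fail)
  also have "teq ?n 0 ... (?a # ?b # ?c # Cap (Suc i) # ?y # ?y # ?A # v)"
    by (intro teq_Cross) (rule mv; auto; fail)
  also have "teq ?n 0 ... (?a # ?b # ?B # Cap (SS i) # ?y # ?y # ?A # v)"
    by (intro teq_Cross) (rule mv; auto; fail)
  also have "teq ?n 0 ... (?a # Cap (SS i) # ?y # ?y # ?A # v)"
    by (intro teq_Cross) (rule mv; auto; fail)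
  also have "teq ?n 0 ... (Cap (SS i) # ?a # ?y # ?y # ?A # v)"
    by (rule mv; auto; fail)
  finally show ?thesis by (simp add: overR_def)
qed

lemma cup_pass: "teq (SS (Suc i)) 0
   (Cup (SS i) e # X i # X (Suc i) # overR (SS i) s @ Y (Suc i) # Y i # v)
   (overR i s @ Cup (SS i) e # v)"
proof -
  let ?n = "SS (Suc i)" and ?a = "X i" and ?b = "X (Suc i)" and ?c = "X (SS i)"
  let ?A = "Y i" and ?B = "Y (Suc i)" and ?C = "Y (SS i)"
  let ?d = "Cross (SS (Suc i)) s" and ?y = "Cross (Suc i) s"
  have "teq ?n 0 (Cup (SS i) e # ?a # ?b # ?c # ?d # ?d # ?C # ?B # ?A # v)
      (?a # Cup (SS i) e # ?b # ?c # ?d # ?d # ?C # ?B # ?A # v)"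
    by (rule mv; auto; fail)
  also have "teq ?n 0 ... (?a # Cup (Suc i) e # ?C # ?c # ?d # ?d # ?C # ?B # ?A # v)"
    by (intro teq_Cross) (rule mv; auto; fail)
  also have "teq ?n 0 ... (?a # Cup (Suc i) e # ?d # ?d # ?C # ?B # ?A # v)"
    by (intro teq_Cross teq_Cup) (rule mv; auto; fail)
  also have "teq ?n 0 ... (?a # ?y # Cup (Suc i) e # ?d # ?C # ?B # ?A # v)"
    by (intro teq_Cross) (rule mv; auto; fail)
  also have "teq ?n 0 ... (?a # ?y # ?y # Cup (Suc i) e # ?C # ?B # ?A # v)"
    by (intro teq_Cross) (rule mv; auto; fail)
  also have "teq ?n 0 ... (?a # ?y # ?y # Cup (SS i) e # ?b # ?B # ?A # v)"
    by (intro teq_Cross) (rule mv; auto; fail)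
  also have "teq ?n 0 ... (?a # ?y # ?y # Cup (SS i) e # ?A # v)"
    by (intro teq_Cross teq_Cup) (rule mv; auto; fail)
  also have "teq ?n 0 ... (?a # ?y # ?y # ?A # Cup (SS i) e # v)"
    by (intro teq_Cross) (rule mv; auto; fail)
  finally show ?thesis by (simp add: overR_def)
qed

lemma far_words: "(\<And>e. e \<in> set w \<Longrightarrow> SS i \<le> position e) \<Longrightarrow> (\<And>e. e \<in> set u \<Longrightarrow> \<exists>j s. e = Cross j s \<and> j \<le> i) \<Longrightarrow>
    teq n 0 (w @ u @ v) (u @ w @ v)"
proof (induction u)
  case (Cons e u)
  then obtain j s where e: "e = Cross j s" "j \<le> i" by force
  have "teq n 0 (w @ Cross j s # u @ v) (Cross j s # w @ u @ v)"
    by (rule far_word) (use Cons.prems(1) e(2) in force)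
  also have "teq n 0 ... (Cross j s # u @ w @ v)"
    by (rule teq_Cross[OF Cons.IH]) (use Cons.prems in auto)
  finally show ?case by (simp add: e)
qed (simp add: teq_refl)

lemma run_length: "run w xs = Some ys \<Longrightarrow> length ys + sum_list (map inputs w) = length xs + sum_list (map outputs w)"
proof (induction w arbitrary: xs)
  case (Cons e w)
  then obtain zs where "step e xs = Some zs" "run w zs = Some ys" by (auto simp: bind_eq_Some_conv)
  with Cons.IH length_step show ?case by fastforce
qed simp

lemma teq_word:
  assumes "sum_list (map inputs w) = sum_list (map outputs w)" "tangle_rel n R l r"
  shows "tangle_rel n R (w @ l) (w @ r)"
  by (rule teq_append_left[OF assms(2)]) (use run_length[of w] assms(1) in force)

lemma balanced_col: "sum_list (map inputs (col i p)) = sum_list (map outputs (col i p))"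
  by (simp add: col_def)

lemma balanced_cols: "sum_list (map inputs (cols i a ps)) = sum_list (map outputs (cols i a ps))"
  by (induction i a ps rule: cols.induct) (auto simp: balanced_col)

text \<open>After the hook has left the remaining columns at the top, the finger that carried it is
  pulled up past \<open>w\<close> and past the cap; it lies over everything, so no Delta-move is
  needed.\<close>

lemma sweep_top:
  assumes "\<And>e. e \<in> set w \<Longrightarrow> SS (Suc i) \<le> position e" "sum_list (map inputs w) = sum_list (map outputs w)"
  shows "teq (SS (Suc i)) 0
    (Cup (SS i) e # col (Suc i) p @ X i # X (Suc i) # w @ overR (SS i) s @
       Y (Suc i) # Y i # Cap (SS i) # v)
    (Cup (SS i) e # col (Suc i) p @ w @ Cap (SS i) # overR i s @ v)"
proof -
  let ?n = "SS (Suc i)"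
  let ?r = "overR (SS i) s @ Y (Suc i) # Y i # Cap (SS i) # v"
  have "teq ?n 0 (Cup (SS i) e # col (Suc i) p @ [X i, X (Suc i)] @ w @ ?r)
     (Cup (SS i) e # col (Suc i) p @ w @ [X i, X (Suc i)] @ ?r)"
    by (intro teq_Cup teq_word[OF balanced_col] teq_sym[OF far_words]) (use assms(1) in auto)
  also have "teq ?n 0 ... (Cup (SS i) e # col (Suc i) p @ w @ Cap (SS i) # overR i s @ v)"
    using cap_pass[of i s v] by (intro teq_Cup teq_word[OF balanced_col] teq_word[OF assms(2)]) simp
  finally show ?thesis by simp
qed

text \<open>Both edges of the finger lie over the column \<open>p\<close> and slide down through it
  by third Reidemeister moves; the hook itself stays to the right of the column.\<close>

lemma sweep_bottom:
  assumes "\<And>e. e \<in> set w \<Longrightarrow> SS (Suc i) \<le> position e" "sum_list (map inputs w) = sum_list (map outputs w)"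
  shows "teq (SS (Suc i)) 0
    (Cup (SS i) e # col (Suc i) p @ X i # X (Suc i) # overR (SS i) s @ w @
       Y (Suc i) # Y i # Cap (SS i) # v)
    (overR i s @ Cup (SS i) e # col (Suc i) p @ w @ Cap (SS i) # v)"
proof -
  let ?n = "SS (Suc i)" and ?XX = "[X i, X (Suc i)]" and ?YY = "[Y (Suc i), Y i]"
  let ?R = "overR (SS i) s" and ?C = "Cap (SS i) # v"
  have bR: "sum_list (map inputs ?R) = sum_list (map outputs ?R)" by (simp add: overR_def)
  have pR: "SS i \<le> position e" if "e \<in> set ?R" for e using that by (auto simp: overR_def)
  have "teq ?n 0 (Cup (SS i) e # col (Suc i) p @ ?XX @ ?R @ w @ ?YY @ ?C)
    (Cup (SS i) e # col (Suc i) p @ ?XX @ ?R @ ?YY @ w @ ?C)"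
    by (intro teq_Cup teq_word[OF balanced_col] teq_word[OF bR] teq_word[of ?XX] far_words) (use assms(1) in auto)
  also have "teq ?n 0 ... (Cup (SS i) e # ?XX @ col i p @ ?R @ ?YY @ w @ ?C)"
    using teq_sym[OF braid_slide_down[of _ i True "nat \<bar>p\<bar>" "p > 0"]]
    by (intro teq_Cup) (simp add: col_def)
  also have "teq ?n 0 ... (Cup (SS i) e # ?XX @ ?R @ col i p @ ?YY @ w @ ?C)"
    by (intro teq_Cup teq_word[of ?XX] teq_sym[OF far_words]) (use pR in \<open>auto simp: col_def\<close>)
  also have "teq ?n 0 ... (Cup (SS i) e # ?XX @ ?R @ ?YY @ col (Suc i) p @ w @ ?C)"
    using teq_sym[OF braid_slide_up[of _ i False "nat \<bar>p\<bar>" "p > 0"]]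
    by (intro teq_Cup teq_word[of ?XX] teq_word[OF bR]) (simp_all add: col_def)
  also have "teq ?n 0 ... (overR i s @ Cup (SS i) e # col (Suc i) p @ w @ ?C)"
    using cup_pass[of i e s "col (Suc i) p @ w @ ?C"] by simp
  finally show ?thesis by simp
qed

text \<open>
  The number of moves used by a hook which enters the columns from above, respectively from below. It
  leaves a column on the opposite side, which is the side from which it enters the next column.
\<close>

fun cost_down :: "int list \<Rightarrow> nat" and cost_up :: "int list \<Rightarrow> nat" where
  "cost_down [] = 0"
| "cost_down (p # ps) = nat ((p + 1) div 2) + cost_up ps"
| "cost_up [] = 0"
| "cost_up (p # ps) = nat (p div 2) + cost_down ps"

definition odd_pos :: "int list \<Rightarrow> bool" where "odd_pos ps \<longleftrightarrow> (\<forall>p \<in> set ps. odd p \<and> 0 < p)"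

lemma odd_pos_simps [simp]: "odd_pos []" "odd_pos (p # ps) \<longleftrightarrow> odd p \<and> 0 < p \<and> odd_pos ps"
  by (auto simp: odd_pos_def)

text \<open>The columns contribute half of \<open>p + 1\<close> and half of \<open>p - 1\<close> in
  turn, so the corrections cancel in pairs.\<close>

lemma costs: "odd_pos ps \<Longrightarrow> 2 * int (cost_down ps) = sum_list ps + (if even (length ps) then 0 else 1)
   \<and> 2 * int (cost_up ps) = sum_list ps - (if even (length ps) then 0 else 1)"
proof (induction ps)
  case (Cons p ps)
  then obtain k where "p = 2 * k + 1" "k \<ge> 0" by (auto elim!: oddE)
  with Cons show ?case by auto
qed simp

lemma col_odd: assumes "odd p" "0 < p" shows "col i p = rep (2 * nat (p div 2) + 1) (X i)"
proof -
  have "nat \<bar>p\<bar> = 2 * nat (p div 2) + 1" using assms by (auto elim!: oddE)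
  then show ?thesis using assms by (simp add: col_def)
qed

text \<open>Both directions are proved together, since the hook enters successive columns
  alternately from above and from below. Its sign records the direction, and the parity of the
  number of columns decides on which side it returns.\<close>

lemma sweep: "odd_pos ps \<Longrightarrow>
    teq (SS (Suc i)) (cost_down ps) (cols (Suc i) a ps @ overL i False)
      (if even (length ps) then cols (Suc i) a ps @ overR i True else overR i False @ cols (Suc i) a ps) \<and>
    teq (SS (Suc i)) (cost_up ps) (overL i True @ cols (Suc i) a ps)
      (if even (length ps) then overR i False @ cols (Suc i) a ps else cols (Suc i) a ps @ overR i True)"
proof (induction ps arbitrary: i a)
  case Nil
  have "teq (SS (Suc i)) 0 (Cap (Suc i) # Cup (Suc i) a # overL i False) (Cap (Suc i) # Cup (Suc i) a # overR i True)"
    using cup_transfer[of i a "[]"] by (intro teq_Cap) (simp add: overL_def overR_def)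
  moreover have "teq (SS (Suc i)) 0 (overL i True @ [Cap (Suc i), Cup (Suc i) a]) (overR i False @ [Cap (Suc i), Cup (Suc i) a])"
    using cap_transfer[of i "[Cup (Suc i) a]"] by (simp add: overL_def overR_def)
  ultimately show ?case by simp
next
  case (Cons p ps)
  let ?n = "SS (Suc i)" and ?XX = "[X i, X (Suc i)]" and ?YY = "[Y (Suc i), Y i]"
  let ?w = "cols (SS (Suc i)) (\<not> a) ps" and ?U = "Cup (SS i) a" and ?C = "Cap (SS i)" and ?c = "col (Suc i) p"
  define k where "k = nat (p div 2)"
  have p: "odd p" "0 < p" "odd_pos ps" using Cons.prems by auto
  have c: "?c = rep (2 * k + 1) (X (Suc i))" using col_odd[OF p(1,2)] by (simp add: k_def)
  have cd: "cost_down (p # ps) = Suc k + cost_up ps" "cost_up (p # ps) = k + cost_down ps"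
    using p(1,2) by (auto simp: k_def elim!: oddE)
  have pw: "SS (Suc i) \<le> position e" if "e \<in> set ?w" for e using position_cols[OF that] .
  note bw = balanced_cols[of "SS (Suc i)" "\<not> a" ps]
  note top = sweep_top[OF pw bw, where v = "[]"] and bottom = sweep_bottom[OF pw bw, where v = "[]"]
  have IH: "teq (SS ?n) (cost_down ps) (?w @ overL (SS i) False)
      (if even (length ps) then ?w @ overR (SS i) True else overR (SS i) False @ ?w)"
    "teq (SS ?n) (cost_up ps) (overL (SS i) True @ ?w)
      (if even (length ps) then overR (SS i) False @ ?w else ?w @ overR (SS i) True)"
    using Cons.IH[OF p(3)] by auto
  have "teq ?n 0 (?U # ?c @ ?w @ [?C] @ overL i False) (?U # ?c @ ?w @ overL i False @ [?C])"
    by (intro teq_Cup teq_word[OF balanced_col] teq_word[OF bw] far_words[of _ i _ _ "[]", simplified]) (auto simp: overL_def)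
  also have "teq ?n 0 ... (?U # ?c @ overL i False @ ?w @ [?C])"
    by (intro teq_Cup teq_word[OF balanced_col] far_words) (use pw in \<open>force simp: overL_def\<close>)+
  also have "teq ?n (Suc k) ... (?U # overR i False @ ?c @ ?w @ [?C])"
    unfolding c by (intro teq_Cup teq_mono[OF col_down]) auto
  also have "teq ?n 0 ... (X i # ?U # Y (Suc i) # Y (Suc i) # Y i # ?c @ ?w @ [?C])"
    unfolding overR_def by simp (rule mv; auto; fail)
  \<comment> \<open>At the cup joining this column to the next one, the hook changes legs: it now
    grips the left strand of the next column, from below.\<close>
  also have "teq ?n 0 ... (X i # ?U # X (Suc i) # X (SS i) # X (SS i) # Y (Suc i) # Y i # ?c @ ?w @ [?C])"
    by (intro teq_Cross teq_mono[OF cup_transfer]) auto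
  also have "teq ?n 0 ... (?U # ?XX @ overL (SS i) True @ ?YY @ ?c @ ?w @ [?C])"
    unfolding overL_def by simp (rule mv; auto; fail)
  \<comment> \<open>To apply the induction hypothesis, the hook must be adjacent to the remaining
    columns. The finger is therefore lifted over the column \<open>p\<close>, first its upper edge,
    then the hook, then its lower edge.\<close>
  also have "teq ?n 0 ... (?U # ?XX @ overL (SS i) True @ col i p @ ?YY @ ?w @ [?C])"
    using braid_slide_up[of _ i False "nat \<bar>p\<bar>" "p > 0"]
    by (intro teq_Cup teq_word[of ?XX] teq_word[of "overL _ _"]) (simp_all add: col_def overL_def)
  also have "teq ?n 0 ... (?U # ?XX @ col i p @ overL (SS i) True @ ?YY @ ?w @ [?C])"
    by (intro teq_Cup teq_word[of ?XX] far_words[of _ i]) (auto simp: col_def overL_def)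
  also have "teq ?n 0 ... (?U # ?c @ ?XX @ overL (SS i) True @ ?YY @ ?w @ [?C])"
    using braid_slide_down[of _ i True "nat \<bar>p\<bar>" "p > 0"]
    by (intro teq_Cup) (simp_all add: col_def overL_def)
  also have "teq ?n 0 ... (?U # ?c @ ?XX @ overL (SS i) True @ ?w @ ?YY @ [?C])"
    by (intro teq_Cup teq_word[of ?XX] teq_word[OF balanced_col] teq_word[of "overL _ _"] teq_sym[OF far_words]) (use pw in \<open>auto simp: overL_def\<close>)
  also have "teq ?n (cost_up ps) ... (?U # ?c @ ?XX @
     (if even (length ps) then overR (SS i) False @ ?w else ?w @ overR (SS i) True) @ ?YY @ [?C])"
    using teq_append_right[OF IH(2), of "?YY @ [?C]"] by (intro teq_Cup teq_word[of ?XX] teq_word[OF balanced_col]) simp_all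
  also have "teq ?n 0 ... (if even (length ps) then overR i False @ ?U # ?c @ ?w @ [?C] else ?U # ?c @ ?w @ [?C] @ overR i True)"
    using top[of a p True] bottom[of a p False] by auto
  finally have down: "teq ?n (cost_down (p # ps)) (cols (Suc i) a (p # ps) @ overL i False)
     (if even (length ps) then overR i False @ cols (Suc i) a (p # ps) else cols (Suc i) a (p # ps) @ overR i True)"
    unfolding cd by (cases "even (length ps)") simp_all
  have "teq ?n 0 (overL i True @ ?U # ?c @ ?w @ [?C]) (?U # overL i True @ ?c @ ?w @ [?C])"
  proof -
    have "teq ?n 0 ([?U] @ overL i True @ ?c @ ?w @ [?C]) (overL i True @ [?U] @ ?c @ ?w @ [?C])"
      by (rule far_words[of _ i]) (auto simp: overL_def)
    from teq_sym[OF this] show ?thesis by simp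
  qed
  also have "teq ?n k ... (?U # ?c @ overR i True @ ?w @ [?C])"
    unfolding c by (intro teq_Cup teq_mono[OF col_up]) auto
  also have "teq ?n 0 ... (?U # ?c @ ?w @ overR i True @ [?C])"
    by (intro teq_Cup teq_word[OF balanced_col] teq_sym[OF far_words[of _ "Suc i"]]) (use pw in \<open>auto simp: overR_def\<close>)
  also have "teq ?n 0 ... (?U # ?c @ ?w @ [X i, X (Suc i), X (Suc i), ?C, Y i])"
    unfolding overR_def append.simps
    by (intro teq_Cup teq_word[OF balanced_col] teq_word[OF bw] teq_Cross) (rule mv; auto; fail)
  \<comment> \<open>The upper edge of the finger goes above the cap first, so that the hook can
    change legs at the cap.\<close>
  also have "teq ?n 0 ... (?U # ?c @ ?w @ [X i] @ overR (Suc i) False @ [?C, Y i])"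
    using teq_Cross[OF teq_mono[OF cap_transfer[of "Suc i" "[Y i]"], of "SS ?n"], of i True]
    by (intro teq_Cup teq_word[OF balanced_col] teq_word[OF bw]) (simp add: overR_def)
  also have "teq ?n 0 ... (?U # ?c @ ?w @ ?XX @ overL (SS i) False @ ?YY @ [?C])"
    unfolding overR_def overL_def append.simps
    by (intro teq_Cup teq_word[OF balanced_col] teq_word[OF bw] teq_Cross) (rule mv; auto; fail)
  also have "teq ?n 0 ... (?U # ?c @ ?XX @ ?w @ overL (SS i) False @ ?YY @ [?C])"
    by (intro teq_Cup teq_word[OF balanced_col] far_words[of _ "Suc i"]) (use pw in auto)
  also have "teq ?n (cost_down ps) ... (?U # ?c @ ?XX @
     (if even (length ps) then ?w @ overR (SS i) True else overR (SS i) False @ ?w) @ ?YY @ [?C])"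
    using teq_append_right[OF IH(1), of "?YY @ [?C]"] by (intro teq_Cup teq_word[of ?XX] teq_word[OF balanced_col]) simp_all
  also have "teq ?n 0 ... (if even (length ps) then ?U # ?c @ ?w @ [?C] @ overR i True else overR i False @ ?U # ?c @ ?w @ [?C])"
    using top[of a p True] bottom[of a p False] by auto
  finally have up: "teq ?n (cost_up (p # ps)) (overL i True @ cols (Suc i) a (p # ps))
     (if even (length ps) then cols (Suc i) a (p # ps) @ overR i True else overR i False @ cols (Suc i) a (p # ps))"
    unfolding cd by (cases "even (length ps)") simp_all
  from down up show ?case by (simp split del: if_split) (auto split: if_splits)
qed

section \<open>Unknotting the closed columns\<close>

definition closed_cols :: "bool \<Rightarrow> bool \<Rightarrow> int \<Rightarrow> int list \<Rightarrow> diagram" where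
  "closed_cols a c p ps = Cup 0 a # cols 0 c (p # ps) @ [Cap 0]"

lemma closed_cols_alt: "closed_cols a c p ps = Cup 0 a # Cup (Suc 0) c # col 0 p @ cols (SS 0) (\<not> c) ps @ [Cap (Suc 0), Cap 0]"
  by (simp add: closed_cols_def)

text \<open>The two nested caps carry a band of two strands over the top; a crossing at its right
  end slides to its left end.\<close>

lemma outer_cap_swap: "teq n 0 (Cross (SS 0) s # Cap (Suc 0) # Cap 0 # v) (Cross 0 s # Cap (Suc 0) # Cap 0 # v)"
proof -
  have "teq n 0 (Cross (SS 0) s # Cap (Suc 0) # Cap 0 # v) (Cross (Suc 0) (\<not> s) # Cap (SS 0) # Cap 0 # v)"
    by (rule mv; auto; fail)
  also have "teq n 0 ... (Cross (Suc 0) (\<not> s) # Cap 0 # Cap 0 # v)"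
    by (intro teq_Cross) (rule mv; auto; fail)
  also have "teq n 0 ... (Cross 0 s # Cap (Suc 0) # Cap 0 # v)"
    by (rule mv; auto; fail)
  finally show ?thesis .
qed

text \<open>The hook grips the outer arc, and the strand carrying it belongs to the inner arc. It is
  thus a full twist of the two nested arcs and can be moved to their left ends.\<close>

lemma outer_cap: "teq (SS (SS 0)) 0 (overR (Suc 0) True @ Cap (Suc 0) # Cap 0 # v) (Y 0 # Y 0 # Cap (Suc 0) # Cap 0 # v)"
proof -
  let ?n = "SS (SS 0)" and ?a = "X (Suc 0)" and ?b = "X (SS 0)" and ?A = "Y (Suc 0)" and ?B = "Y (SS 0)"
  let ?C1 = "Cap (Suc 0)" and ?C2 = "Cap (SS 0)" and ?C0 = "Cap 0"
  have "teq ?n 0 (?a # ?b # ?b # ?A # ?C1 # ?C0 # v) (?a # ?b # ?b # ?C1 # ?C0 # v)"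
    by (intro teq_Cross) (rule mv; auto; fail)
  also have "teq ?n 0 ... (?a # ?b # ?A # ?C2 # ?C0 # v)"
    by (intro teq_Cross) (rule mv; auto; fail)
  also have "teq ?n 0 ... (?B # ?a # ?b # ?C2 # ?C0 # v)"
    by (rule mv; auto; fail)
  also have "teq ?n 0 ... (?B # ?a # ?C2 # ?C0 # v)"
    by (intro teq_Cross) (rule mv; auto; fail)
  also have "teq ?n 0 ... (?B # ?B # ?C1 # ?C0 # v)"
    by (intro teq_Cross) (rule mv; auto; fail)
  also have "teq ?n 0 ... (?B # Y 0 # ?C1 # ?C0 # v)"
    by (intro teq_Cross outer_cap_swap)
  also have "teq ?n 0 ... (Y 0 # ?B # ?C1 # ?C0 # v)"
    by (rule mv; auto; fail)
  also have "teq ?n 0 ... (Y 0 # Y 0 # ?C1 # ?C0 # v)"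
    by (intro teq_Cross outer_cap_swap)
  finally show ?thesis by (simp add: overR_def)
qed

lemma outer_cup_swap: "teq n 0 (Cup 0 a # Cup (Suc 0) c # Cross (SS 0) s # v) (Cup 0 c # Cup (Suc 0) a # Cross 0 s # v)"
proof -
  have "teq n 0 (Cup 0 a # Cup (Suc 0) c # Cross (SS 0) s # v) (Cup 0 a # Cup (SS 0) c # Cross (Suc 0) (\<not> s) # v)"
    by (intro teq_Cup) (rule mv; auto; fail)
  also have "teq n 0 ... (Cup 0 c # Cup 0 a # Cross (Suc 0) (\<not> s) # v)"
    by (rule mv; auto; fail)
  also have "teq n 0 ... (Cup 0 c # Cup (Suc 0) a # Cross 0 s # v)"
    by (intro teq_Cup) (rule mv; auto; fail)
  finally show ?thesis .
qed

lemma outer_cup: "teq 0 0 (Cup 0 a # Cup (Suc 0) c # overR (Suc 0) False @ v) (Cup 0 a # Cup (Suc 0) c # X 0 # X 0 # v)"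
proof -
  let ?n = 0 and ?a = "X (Suc 0)" and ?b = "X (SS 0)" and ?A = "Y (Suc 0)" and ?B = "Y (SS 0)"
  have "teq ?n 0 (Cup 0 a # Cup (Suc 0) c # ?a # ?B # ?B # ?A # v) (Cup 0 a # Cup (Suc 0) (\<not> c) # ?B # ?B # ?A # v)"
    by (intro teq_Cup) (rule mv; auto; fail)
  also have "teq ?n 0 ... (Cup 0 a # Cup (SS 0) (\<not> c) # ?a # ?B # ?A # v)"
    by (intro teq_Cup) (rule mv; auto; fail)
  also have "teq ?n 0 ... (Cup 0 a # Cup (SS 0) (\<not> c) # ?B # ?A # ?b # v)"
    by (intro teq_Cup) (rule mv; auto; fail)
  also have "teq ?n 0 ... (Cup 0 a # Cup (SS 0) c # ?A # ?b # v)"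
    by (intro teq_Cup) (rule mv; auto; fail)
  also have "teq ?n 0 ... (Cup 0 a # Cup (Suc 0) c # ?b # ?b # v)"
    by (intro teq_Cup) (rule mv; auto; fail)
  also have "teq ?n 0 ... (Cup 0 c # Cup (Suc 0) a # X 0 # ?b # v)"
    by (rule outer_cup_swap)
  also have "teq ?n 0 ... (Cup 0 c # Cup (Suc 0) a # ?b # X 0 # v)"
    by (intro teq_Cup) (rule mv; auto; fail)
  also have "teq ?n 0 ... (Cup 0 a # Cup (Suc 0) c # X 0 # X 0 # v)"
    by (rule outer_cup_swap)
  finally show ?thesis by (simp add: overR_def)
qed

lemma closed_hook: "teq 0 0 (closed_cols a c p ps)
   (Cup 0 a # Cup (Suc 0) c # col 0 p @ (cols (SS 0) (\<not> c) ps @ overL (Suc 0) False) @ [Cap (Suc 0), Cap 0])"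
proof -
  have "teq n 0 (Cap (Suc 0) # v) (overL (Suc 0) False @ Cap (Suc 0) # v)" for n v
    unfolding overL_def append.simps
    using teq_trans0[OF teq_sym[OF teq_R1_cap] teq_Cross[OF teq_sym[OF teq_R1_cap]]] .
  then show ?thesis unfolding closed_cols_alt append_assoc
    by (intro teq_Cup teq_word[OF balanced_col] teq_word[OF balanced_cols])
qed

text \<open>Proved in the direction that adds two crossings and reversed later by symmetry. With an
  even number of odd columns the hook returns at the top, where the outer arcs convert it to two
  crossings of the first column.\<close>

lemma closed_step_even:
  assumes "odd_pos ps" "even (length ps)" "p \<le> 0"
  shows "teq 0 (cost_down ps) (closed_cols a c p ps) (closed_cols a c (p - 2) ps)"
proof -
  let ?w = "cols (SS 0) (\<not> c) ps" and ?v = "[Cap (Suc 0), Cap 0]" and ?n = "SS (SS 0)"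
  have "teq 0 0 (closed_cols a c p ps) (Cup 0 a # Cup (Suc 0) c # col 0 p @ (?w @ overL (Suc 0) False) @ ?v)"
    by (rule closed_hook)
  also have "teq 0 (cost_down ps) ... (Cup 0 a # Cup (Suc 0) c # col 0 p @ (?w @ overR (Suc 0) True) @ ?v)"
    using sweep[OF assms(1), of "Suc 0" "\<not> c"] assms(2)
    by (intro teq_Cup teq_word[OF balanced_col] teq_append_right[of _ _ "?w @ overL (Suc 0) False"]) simp
  also have "teq 0 0 ... (Cup 0 a # Cup (Suc 0) c # col 0 p @ ?w @ [Y 0, Y 0] @ ?v)"
    using outer_cap[of "[]"] unfolding append_assoc
    by (intro teq_Cup teq_word[OF balanced_col] teq_word[OF balanced_cols]) simp
  also have "teq 0 0 ... (Cup 0 a # Cup (Suc 0) c # col 0 p @ [Y 0, Y 0] @ ?w @ ?v)"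
    by (intro teq_Cup teq_word[OF balanced_col] far_words[of _ 0]) (auto dest: position_cols)
  also have "col 0 p @ [Y 0, Y 0] @ ?w @ ?v = col 0 (p - 2) @ ?w @ ?v"
  proof -
    have "nat \<bar>p - 2\<bar> = nat \<bar>p\<bar> + 2" using assms(3) by simp
    then show ?thesis using assms(3) by (simp add: col_def replicate_add numeral_2_eq_2 rep_snoc)
  qed
  finally show ?thesis unfolding closed_cols_alt .
qed

text \<open>The hook returns below the odd columns but above the first one. To reach the cups at the
  bottom it must pass the \<open>2 * k\<close> crossings of the first column, i.e. \<open>k\<close>
  full twists at one move each.\<close>

lemma closed_step_odd:
  assumes "odd_pos ps" "odd (length ps)" "p = 2 * int k"
  shows "teq 0 (cost_down ps + k) (closed_cols a c p ps) (closed_cols a c (p + 2) ps)"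
proof -
  let ?w = "cols (SS 0) (\<not> c) ps" and ?v = "[Cap (Suc 0), Cap 0]" and ?n = "SS (SS 0)"
  have col: "col 0 p = rep (2 * k) (X 0)" using assms(3) by (cases "k = 0") (simp_all add: col_def nat_mult_distrib)
  have far: "teq n 0 (Cross (SS 0) s # rep j (Cross 0 t) @ v) (rep j (Cross 0 t) @ Cross (SS 0) s # v)" for n s j t v
    using far_words[of "[Cross (SS 0) s]" 0 "rep j (Cross 0 t)" n v] by simp
  have "teq 0 0 (closed_cols a c p ps) (Cup 0 a # Cup (Suc 0) c # col 0 p @ (?w @ overL (Suc 0) False) @ ?v)"
    by (rule closed_hook)
  also have "teq 0 (cost_down ps) ... (Cup 0 a # Cup (Suc 0) c # col 0 p @ (overR (Suc 0) False @ ?w) @ ?v)"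
    using sweep[OF assms(1), of "Suc 0" "\<not> c"] assms(2)
    by (intro teq_Cup teq_word[OF balanced_col] teq_append_right[of _ _ "?w @ overL (Suc 0) False"]) simp
  also have "teq 0 0 ... (Cup 0 a # Cup (Suc 0) c # rep (2 * k) (X 0) @
      Y (SS 0) # Y (Suc 0) # Y (Suc 0) # X (SS 0) # ?w @ ?v)"
    unfolding col append_assoc using overR_alt[of "Suc 0" False] by (intro teq_Cup teq_rep) simp
  also have "teq 0 0 ... (Cup 0 a # Cup (Suc 0) c #
      Y (SS 0) # rep (2 * k) (X 0) @ Y (Suc 0) # Y (Suc 0) # X (SS 0) # ?w @ ?v)"
    by (intro teq_Cup teq_sym[OF far])
  also have "teq 0 k ... (Cup 0 a # Cup (Suc 0) c #
      Y (SS 0) # Y (Suc 0) # Y (Suc 0) # rep (2 * k) (X 0) @ X (SS 0) # ?w @ ?v)"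
    by (intro teq_Cup teq_Cross teq_mono[OF teq_sym[OF comm_Delta_power']]) simp
  also have "teq 0 0 ... (Cup 0 a # Cup (Suc 0) c #
      Y (SS 0) # Y (Suc 0) # Y (Suc 0) # X (SS 0) # rep (2 * k) (X 0) @ ?w @ ?v)"
    by (intro teq_Cup teq_Cross teq_sym[OF far])
  also have "teq 0 0 ... (Cup 0 a # Cup (Suc 0) c # overR (Suc 0) False @ rep (2 * k) (X 0) @ ?w @ ?v)"
    by (intro teq_Cup teq_sym[OF overR_alt])
  also have "teq 0 0 ... (Cup 0 a # Cup (Suc 0) c # X 0 # X 0 # rep (2 * k) (X 0) @ ?w @ ?v)"
    by (rule outer_cup)
  also have "X 0 # X 0 # rep (2 * k) (X 0) @ ?w @ ?v = col 0 (p + 2) @ ?w @ ?v"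
  proof -
    have "nat \<bar>p + 2\<bar> = SS (2 * k)" using assms(3) by simp
    then show ?thesis using assms(3) by (simp add: col_def)
  qed
  finally show ?thesis unfolding closed_cols_alt by simp
qed

lemma far_shift_Cap: assumes "\<And>e. e \<in> set w \<Longrightarrow> j \<le> position e"
  shows "teq n 0 (map (shift \<circ> shift) w @ Cap j # v) (Cap j # w @ v)"
proof -
  have "teq n 0 ((shift \<circ> shift) e # Cap j # v) (Cap j # e # v)" if "e \<in> set w" for n e v
    using assms[OF that] by (cases e) (auto intro: far_Cross_Cap far_Cup_Cap far_Cap_Cap)
  from slide_word[where w = w and h = "\<lambda>e. e", OF this] show ?thesis by (simp add: comp_def)
qed

lemma far_shift_Cup: assumes "\<And>e. e \<in> set w \<Longrightarrow> j \<le> position e"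
  shows "teq n 0 (w @ Cup j a # v) (Cup j a # map (shift \<circ> shift) w @ v)"
proof -
  have "teq n 0 (e # Cup j a # v) (Cup j a # (shift \<circ> shift) e # v)" if "e \<in> set w" for n e v
    using assms[OF that] by (cases e) (auto intro: far_Cross_Cup far_Cup_Cup far_Cap_Cup)
  from slide_word[where w = w and g = "\<lambda>e. e", OF this] show ?thesis by (simp add: comp_def)
qed

lemma cols_shift: "map (shift \<circ> shift) (cols i a ps) = cols (SS i) a ps"
  by (induction i a ps rule: cols.induct) (simp_all add: col_def)

text \<open>Brings the second column into a loop next to the first one. For \<open>p = 0\<close>
  this loop is a local knot in a single strand, so that columns can be removed one by one.\<close>

lemma closed_cols_Cons: "teq 0 0 (closed_cols a b p (q # ps))
   (Cup 0 a # Cup (Suc 0) (\<not> b) # Cup (Suc 0) b # col 0 p @ col (SS 0) q @ Cap (Suc 0) # cols (SS 0) b ps @ [Cap (Suc 0), Cap 0])"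
proof -
  let ?w = "cols (SS 0) b ps" and ?w4 = "cols (SS (SS 0)) b ps" and ?c = "col (SS 0) q"
  let ?U = "Cup (SS (Suc 0)) (\<not> b)"
  have "closed_cols a b p (q # ps) = Cup 0 a # Cup (Suc 0) b # col 0 p @ [?U] @ ?c @ ?w4 @ [Cap (SS (Suc 0)), Cap (Suc 0), Cap 0]"
    by (simp add: closed_cols_alt)
  also have "teq 0 0 ... (Cup 0 a # Cup (Suc 0) b # [?U] @ col 0 p @ ?c @ ?w4 @ [Cap (SS (Suc 0)), Cap (Suc 0), Cap 0])"
    by (intro teq_Cup teq_sym[OF far_words[of _ 0]]) (auto simp: col_def)
  also have "teq 0 0 ... (Cup 0 a # Cup (Suc 0) (\<not> b) # Cup (Suc 0) b # col 0 p @ ?c @ ?w4 @ [Cap (SS (Suc 0)), Cap (Suc 0), Cap 0])"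
    unfolding append.simps by (intro teq_Cup) (rule mv; auto; fail)
  also have "teq 0 0 ... (Cup 0 a # Cup (Suc 0) (\<not> b) # Cup (Suc 0) b # col 0 p @ ?c @ ?w4 @ [Cap (Suc 0), Cap (Suc 0), Cap 0])"
    by (intro teq_Cup teq_word[OF balanced_col] teq_word[OF balanced_cols]) (rule mv; auto; fail)
  also have "teq 0 0 ... (Cup 0 a # Cup (Suc 0) (\<not> b) # Cup (Suc 0) b # col 0 p @ ?c @ Cap (Suc 0) # ?w @ [Cap (Suc 0), Cap 0])"
    unfolding cols_shift[of "SS 0", symmetric] by (intro teq_Cup teq_word[OF balanced_col] far_shift_Cap) (auto dest: position_cols)
  finally show ?thesis .
qed

text \<open>For \<open>p = 2 * r + 1\<close> the inner sum is the cost of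
  \<open>deq_left_loop\<close>.\<close>

definition tri :: "int list \<Rightarrow> nat" where "tri ps = (\<Sum>p\<leftarrow>ps. \<Sum>j\<le>nat (p div 2). j)"

lemma deq_unknot: "deq 0 (Cup i a # Cap i # v) (Cup i True # Cap i # v)"
proof (cases a)
  case False
  have "teq 0 0 (Cup i False # Cap i # v) (Cup i True # X i # Cap i # v)"
    by (rule mv; auto; fail)
  also have "teq 0 0 ... (Cup i True # Cap i # v)"
    by (rule teq_Cup teq_R1_cap)+
  finally show ?thesis using False by (simp add: teq_deq0)
qed (simp add: deq_refl)

lemma closed_0_unknot: "odd_pos ps \<Longrightarrow> deq (tri ps) (closed_cols a c 0 ps) unknot"
proof (induction ps arbitrary: c)
  case Nil
  have "deq 0 (closed_cols a c 0 []) ([Cup 0 a, Cup (Suc 0) c, Cap (SS 0), Cap 0])"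
    unfolding closed_cols_alt by (simp add: col_def) (intro deq_Cons deq_straighten_left)
  also have "deq 0 ... [Cup 0 a, Cap 0]"
    by (intro deq_Cons deq_straighten_right)
  also have "deq 0 ... unknot" unfolding unknot_def by (rule deq_unknot)
  finally show ?case by (simp add: tri_def)
next
  case (Cons p ps)
  then have p: "odd p" "0 < p" "odd_pos ps" by auto
  have "deq 0 (closed_cols a c 0 (p # ps)) (Cup 0 a # Cup (Suc 0) (\<not> c) # (Cup (Suc 0) c # col (SS 0) p @ [Cap (Suc 0)]) @ cols (SS 0) c ps @ [Cap (Suc 0), Cap 0])"
    using teq_deq0[OF closed_cols_Cons[of a c 0 p ps]] by (simp add: col_def)
  also have "deq (\<Sum>j\<le>nat (p div 2). j) ... (Cup 0 a # Cup (Suc 0) (\<not> c) # cols (SS 0) c ps @ [Cap (Suc 0), Cap 0])"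
    unfolding col_odd[OF p(1,2)] using deq_left_loop by (intro deq_Cons) simp
  also have "... = closed_cols a (\<not> c) 0 ps" by (simp add: closed_cols_alt col_def)
  also have "deq (tri ps) ... unknot" using Cons.IH p by blast
  finally show ?case by (simp add: tri_def)
qed

lemma closed_even_unknot:
  assumes "odd_pos ps" "even (length ps)"
  shows "deq (k * cost_down ps + tri ps) (closed_cols a c (- 2 * int k) ps) unknot"
proof (induction k)
  case 0 then show ?case using closed_0_unknot[OF assms(1)] by simp
next
  case (Suc k)
  have e: "- 2 * int (Suc k) = - 2 * int k - 2" by simp
  have "deq (cost_down ps) (closed_cols a c (- 2 * int k - 2) ps) (closed_cols a c (- 2 * int k) ps)"
    by (rule teq_deq0[OF teq_sym[OF closed_step_even]]) (use assms in auto)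
  from deq_trans[OF this Suc] show ?case unfolding e by (simp add: algebra_simps del: minus_mult_left)
qed

lemma closed_odd_unknot:
  assumes "odd_pos ps" "odd (length ps)"
  shows "deq (k * cost_down ps + (\<Sum>j<k. j) + tri ps) (closed_cols a c (2 * int k) ps) unknot"
proof (induction k)
  case 0 then show ?case using closed_0_unknot[OF assms(1)] by simp
next
  case (Suc k)
  have "deq (cost_down ps + k) (closed_cols a c (2 * int k + 2) ps) (closed_cols a c (2 * int k) ps)"
    by (rule teq_deq0[OF teq_sym[OF closed_step_odd]]) (use assms in auto)
  from deq_trans[OF this Suc] show ?case by (simp add: algebra_simps)
qed

section \<open>Standard form of the pretzel diagram\<close>

fun nest :: "nat \<Rightarrow> (nat \<Rightarrow> bool) \<Rightarrow> int list \<Rightarrow> diagram" where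
  "nest i d [] = []"
| "nest i d [p] = col i p"
| "nest i d (p # q # ps) = Cup (Suc i) (d 1) # col i p @ nest (SS i) (\<lambda>k. d (Suc k)) (q # ps) @ [Cap (Suc i)]"

lemma balanced_nest: "sum_list (map inputs (nest i d ps)) = sum_list (map outputs (nest i d ps))"
  by (induction i d ps rule: nest.induct) (auto simp: balanced_col)

lemma position_nest: "e \<in> set (nest i d ps) \<Longrightarrow> i \<le> position e"
  by (induction i d ps rule: nest.induct) (auto dest: position_col)

lemma upt_Suc_map: "m \<ge> 1 \<Longrightarrow> [1..<Suc m] = 1 # map Suc [1..<m]"
  by (simp add: map_Suc_upt upt_conv_Cons)

lemma flatten: "ps \<noteq> [] \<Longrightarrow> m = length ps \<Longrightarrow> teq n 0
   (map (\<lambda>k. Cup (i + 2 * k - 1) (d k)) [1..<m] @ concat (map (\<lambda>j. col (i + 2 * (j - 1)) (ps ! (j - 1))) [1..<Suc m]) @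
      map (\<lambda>k. Cap (i + 2 * k - 1)) (rev [1..<m]) @ v)
   (nest i d ps @ v)"
proof (induction i d ps arbitrary: m n v rule: nest.induct)
  case (2 i d p)
  then show ?case by (simp add: teq_refl)
next
  case (3 i d p q ps)
  define k where "k = length (q # ps)"
  have m: "m = Suc k" "k \<ge> 1" using 3 by (auto simp: k_def)
  let ?cups = "map (\<lambda>k. Cup (SS i + 2 * k - 1) (d (Suc k))) [1..<k]"
    and ?cs = "concat (map (\<lambda>j. col (SS i + 2 * (j - 1)) ((q # ps) ! (j - 1))) [1..<Suc k])"
    and ?caps = "map (\<lambda>k. Cap (SS i + 2 * k - 1)) (rev [1..<k])"
  have 1: "map (\<lambda>k. Cup (i + 2 * k - 1) (d k)) [1..<m] = Cup (Suc i) (d 1) # ?cups"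
    unfolding m(1) upt_Suc_map[OF m(2)] by simp
  have 2: "concat (map (\<lambda>j. col (i + 2 * (j - 1)) ((p # q # ps) ! (j - 1))) [1..<Suc m]) = col i p @ ?cs"
  proof -
    have "map (\<lambda>j. col (i + 2 * (j - 1)) ((p # q # ps) ! (j - 1))) [1..<Suc m] =
       col i p # map (\<lambda>j. col (i + 2 * j) ((p # q # ps) ! j)) [1..<Suc k]"
      unfolding m(1) using upt_Suc_map[of "Suc k"] by (simp add: comp_def)
    also have "map (\<lambda>j. col (i + 2 * j) ((p # q # ps) ! j)) [1..<Suc k] =
       map (\<lambda>j. col (SS i + 2 * (j - 1)) ((q # ps) ! (j - 1))) [1..<Suc k]"
    proof (rule map_cong[OF refl])
      fix j assume "j \<in> set [1..<Suc k]"
      then have "1 \<le> j" by (simp del: upt_Suc)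
      then obtain j' where "j = Suc j'" by (cases j) auto
      then show "col (i + 2 * j) ((p # q # ps) ! j) = col (SS i + 2 * (j - 1)) ((q # ps) ! (j - 1))" by simp
    qed
    finally show ?thesis by simp
  qed
  have caps: "map (\<lambda>k. Cap (i + 2 * k - 1)) (rev [1..<m]) = ?caps @ [Cap (Suc i)]"
    unfolding m(1) upt_Suc_map[OF m(2)] by (simp add: rev_map comp_def)
  have pos: "SS i \<le> position e" if "e \<in> set ?cups" for e using that by auto
  have "teq n 0 (Cup (Suc i) (d 1) # ?cups @ col i p @ ?cs @ ?caps @ Cap (Suc i) # v)
     (Cup (Suc i) (d 1) # col i p @ ?cups @ ?cs @ ?caps @ Cap (Suc i) # v)"
    by (intro teq_Cup far_words[of _ i]) (use pos in \<open>auto simp: col_def\<close>)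
  also have "teq n 0 ... (Cup (Suc i) (d 1) # col i p @ nest (SS i) (\<lambda>k. d (Suc k)) (q # ps) @ Cap (Suc i) # v)"
    by (intro teq_Cup teq_word[OF balanced_col] "3.IH") (simp_all add: k_def)
  finally show ?case unfolding 1 2 caps by simp
qed simp

lemma pretzel_nest: assumes "n \<ge> 1"
  shows "teq 0 0 (pretzel n p d) (Cup 0 (d 0) # nest 0 d (map p [1..<Suc n]) @ [Cap 0])"
proof -
  have "pretzel n p d = Cup 0 (d 0) # map (\<lambda>k. Cup (0 + 2 * k - 1) (d k)) [1..<n] @
     concat (map (\<lambda>j. col (0 + 2 * (j - 1)) (map p [1..<Suc n] ! (j - 1))) [1..<Suc n]) @
      map (\<lambda>k. Cap (0 + 2 * k - 1)) (rev [1..<n]) @ [Cap 0]"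
  proof -
    have e: "map (\<lambda>i. replicate (nat \<bar>p i\<bar>) (Cross (2 * (i - 1)) (p i > 0))) [1..<n + 1] =
        map (\<lambda>j. col (0 + 2 * (j - 1)) (map p [1..<Suc n] ! (j - 1))) [1..<Suc n]"
      by (rule map_cong) (auto simp: col_def nth_append simp del: upt_Suc)
    show ?thesis unfolding pretzel_def e by (simp del: upt_Suc)
  qed
  moreover have "teq 0 0 (Cup 0 (d 0) # map (\<lambda>k. Cup (0 + 2 * k - 1) (d k)) [1..<n] @
     concat (map (\<lambda>j. col (0 + 2 * (j - 1)) (map p [1..<Suc n] ! (j - 1))) [1..<Suc n]) @
      map (\<lambda>k. Cap (0 + 2 * k - 1)) (rev [1..<n]) @ [Cap 0])
     (Cup 0 (d 0) # nest 0 d (map p [1..<Suc n]) @ [Cap 0])"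
    by (intro teq_Cup flatten) (use assms in auto)
  ultimately show ?thesis by simp
qed

lemma cols_nest: "ps \<noteq> [] \<Longrightarrow> (\<And>k. 1 \<le> k \<Longrightarrow> k < length ps \<Longrightarrow> d k = (c = odd k)) \<Longrightarrow>
   deq 0 (cols i c ps) (nest i d ps)"
proof (induction i d ps arbitrary: c rule: nest.induct)
  case (2 i d p)
  have "deq 0 (cols i c [p]) (Cup (Suc i) c # col i p @ [Cap (SS i)])"
  proof -
    have "deq 0 ([Cap (SS i)] @ [Cup (SS i) (\<not> c), Cap (Suc i)]) [Cap (SS i)]"
      using deq_append_left[OF deq_straighten_left[of "Suc i" "\<not> c" "[]"], of "[Cap (SS i)]"] by simp
    from deq_append_left[OF this, of "Cup (Suc i) c # col i p"] show ?thesis by simp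
  qed
  also have "deq 0 ... (Cup (Suc i) c # Cap (SS i) # col i p)"
  proof -
    have "teq 2 0 ([Cap (SS i)] @ col i p @ []) (col i p @ [Cap (SS i)] @ [])"
      by (rule far_words[of _ i]) (auto simp: col_def)
    from teq_deq0[OF teq_Cup[OF teq_mono[OF teq_sym[OF this]]]] show ?thesis by simp
  qed
  also have "deq 0 ... (col i p)" by (rule deq_straighten_right)
  finally show ?case by simp
next
  case (3 i d p q ps)
  have "d 1 = c" using 3(3)[of 1] by simp
  have "deq 0 (cols (SS i) (\<not> c) (q # ps)) (nest (SS i) (\<lambda>k. d (Suc k)) (q # ps))"
    by (rule 3(1)) (use 3(3) in auto)
  from deq_context[OF this, of "Cup (Suc i) c # col i p" "[Cap (Suc i)]"] show ?case using \<open>d 1 = c\<close> by simp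
qed simp

lemma take_step: "step e xs = Some ys \<Longrightarrow> k \<le> position e \<Longrightarrow> k \<le> length xs \<Longrightarrow> take k ys = take k xs \<and> k \<le> length ys"
  by (cases e) (auto simp: step.simps split: if_splits)

lemma take_run: "run w xs = Some ys \<Longrightarrow> (\<And>e. e \<in> set w \<Longrightarrow> k \<le> position e) \<Longrightarrow> k \<le> length xs \<Longrightarrow> take k ys = take k xs \<and> k \<le> length ys"
proof (induction w arbitrary: xs)
  case (Cons e w)
  then obtain zs where zs: "step e xs = Some zs" "run w zs = Some ys" by (auto simp: bind_eq_Some_conv)
  have "take k zs = take k xs \<and> k \<le> length zs" by (rule take_step[OF zs(1)]) (use Cons in auto)
  with Cons.IH[OF zs(2)] Cons.prems(2) show ?case by auto
qed simp

lemma step_Cup_at: "length A = i \<Longrightarrow> step (Cup i a) (A @ B) = Some (A @ a # (\<not> a) # B)"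
  by (simp add: step.simps)

lemma step_Cap_at: "length A = i \<Longrightarrow> step (Cap i) (A @ x # y # B) = (if x \<noteq> y then Some (A @ B) else None)"
  by (auto simp: step.simps nth_append)

lemma step_Cross_at: "length A = i \<Longrightarrow> step (Cross i s) (A @ x # y # B) = Some (A @ y # x # B)"
  by (auto simp: step.simps nth_append)

lemma run_col_parallel: "length A = i \<Longrightarrow> run (col i p) (A @ x # x # B) = Some (A @ x # x # B)"
proof -
  assume "length A = i"
  then have "run (replicate m (Cross i s)) (A @ x # x # B) = Some (A @ x # x # B)" for m s
    by (induction m) (auto simp: step_Cross_at)
  then show ?thesis by (simp add: col_def)
qed

lemma run_replicate_Cross: "length A = i \<Longrightarrow>
    run (replicate m (Cross i s)) (A @ x # y # B) = Some (if even m then A @ x # y # B else A @ y # x # B)"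
  by (induction m arbitrary: x y) (auto simp: step_Cross_at)

lemma run_col: "length A = i \<Longrightarrow>
    run (col i p) (A @ x # y # B) = Some (if even p then A @ x # y # B else A @ y # x # B)"
  by (simp add: col_def run_replicate_Cross even_nat_iff)

text \<open>An odd column interchanges the directions of its two strands, yet its left strand has to
  leave with the direction \<open>x\<close> with which it entered. So the strands of every column
  are parallel, which makes the directions of the cups alternate.\<close>

lemma run_nest: "run (nest i d ps) (A @ x # y # B) = Some (A @ x # C) \<Longrightarrow> length A = i \<Longrightarrow> odd_pos ps \<Longrightarrow> ps \<noteq> [] \<Longrightarrow>
   (\<forall>k. 1 \<le> k \<longrightarrow> k < length ps \<longrightarrow> d k = (x = odd k)) \<and> y = (if even (length ps) then \<not> x else x)"
proof (induction i d ps arbitrary: A x C rule: nest.induct)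
  case (2 i d p)
  then show ?case by (auto simp: run_col)
next
  case (3 i d p q ps)
  let ?A = "A @ [d 1, x]" and ?w = "nest (SS i) (\<lambda>k. d (Suc k)) (q # ps)"
  have st: "step (Cup (Suc i) (d 1)) (A @ x # y # B) = Some (A @ x # d 1 # (\<not> d 1) # y # B)"
    using step_Cup_at[of "A @ [x]" "Suc i" "d 1" "y # B"] 3(3) by simp
  have "run (nest i d (p # q # ps)) (A @ x # y # B) =
     Option.bind (run ?w (?A @ (\<not> d 1) # y # B)) (run [Cap (Suc i)])"
    using run_col[of A i p x "d 1" "(\<not> d 1) # y # B"] 3(3,4) st by (simp add: run_append)
  with 3(2) have "Option.bind (run ?w (?A @ (\<not> d 1) # y # B)) (run [Cap (Suc i)]) = Some (A @ x # C)" by metis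
  then obtain zs where zs: "run ?w (?A @ (\<not> d 1) # y # B) = Some zs" "step (Cap (Suc i)) zs = Some (A @ x # C)"
    unfolding bind_eq_Some_conv by (auto split: bind_splits)
  have "take (SS i) zs = take (SS i) (?A @ (\<not> d 1) # y # B)"
    using take_run[OF zs(1), of "SS i"] position_nest 3(3) by fastforce
  then obtain Z where Z: "zs = A @ d 1 # x # Z" using 3(3)
    by (metis append.assoc append_Cons append_Nil append_eq_conv_conj append_take_drop_id length_append_singleton length_Cons length_append list.size(3) One_nat_def add_Suc_right add_0_right)
  with zs(2) obtain z Z' where Z': "Z = z # Z'" "x \<noteq> z"
    using step_Cap_at[of "A @ [d 1]" "Suc i" x _ _] 3(3) by (cases Z) (auto simp: step.simps nth_append split: if_splits)
  then have d: "A @ d 1 # Z' = A @ x # C" using zs(2) step_Cap_at[of "A @ [d 1]" "Suc i" x z Z'] 3(3) Z by simp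
  then have d1: "d 1 = x" by simp
  have "z = (\<not> d 1)" using Z' d1 by auto
  with zs(1) Z Z' have "run ?w (?A @ (\<not> d 1) # y # B) = Some (?A @ (\<not> d 1) # Z')" by simp
  from 3(1)[OF this] 3(3,4) have IH: "\<forall>k. 1 \<le> k \<longrightarrow> k < length (q # ps) \<longrightarrow> d (Suc k) = ((\<not> d 1) = odd k)"
     "y = (if even (length (q # ps)) then d 1 else \<not> d 1)" by auto
  show ?case
  proof (intro conjI allI impI)
    fix k assume k: "1 \<le> k" "k < length (p # q # ps)"
    show "d k = (x = odd k)"
    proof (cases "k = 1")
      case True then show ?thesis using d1 by simp
    next
      case False
      then obtain j where "k = Suc j" "1 \<le> j" using k by (cases k) auto
      then show ?thesis using IH(1) k d1 by auto
    qed
  qed (use IH(2) d1 in auto)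
qed simp

lemma run_cols: "length A = i \<Longrightarrow> y = (if even (length ps) then \<not> c else c) \<Longrightarrow>
   run (cols i c ps) (A @ c # y # B) = Some (A @ c # y # B)"
proof (induction i c ps arbitrary: A rule: cols.induct)
  case (1 i a)
  then show ?case by (auto simp: step_Cap_at step_Cup_at)
next
  case (2 i a p ps)
  have st: "step (Cup (Suc i) a) (A @ a # y # B) = Some (A @ a # a # (\<not> a) # y # B)"
    using step_Cup_at[of "A @ [a]" "Suc i" a "y # B"] 2(2) by simp
  have IH: "run (cols (SS i) (\<not> a) ps) (A @ a # a # (\<not> a) # y # B) = Some (A @ a # a # (\<not> a) # y # B)"
    using 2(1)[of "A @ [a, a]"] 2(2,3) by auto
  show ?case using step_Cap_at[of "A @ [a]" "Suc i" a "\<not> a" "y # B"] 2(2)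
    by (simp add: st run_append run_col_parallel IH)
qed

lemma link_closed_cols: assumes "even p \<or> a = c" "a = (if even (length ps) then \<not> c else c)"
  shows "link_diagram (closed_cols a c p ps)"
proof -
  have 1: "run (col 0 p) [a, c, \<not> c, \<not> a] = Some [a, c, \<not> c, \<not> a]"
    using run_col[of "[]" 0 p a c "[\<not> c, \<not> a]"] assms(1) by auto
  have 2: "run (cols (SS 0) (\<not> c) ps) [a, c, \<not> c, \<not> a] = Some [a, c, \<not> c, \<not> a]"
    using run_cols[of "[a, c]" "SS 0" "\<not> a" ps "\<not> c" "[]"] assms(2) by (auto split: if_splits)
  have 3: "run [Cap (Suc 0), Cap 0] [a, c, \<not> c, \<not> a] = Some []" by simp
  have "run (col 0 p @ cols (SS 0) (\<not> c) ps @ [Cap (Suc 0), Cap 0]) [a, c, \<not> c, \<not> a] = Some []"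
    by (simp only: run_append 1 2 3 bind.simps)
  then show ?thesis unfolding link_diagram_def closed_cols_alt by simp
qed

lemma pretzel_closed_cols:
  assumes "link_diagram (pretzel n p d)" "n \<ge> 1" "even (p 1)" "odd_pos (map p [2..<Suc n])"
  obtains a c where "isotopic (pretzel n p d) (closed_cols a c (p 1) (map p [2..<Suc n]))"
    "a = (if odd n then \<not> c else c)"
proof -
  let ?ps = "map p [2..<Suc n]"
  have "[1..<Suc n] = 1 # [2..<Suc n]" using assms(2) by (simp add: upt_conv_Cons numeral_2_eq_2 del: upt_Suc)
  then have ps: "map p [1..<Suc n] = p 1 # ?ps" by (simp del: upt_Suc)
  have len: "length ?ps = n - 1" by (simp del: upt_Suc)
  let ?N = "Cup 0 (d 0) # nest 0 d (p 1 # ?ps) @ [Cap 0]"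
  have iso: "link_diagram ?N" "isotopic (pretzel n p d) ?N"
    using pretzel_nest[OF assms(2), of p d] assms(1) unfolding tangle_rel_def ps
    by (metis append_Nil append_Nil2 ddist_0 le0 run.simps(1))+
  \<comment> \<open>For \<open>n = 1\<close> there is no inner cup; \<open>c\<close> is then the
    direction of the zigzag in \<open>closed_cols\<close> and is free, so it is chosen to satisfy
    the parity condition.\<close>
  define c where "c = (if n = 1 then \<not> d 0 else d 1)"
  have *: "d 0 = (if odd n then \<not> c else c) \<and> (\<forall>k. 1 \<le> k \<longrightarrow> k < n \<longrightarrow> d k = (c = odd k))"
  proof (cases ?ps)
    case Nil
    then have "n = 1" using assms(2) len by simp
    then show ?thesis by (simp add: c_def)
  next
    case (Cons q qs)
    then have n: "n \<noteq> 1" using len unfolding Cons by simp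
    let ?w = "nest (SS 0) (\<lambda>k. d (Suc k)) ?ps"
    have 1: "run (col 0 (p 1)) [d 0, d 1, \<not> d 1, \<not> d 0] = Some [d 0, d 1, \<not> d 1, \<not> d 0]"
      using run_col[of "[]" 0 "p 1" "d 0" "d 1" "[\<not> d 1, \<not> d 0]"] assms(3) by auto
    have "run ?N [] = Option.bind (run ?w [d 0, d 1, \<not> d 1, \<not> d 0]) (run [Cap (Suc 0), Cap 0])"
      unfolding Cons using 1 by (simp add: run_append)
    then obtain zs where zs: "run ?w [d 0, d 1, \<not> d 1, \<not> d 0] = Some zs" "run [Cap (Suc 0), Cap 0] zs = Some []"
      using iso(1) by (auto simp: link_diagram_def bind_eq_Some_conv)
    have "length zs = 4" using run_length[OF zs(1)] balanced_nest[of "SS 0" "\<lambda>k. d (Suc k)" ?ps] by simp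
    then obtain w x y z where z: "zs = [w, x, y, z]"
      by (auto simp: numeral_eq_Suc length_Suc_conv)
    have "take 2 zs = take 2 [d 0, d 1, \<not> d 1, \<not> d 0]"
      using take_run[OF zs(1), of 2] position_nest by (fastforce simp: numeral_2_eq_2)
    then have "w = d 0" "x = d 1" using z by auto
    with zs(2) z have "y = (\<not> d 1)" by (auto split: if_splits)
    with zs(1) z \<open>w = d 0\<close> \<open>x = d 1\<close>
    have zs': "run ?w ([d 0, d 1] @ (\<not> d 1) # (\<not> d 0) # []) = Some ([d 0, d 1] @ (\<not> d 1) # [z])" by simp
    have "(\<forall>k. 1 \<le> k \<longrightarrow> k < length ?ps \<longrightarrow> d (Suc k) = ((\<not> d 1) = odd k)) \<and>
        (\<not> d 0) = (if even (length ?ps) then \<not> \<not> d 1 else \<not> d 1)"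
      by (rule run_nest[OF zs' _ assms(4)]) (simp_all only: Cons, simp_all)
    then have r: "\<forall>k. 1 \<le> k \<longrightarrow> k < n - 1 \<longrightarrow> d (Suc k) = ((\<not> d 1) = odd k)" "(\<not> d 0) = (if even (n - 1) then d 1 else \<not> d 1)"
      unfolding len by simp_all
    have "d k = (d 1 = odd k)" if k: "1 \<le> k" "k < n" for k
    proof (cases "k = 1")
      case False
      then obtain j where "k = Suc j" "1 \<le> j" using k False by (cases k) auto
      then show ?thesis using r(1) k by auto
    qed simp
    moreover have "even (n - 1) \<longleftrightarrow> odd n" using assms(2) by auto
    then have "d 0 = (if odd n then \<not> d 1 else d 1)" using r(2) by (cases "odd n"; cases "d 0"; cases "d 1") simp_all
    moreover have "c = d 1" using n by (simp add: c_def)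
    ultimately show ?thesis by blast
  qed
  have "deq 0 (cols 0 c (p 1 # ?ps)) (nest 0 d (p 1 # ?ps))"
  proof (rule cols_nest)
    fix k assume "1 \<le> k" "k < length (p 1 # ?ps)"
    then have "1 \<le> k" "k < n" using len assms(2) by simp_all
    then show "d k = (c = odd k)" using * by blast
  qed simp
  from deq_context[OF this, of "[Cup 0 (d 0)]" "[Cap 0]"]
  have "deq 0 (closed_cols (d 0) c (p 1) ?ps) ?N" unfolding closed_cols_def by simp
  moreover have "link_diagram (closed_cols (d 0) c (p 1) ?ps)"
  proof (rule link_closed_cols)
    have "even (n - 1) \<longleftrightarrow> odd n" using assms(2) by auto
    then show "d 0 = (if even (length ?ps) then \<not> c else c)" unfolding len using conjunct1[OF *] by simp
  qed (use assms(3) in simp)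
  ultimately have "isotopic (closed_cols (d 0) c (p 1) ?ps) ?N"
    unfolding deq_def by (metis append_Nil append_Nil2 ddist_0)
  from isotopic_trans[OF iso(2) isotopic_sym[OF this]]
  have "isotopic (pretzel n p d) (closed_cols (d 0) c (p 1) ?ps)" .
  then show ?thesis using that[of "d 0" c] conjunct1[OF *] by blast
qed

section \<open>Skein theory\<close>

locale conway =
  fixes f :: "diagram \<Rightarrow> int poly"
  assumes conway: "is_conway_polynomial f"
begin

lemma f_isotopic: "link_diagram D \<Longrightarrow> link_diagram E \<Longrightarrow> isotopic D E \<Longrightarrow> f D = f E"
  and f_unknot: "f unknot = 1"
  and f_skein: "run u [] = Some xs \<Longrightarrow> i + 1 < length xs \<Longrightarrow> xs ! i \<Longrightarrow> xs ! (i + 1) \<Longrightarrow> link_diagram (u @ v) \<Longrightarrow>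
     f (u @ X i # v) - f (u @ Y i # v) = [:0, 1:] * f (u @ v)"
  using conway unfolding is_conway_polynomial_def by (blast, blast, fastforce)

lemma f_deq: "deq 0 l r \<Longrightarrow> link_diagram (u @ l @ v) \<Longrightarrow> f (u @ l @ v) = f (u @ r @ v)"
  unfolding deq_def using f_isotopic by (metis ddist_0)

lemma f_deq_right: "deq 0 l r \<Longrightarrow> link_diagram (u @ l) \<Longrightarrow> f (u @ l) = f (u @ r)"
  using f_deq[of l r u "[]"] by simp

lemma link_iff: "run u [] = Some xs \<Longrightarrow> link_diagram (u @ v) \<longleftrightarrow> run v xs = Some []"
  by (simp add: link_diagram_def run_append)

section \<open>The skein relation for arbitrary directions of the strands\<close>

text \<open>A quarter turn of a crossing interchanges the strands that run from bottom left to top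
  right, and hence the flag of the crossing. It carries the skein axiom, which speaks of upward
  strands only, to other directions.\<close>

lemma rotate_left: "deq 0 (Cup i a # Cross (Suc i) t # Cap (SS i) # v) (Cross i (\<not> t) # v)"
proof -
  have "teq 0 0 (Cup i a # Cross (Suc i) t # Cap (SS i) # v) (Cup (Suc i) a # Cross i (\<not> t) # Cap (SS i) # v)"
    by (rule mv; auto; fail)
  also have "teq 0 0 ... (Cup (Suc i) a # Cap (SS i) # Cross i (\<not> t) # v)"
    by (intro teq_Cup) (rule mv; auto; fail)
  finally have "deq 0 (Cup i a # Cross (Suc i) t # Cap (SS i) # v) (Cup (Suc i) a # Cap (SS i) # Cross i (\<not> t) # v)"
    by (rule teq_deq0)
  also have "deq 0 ... (Cross i (\<not> t) # v)" by (rule deq_straighten_right)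
  finally show ?thesis .
qed

lemma rotate_right: "deq 0 (Cup (SS i) a # Cross (Suc i) t # Cap i # v) (Cross i (\<not> t) # v)"
proof -
  have "teq 0 0 (Cup (SS i) a # Cross (Suc i) t # Cap i # v) (Cup (SS i) a # Cross i (\<not> t) # Cap (Suc i) # v)"
    by (intro teq_Cup) (rule mv; auto; fail)
  also have "teq 0 0 ... (Cross i (\<not> t) # Cup (SS i) a # Cap (Suc i) # v)"
    by (rule mv; auto; fail)
  finally have "deq 0 (Cup (SS i) a # Cross (Suc i) t # Cap i # v) (Cross i (\<not> t) # Cup (SS i) a # Cap (Suc i) # v)"
    by (rule teq_deq0)
  also have "deq 0 ... (Cross i (\<not> t) # v)" by (intro deq_Cons deq_straighten_left)
  finally show ?thesis .
qed

text \<open>A quarter turn makes both strands run upwards. It exchanges the two crossings, whence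
  the minus sign, and turns the smoothing into a cap followed by a cup.\<close>

lemma skein_anti1:
  assumes "run u [] = Some (A @ True # False # B)" "length A = i" "link_diagram (u @ Cross i s # v)"
  shows "f (u @ X i # v) - f (u @ Y i # v) = - ([:0, 1:] * f (u @ Cap i # Cup i False # v))"
proof -
  have v: "run v (A @ False # True # B) = Some []"
    using assms link_iff[OF assms(1)] by (simp add: step_Cross_at)
  let ?u = "u @ [Cup i False]"
  have u: "run ?u [] = Some (A @ False # True # True # False # B)"
    using assms by (simp add: run_append step_Cup_at)
  have c: "step (Cap (SS i)) (A @ False # True # True # False # B) = Some (A @ False # True # B)"
    using step_Cap_at[of "A @ [False, True]" "SS i" True False B] assms(2) by simp
  have x: "step (Cross (Suc i) t) (A @ False # True # True # False # B) = Some (A @ False # True # True # False # B)" for t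
    using step_Cross_at[of "A @ [False]" "Suc i" t True True "False # B"] assms(2) by simp
  have l: "link_diagram (?u @ Cap (SS i) # v)" "link_diagram (?u @ Cross (Suc i) t # Cap (SS i) # v)" for t
    using link_iff[OF u] v by (simp_all add: c x)
  have r: "f (?u @ Cross (Suc i) t # Cap (SS i) # v) = f (u @ Cross i (\<not> t) # v)" for t
    using f_deq_right[OF rotate_left[of i False t v], of u] l(2) by simp
  have "f (?u @ X (Suc i) # Cap (SS i) # v) - f (?u @ Y (Suc i) # Cap (SS i) # v) =
      [:0, 1:] * f (?u @ Cap (SS i) # v)"
    by (rule f_skein[OF u]) (use assms(2) l in \<open>simp_all add: nth_append\<close>)
  moreover have "f (?u @ Cap (SS i) # v) = f (u @ Cap i # Cup i False # v)"
    using f_deq_right[OF teq_deq0[OF teq_sym[OF far_Cap_Cup[of i i 0 False v]]], of u] l(1) by simp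
  ultimately show ?thesis unfolding r by (simp add: algebra_simps)
qed

lemma skein_anti2:
  assumes "run u [] = Some (A @ False # True # B)" "length A = i" "link_diagram (u @ Cross i s # v)"
  shows "f (u @ X i # v) - f (u @ Y i # v) = - ([:0, 1:] * f (u @ Cap i # Cup i True # v))"
proof -
  have v: "run v (A @ True # False # B) = Some []"
    using assms link_iff[OF assms(1)] by (simp add: step_Cross_at)
  let ?u = "u @ [Cup (SS i) True]"
  have u: "run ?u [] = Some (A @ False # True # True # False # B)"
    using assms step_Cup_at[of "A @ [False, True]" "SS i" True B] by (simp add: run_append)
  have c: "step (Cap i) (A @ False # True # True # False # B) = Some (A @ True # False # B)"
    using step_Cap_at[of A i False True] assms(2) by simp
  have x: "step (Cross (Suc i) t) (A @ False # True # True # False # B) = Some (A @ False # True # True # False # B)" for t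
    using step_Cross_at[of "A @ [False]" "Suc i" t True True "False # B"] assms(2) by simp
  have l: "link_diagram (?u @ Cap i # v)" "link_diagram (?u @ Cross (Suc i) t # Cap i # v)" for t
    using link_iff[OF u] v by (simp_all add: c x)
  have r: "f (?u @ Cross (Suc i) t # Cap i # v) = f (u @ Cross i (\<not> t) # v)" for t
    using f_deq_right[OF rotate_right[of i True t v], of u] l(2) by simp
  have "f (?u @ X (Suc i) # Cap i # v) - f (?u @ Y (Suc i) # Cap i # v) =
      [:0, 1:] * f (?u @ Cap i # v)"
    by (rule f_skein[OF u]) (use assms(2) l in \<open>simp_all add: nth_append\<close>)
  moreover have "f (?u @ Cap i # v) = f (u @ Cap i # Cup i True # v)"
    using f_deq_right[OF teq_deq0[OF far_Cup_Cap[of i i 0 True v]], of u] l(1) by simp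
  ultimately show ?thesis unfolding r by (simp add: algebra_simps)
qed

lemma skein_anti:
  assumes "run u [] = Some (A @ x # (\<not> x) # B)" "length A = i" "link_diagram (u @ Cross i s # v)"
  shows "f (u @ X i # v) - f (u @ Y i # v) = - ([:0, 1:] * f (u @ Cap i # Cup i (\<not> x) # v))"
  using skein_anti1[OF _ assms(2,3), of B] skein_anti2[OF _ assms(2,3), of B] assms(1) by (cases x) auto

text \<open>Two downward strands become antiparallel by a quarter turn, so \<open>skein_anti\<close>
  applies; the two changes of sign cancel.\<close>

lemma skein_parallel:
  assumes "run u [] = Some (A @ x # x # B)" "length A = i" "link_diagram (u @ v)"
  shows "f (u @ X i # v) - f (u @ Y i # v) = [:0, 1:] * f (u @ v)"
proof (cases x)
  case True
  show ?thesis by (rule f_skein[OF assms(1)]) (use assms True in \<open>simp_all add: nth_append\<close>)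
next
  case False
  then have v: "run v (A @ False # False # B) = Some []"
    using assms link_iff[OF assms(1)] by simp
  let ?u = "u @ [Cup i False]"
  have u: "run ?u [] = Some ((A @ [False]) @ True # (\<not> True) # False # B)"
    using assms False by (simp add: run_append step_Cup_at)
  have c: "step (Cap (SS i)) (A @ False # False # True # False # B) = Some (A @ False # False # B)"
    using step_Cap_at[of "A @ [False, False]" "SS i" True False B] assms(2) by simp
  have x: "step (Cross (Suc i) t) (A @ False # True # False # False # B) = Some (A @ False # False # True # False # B)" for t
    using step_Cross_at[of "A @ [False]" "Suc i" t True False "False # B"] assms(2) by simp
  have l: "link_diagram (?u @ Cross (Suc i) t # Cap (SS i) # v)" for t
    using link_iff[OF u] v by (simp add: c x)
  have r: "f (?u @ Cross (Suc i) t # Cap (SS i) # v) = f (u @ Cross i (\<not> t) # v)" for t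
    using f_deq_right[OF rotate_left[of i False t v], of u] l by simp
  have c1: "step (Cap (Suc i)) (A @ False # True # False # False # B) = Some (A @ False # False # B)"
    using step_Cap_at[of "A @ [False]" "Suc i" True False "False # B"] assms(2) by simp
  have c2: "step (Cup (Suc i) False) (A @ False # False # B) = Some (A @ False # False # True # False # B)"
    using step_Cup_at[of "A @ [False]" "Suc i" False "False # B"] assms(2) by simp
  have l2: "link_diagram (?u @ Cap (Suc i) # Cup (Suc i) False # Cap (SS i) # v)"
    using link_iff[OF u] v by (simp add: c c1 c2)
  have "f (?u @ X (Suc i) # Cap (SS i) # v) - f (?u @ Y (Suc i) # Cap (SS i) # v) =
      - ([:0, 1:] * f (?u @ Cap (Suc i) # Cup (Suc i) (\<not> True) # Cap (SS i) # v))"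
    by (rule skein_anti[OF u _ l]) (use assms(2) in simp)
  moreover have "f (?u @ Cap (Suc i) # Cup (Suc i) False # Cap (SS i) # v) = f (u @ v)"
    using f_deq_right[OF deq_trans0[OF deq_straighten_right deq_straighten_right], of u i False "Suc i" False v] l2 by simp
  ultimately show ?thesis unfolding r by (simp add: algebra_simps)
qed

lemma circle_direction: "link_diagram (u @ Cup i a # Cap i # v) \<Longrightarrow> f (u @ Cup i a # Cap i # v) = f (u @ Cup i b # Cap i # v)"
proof -
  assume l: "link_diagram (u @ Cup i a # Cap i # v)"
  then have l': "link_diagram (u @ Cup i True # Cap i # v)" using deq_unknot[of i a v] unfolding deq_def by (metis append_Nil2)
  have "teq 0 0 (Cup i True # Cap i # v) (Cup i b # Cap i # v)"
  proof (cases b)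
    case False
    have "teq 0 0 (Cup i True # Cap i # v) (Cup i True # X i # Cap i # v)"
      by (intro teq_Cup) (rule mv)
    also have "teq 0 0 ... (Cup i False # Cap i # v)" by (rule mv; auto; fail)
    finally show ?thesis using False by simp
  qed (simp add: teq_refl)
  from f_deq_right[OF teq_deq0[OF this] l'] f_deq_right[OF deq_unknot l] show ?thesis by simp
qed

lemma z_cancel: "([:0, 1:] :: int poly) * p = 0 \<Longrightarrow> p = 0" by simp

text \<open>Smoothing a crossing in a curl splits off a circle. Curls of either sign can be removed,
  so the skein relation reads \<open>0 = z * f\<close> for the split diagram. The curl is put on a
  strand to the right of the circle if there is one, otherwise to its left.\<close>

lemma split_level:
  assumes "run u [] = Some xs" "xs \<noteq> []" "link_diagram (u @ Cup i a # Cap i # v)"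
  shows "f (u @ Cup i a # Cap i # v) = 0"
proof -
  have i: "i \<le> length xs" using assms by (auto simp: link_diagram_def run_append step.simps split: if_splits)
  have v: "run v xs = Some []"
    using assms i step_Cup_at[of "take i xs" i a "drop i xs"] step_Cap_at[of "take i xs" i a "\<not> a" "drop i xs"]
    by (auto simp: link_diagram_def run_append)
  show ?thesis
  proof (cases "i < length xs")
    case True
    define A x B where "A = take i xs" and "x = xs ! i" and "B = drop (Suc i) xs"
    have xs: "xs = A @ x # B" "length A = i" using True by (auto simp: A_def x_def B_def id_take_nth_drop)
    have u: "run (u @ [Cup i (\<not> x)]) [] = Some ((A @ [\<not> x]) @ x # x # B)"
      using assms(1) xs by (simp add: run_append step_Cup_at)
    have s: "step (Cap i) (A @ (\<not> x) # x # x # B) = Some (A @ x # B)"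
       "step (Cross (Suc i) t) (A @ (\<not> x) # x # x # B) = Some (A @ (\<not> x) # x # x # B)" for t
      using step_Cap_at[of A i "\<not> x" x "x # B"] step_Cross_at[of "A @ [\<not> x]" "Suc i" t x x B] xs(2) by simp_all
    have l: "link_diagram ((u @ [Cup i (\<not> x)]) @ Cross (Suc i) t # Cap i # v)"
      "link_diagram ((u @ [Cup i (\<not> x)]) @ Cap i # v)" for t
      using link_iff[OF u] v xs(1) by (simp_all add: s)
    have "f ((u @ [Cup i (\<not> x)]) @ X (Suc i) # Cap i # v) - f ((u @ [Cup i (\<not> x)]) @ Y (Suc i) # Cap i # v) =
       [:0, 1:] * f ((u @ [Cup i (\<not> x)]) @ Cap i # v)"
      by (rule skein_parallel[OF u _ l(2)]) (use xs in simp)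
    moreover have "f ((u @ [Cup i (\<not> x)]) @ Cross (Suc i) t # Cap i # v) = f (u @ v)" for t
      using f_deq_right[OF deq_left_curl[of i "\<not> x" t v], of u] l(1) by simp
    ultimately have "f (u @ Cup i (\<not> x) # Cap i # v) = 0" using z_cancel by simp
    then show ?thesis using circle_direction[OF assms(3)] by metis
  next
    case False
    then have ii: "i = length xs" using i by simp
    define A x where "A = butlast xs" and "x = last xs"
    have xs: "xs = A @ [x]" "Suc (length A) = i" using assms(2) ii by (auto simp: A_def x_def)
    define j where "j = length A"
    have j: "i = Suc j" "length A = j" using xs by (auto simp: j_def)
    have u: "run (u @ [Cup (Suc j) x]) [] = Some (A @ x # x # [\<not> x])"
      using assms(1) xs step_Cup_at[of "A @ [x]" "Suc j" x "[]"] j(2) by (simp add: run_append)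
    have s: "step (Cap (Suc j)) (A @ x # x # [\<not> x]) = Some (A @ [x])"
       "step (Cross j t) (A @ x # x # [\<not> x]) = Some (A @ x # x # [\<not> x])" for t
      using step_Cap_at[of "A @ [x]" "Suc j" x "\<not> x" "[]"] step_Cross_at[of A j t x x "[\<not> x]"] j(2) by simp_all
    have l: "link_diagram ((u @ [Cup (Suc j) x]) @ Cross j t # Cap (Suc j) # v)"
      "link_diagram ((u @ [Cup (Suc j) x]) @ Cap (Suc j) # v)" for t
      using link_iff[OF u] v xs(1) by (simp_all add: s)
    have "f ((u @ [Cup (Suc j) x]) @ X j # Cap (Suc j) # v) - f ((u @ [Cup (Suc j) x]) @ Y j # Cap (Suc j) # v) =
       [:0, 1:] * f ((u @ [Cup (Suc j) x]) @ Cap (Suc j) # v)"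
      by (rule skein_parallel[OF u j(2) l(2)])
    moreover have "f ((u @ [Cup (Suc j) x]) @ Cross j t # Cap (Suc j) # v) = f (u @ v)" for t
      using f_deq_right[OF deq_right_curl[of j x t v], of u] l(1) by simp
    ultimately have "f (u @ Cup (Suc j) x # Cap (Suc j) # v) = 0" using z_cancel by simp
    then show ?thesis using circle_direction[OF assms(3)] j(1) by metis
  qed
qed

text \<open>If the level below the circle is empty, the circle is first moved below the last cap of
  \<open>u\<close>, where it has a neighbouring strand.\<close>

lemma split_link:
  assumes "u \<noteq> []" "link_diagram (u @ Cup i a # Cap i # v)"
  shows "f (u @ Cup i a # Cap i # v) = 0"
proof -
  obtain xs where xs: "run u [] = Some xs" using assms(2) by (auto simp: link_diagram_append)
  show ?thesis
  proof (cases "xs = []")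
    case False then show ?thesis using split_level[OF xs _ assms(2)] by simp
  next
    case True
    obtain u' e where u: "u = u' @ [e]" using assms(1) by (cases u rule: rev_cases) auto
    then obtain ys where ys: "run u' [] = Some ys" "step e ys = Some []" using xs True
      by (auto simp: run_append bind_eq_Some_conv)
    then have e: "e = Cap 0" "ys \<noteq> []" by (cases e; auto simp: step.simps split: if_splits)+
    have i: "i = 0" using assms(2) xs True by (cases i) (auto simp: link_diagram_def run_append step_Suc_Nil)
    have "teq 0 0 (Cap 0 # Cup 0 a # Cap 0 # v) (Cup 0 a # Cap (SS 0) # Cap 0 # v)"
      by (rule mv; auto; fail)
    also have "teq 0 0 ... (Cup 0 a # Cap 0 # Cap 0 # v)"
      by (intro teq_Cup) (rule mv; auto; fail)
    finally have d: "deq 0 (Cap 0 # Cup 0 a # Cap 0 # v) (Cup 0 a # Cap 0 # Cap 0 # v)" by (rule teq_deq0)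
    have l: "link_diagram (u' @ Cap 0 # Cup 0 a # Cap 0 # v)" using assms(2) u e i by simp
    then have "link_diagram (u' @ Cup 0 a # Cap 0 # Cap 0 # v)" using d unfolding deq_def by (metis append_Nil2)
    from split_level[OF ys(1) e(2) this] f_deq_right[OF d l] show ?thesis using u e i by simp
  qed
qed

section \<open>The constant coefficient\<close>

text \<open>
  The constant coefficient does not change if a crossing is switched. The relation \<open>ceq\<close> therefore disregards
  the signs of crossings, and only the sign \<^term>\<open>True\<close> is used.
\<close>

definition h :: "diagram \<Rightarrow> int" where "h D = coeff (f D) 0"

abbreviation ceq :: "nat \<Rightarrow> diagram \<Rightarrow> diagram \<Rightarrow> bool" where
  "ceq n \<equiv> tangle_rel n (\<lambda>D E. h D = h E)"

lemma ceq_refl: "ceq n l l" by (simp add: tangle_rel_def)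

lemma ceq_sym: "ceq n l r \<Longrightarrow> ceq n r l" unfolding tangle_rel_def by metis

lemma ceq_trans [trans]: "ceq n l m \<Longrightarrow> ceq n m r \<Longrightarrow> ceq n l r" unfolding tangle_rel_def by metis

lemma ceq_teq: "teq n 0 l r \<Longrightarrow> ceq n l r"
  unfolding tangle_rel_def ddist_0 h_def using f_isotopic by metis

lemma link_Cross_split:
  assumes "link_diagram (u @ Cross i s # v)"
  obtains A x y B where "run u [] = Some (A @ x # y # B)" "length A = i" "run v (A @ y # x # B) = Some []"
proof -
  from assms obtain xs ys where xs: "run u [] = Some xs" "step (Cross i s) xs = Some ys" "run v ys = Some []"
    by (auto simp: link_diagram_def run_append bind_eq_Some_conv)
  then have "i + 1 < length xs" by (auto simp: step.simps split: if_splits)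
  then have "xs = take i xs @ xs ! i # xs ! (i + 1) # drop (i + 2) xs" "length (take i xs) = i"
    using split2[of i xs] by auto
  then obtain A x y B where A: "xs = A @ x # y # B" "length A = i" by blast
  then have "ys = A @ y # x # B" using xs(2) step_Cross_at by simp
  with that A xs show ?thesis by blast
qed

lemma h_crossing_change: assumes "link_diagram (u @ Cross i s # v)" shows "h (u @ Cross i s # v) = h (u @ Cross i t # v)"
proof -
  obtain A x y B where A: "run u [] = Some (A @ x # y # B)" "length A = i" "run v (A @ y # x # B) = Some []"
    using assms by (rule link_Cross_split)
  have "\<exists>q. f (u @ X i # v) - f (u @ Y i # v) = [:0, 1:] * q"
  proof (cases "y = x")
    case True
    have "link_diagram (u @ v)" using A True by (simp add: link_diagram_def run_append)
    from skein_parallel[OF A(1)[unfolded True] A(2) this] show ?thesis by blast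
  next
    case False
    then have y: "y = (\<not> x)" by auto
    from skein_anti[OF A(1)[unfolded y] A(2) assms] show ?thesis by (metis mult_minus_right)
  qed
  then have "h (u @ X i # v) = h (u @ Y i # v)"
    unfolding h_def by (metis coeff_diff coeff_pCons_0 eq_iff_diff_eq_0 mult_pCons_left mult_zero_left smult_0_left add_0)
  then show ?thesis by (cases s; cases t) auto
qed

lemma ceq_sign: "ceq n (Cross i s # v) (Cross i t # v)"
proof -
  have "link_diagram (u @ Cross i s # v) \<Longrightarrow> link_diagram (u @ Cross i t # v)" for u s t v
    by (erule link_Cross_split) (auto simp: link_diagram_def run_append step_Cross_at)
  then show ?thesis unfolding tangle_rel_def using h_crossing_change by (metis append_Cons)
qed

lemma x_slide_cup: "ceq n (Cup i a # X (Suc i) # v) (Cup (Suc i) a # X i # v)"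
  using ceq_trans[OF ceq_teq[OF slide_cup[of False True n i a v]] teq_Cup[OF ceq_sign]] by simp

lemma x_slide_cap: "ceq n (X i # Cap (Suc i) # v) (X (Suc i) # Cap i # v)"
  using ceq_trans[OF ceq_teq[OF slide_cap[of False True n i v]] ceq_sign] by simp

lemma x_R1_cap: "ceq n (X i # Cap i # v) (Cap i # v)"
  by (rule ceq_teq[OF teq_R1_cap])

lemma x_R3: "ceq n (X i # X (Suc i) # X i # v) (X (Suc i) # X i # X (Suc i) # v)"
  by (rule ceq_teq[OF teq_R3]) simp

lemma x_R2: "SS i \<le> n \<Longrightarrow> ceq n (X i # X i # v) v"
  using ceq_trans[OF teq_Cross[OF ceq_sign[of n i True v False]] ceq_teq[OF teq_R2_gen[of i n False True v]]] by simp

lemmas x_far = far_Cross_Cross[THEN ceq_teq] far_Cap_Cross[THEN ceq_teq] far_Cross_Cap[THEN ceq_teq] far_Cap_Cap[THEN ceq_teq]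
  far_Cross_Cup[THEN ceq_teq]
lemmas x_moves = x_far x_far[THEN ceq_sym] x_slide_cup x_slide_cap x_R1_cap x_R3 x_R2
  x_slide_cup[THEN ceq_sym] x_slide_cap[THEN ceq_sym] x_R1_cap[THEN ceq_sym] x_R2[THEN ceq_sym]

text \<open>
  A cap which joins the strands \<open>a\<close> and \<open>a + k + 1\<close>, crossing those in between.
\<close>

fun pull :: "nat \<Rightarrow> nat \<Rightarrow> diagram" where
  "pull a 0 = [Cap a]"
| "pull a (Suc k) = X (a + k + 1) # pull a k"

lemma position_pull: "e \<in> set (pull a k) \<Longrightarrow> a \<le> position e"
  by (induction k) auto

lemma pull_shift: "map (shift \<circ> shift) (pull a k) = pull (SS a) k"
  by (induction k) auto

lemma pull_far_left: "SS j \<le> a \<Longrightarrow> ceq n (X j # pull a k @ v) (pull a k @ X j # v)"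
  by (rule ceq_sym[OF ceq_teq[OF far_word]]) (auto dest: position_pull)

lemma pull_far_right: "a + k \<le> m \<Longrightarrow> ceq n (X (SS m) # pull a k @ v) (pull a k @ X m # v)"
proof (induction k)
  case (Suc k)
  have "ceq n (X (SS m) # X (a + k + 1) # pull a k @ v) (X (a + k + 1) # X (SS m) # pull a k @ v)"
    by (rule x_moves) (use Suc in auto)
  also have "ceq n ... (X (a + k + 1) # pull a k @ X m # v)" by (rule teq_Cross) (use Suc in auto)
  finally show ?case by simp
qed (auto intro: x_moves)

lemma pull_far_right_Cap: "a + k \<le> m \<Longrightarrow> ceq n (Cap (SS m) # pull a k @ v) (pull a k @ Cap m # v)"
proof (induction k)
  case (Suc k)
  have "ceq n (Cap (SS m) # X (a + k + 1) # pull a k @ v) (X (a + k + 1) # Cap (SS m) # pull a k @ v)"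
    by (rule x_moves) (use Suc in auto)
  also have "ceq n ... (X (a + k + 1) # pull a k @ Cap m # v)" by (rule teq_Cross) (use Suc in auto)
  finally show ?case by simp
qed (auto intro: x_moves)

lemma pull_left: "ceq n (X a # pull (Suc a) k @ v) (pull a (Suc k) @ v)"
proof (induction k)
  case 0 then show ?case using x_slide_cap by simp
next
  case (Suc k)
  have "ceq n (X a # X (Suc a + k + 1) # pull (Suc a) k @ v) (X (Suc a + k + 1) # X a # pull (Suc a) k @ v)"
    by (rule x_moves) auto
  also have "ceq n ... (X (Suc a + k + 1) # pull a (Suc k) @ v)" by (rule teq_Cross[OF Suc])
  finally show ?case by simp
qed

lemma pull_right: "SS a \<le> n \<Longrightarrow> ceq n (X a # pull a (Suc k) @ v) (pull (Suc a) k @ v)"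
  using ceq_trans[OF teq_Cross[OF ceq_sym[OF pull_left]] x_R2] .

lemma pull_inner: "m + 2 \<le> k \<Longrightarrow> ceq n (X (a + m + 1) # pull a k @ v) (pull a k @ X (a + m) # v)"
proof (induction k)
  case (Suc k)
  show ?case
  proof (cases "m + 2 \<le> k")
    case True
    have "ceq n (X (a + m + 1) # X (a + k + 1) # pull a k @ v) (X (a + k + 1) # X (a + m + 1) # pull a k @ v)"
      by (rule x_moves) (use True in auto)
    also have "ceq n ... (X (a + k + 1) # pull a k @ X (a + m) # v)" by (rule teq_Cross[OF Suc.IH[OF True]])
    finally show ?thesis by simp
  next
    case False
    then have k: "k = Suc m" using Suc by simp
    have "ceq n (X (Suc (a + m)) # X (SS (a + m)) # X (Suc (a + m)) # pull a m @ v)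
       (X (SS (a + m)) # X (Suc (a + m)) # X (SS (a + m)) # pull a m @ v)"
      by (rule x_moves)
    also have "ceq n ... (X (SS (a + m)) # X (Suc (a + m)) # pull a m @ X (a + m) # v)"
      by (intro teq_Cross pull_far_right) simp
    finally show ?thesis by (simp add: k)
  qed
qed simp

lemma pull_Cap_low: "j \<le> a \<Longrightarrow> ceq n (Cap j # pull a k @ v) (pull (SS a) k @ Cap j # v)"
  unfolding pull_shift[symmetric] by (rule ceq_sym[OF ceq_teq[OF far_shift_Cap]]) (auto dest: position_pull)

text \<open>A cap under the span of the arc is passed by letting the arc cross both of its legs,
  whence \<open>SS k\<close>.\<close>

lemma pull_Cap_inner: "m \<le> k \<Longrightarrow> a + k + 4 \<le> n \<Longrightarrow> ceq n (Cap (a + m + 1) # pull a k @ v) (pull a (SS k) @ Cap (a + m) # v)"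
proof (induction k)
  case 0
  have "ceq n (Cap (Suc a) # Cap a # v) (X (SS a) # X (SS a) # Cap (Suc a) # Cap a # v)"
    by (rule x_moves) (use 0 in simp)
  also have "ceq n ... (X (SS a) # X (Suc a) # Cap (SS a) # Cap a # v)"
    by (intro teq_Cross) (rule x_moves)
  also have "ceq n ... (X (SS a) # X (Suc a) # Cap a # Cap a # v)"
    by (intro teq_Cross) (rule x_moves; simp; fail)
  finally show ?case using 0 by simp
next
  case (Suc k)
  show ?case
  proof (cases "m \<le> k")
    case True
    have "ceq n (Cap (a + m + 1) # X (a + k + 1) # pull a k @ v) (X (SS (a + k + 1)) # Cap (a + m + 1) # pull a k @ v)"
      by (rule x_moves) (use True in auto)
    also have "ceq n ... (X (SS (a + k + 1)) # pull a (SS k) @ Cap (a + m) # v)"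
      by (rule teq_Cross) (use True Suc in auto)
    finally show ?thesis by simp
  next
    case False
    then have m: "m = Suc k" using Suc by simp
    let ?j = "a + Suc k"
    have "ceq n (Cap (Suc ?j) # pull a (Suc k) @ v) (X (SS ?j) # X (SS ?j) # Cap (Suc ?j) # pull a (Suc k) @ v)"
      by (rule x_moves) (use Suc in simp)
    also have "ceq n ... (X (SS ?j) # X (Suc ?j) # Cap (SS ?j) # pull a (Suc k) @ v)"
      by (intro teq_Cross) (rule x_moves)
    also have "ceq n ... (X (SS ?j) # X (Suc ?j) # pull a (Suc k) @ Cap ?j # v)"
      by (intro teq_Cross pull_far_right_Cap) simp
    finally show ?thesis by (simp add: m)
  qed
qed

section \<open>Removing the cups of a diagram\<close>

fun is_cup :: "event \<Rightarrow> bool" where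
  "is_cup (Cup i a) = True" | "is_cup (Cap i) = False" | "is_cup (Cross i s) = False"

definition cups :: "diagram \<Rightarrow> nat" where "cups w = length (filter is_cup w)"

lemma cups_simps [simp]: "cups [] = 0" "cups (e # w) = (if is_cup e then Suc (cups w) else cups w)" "cups (u @ w) = cups u + cups w"
  by (auto simp: cups_def)

text \<open>
  For \<open>w\<close> the part of a diagram above its last cup and \<open>r\<close> a strand of this cup: the cap at the
  end of the strand is moved down to the cup, so that the cup can be removed.
\<close>

lemma expose_cap: "run w xs = Some [] \<Longrightarrow> cups w = 0 \<Longrightarrow> r < length xs \<Longrightarrow>
   \<exists>a k w'. (r = a \<or> r = a + k + 1) \<and> a + k + 1 < length xs \<and> cups w' = 0 \<and> ceq (length xs) w (pull a k @ w')"
proof (induction w arbitrary: xs r)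
  case (Cons e w)
  let ?n = "length xs"
  obtain zs where zs: "step e xs = Some zs" "run w zs = Some []" using Cons.prems by (auto simp: bind_eq_Some_conv)
  have I: "\<exists>a k w'. (r = a \<or> r = a + k + 1) \<and> a + k + 1 < ?n \<and> cups w' = 0 \<and> ceq ?n (e # w) (pull a k @ w')"
    if "ceq ?n (e # w) (pull a k @ w')" "(r = a \<or> r = a + k + 1) \<and> a + k + 1 < ?n \<and> cups w' = 0" for a k w'
    using that by blast
  show ?case
  proof (cases e)
    case (Cup i a) then show ?thesis using Cons.prems by simp
  next
    case (Cap j)
    have len: "length zs = ?n - 2" "j + 1 < ?n" using zs Cap by (auto simp: step.simps split: if_splits)
    show ?thesis
    proof (cases "r = j \<or> r = Suc j")
      case True
      then have "(r = j \<or> r = j + 0 + 1) \<and> j + 0 + 1 < ?n \<and> cups w = 0"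
        using len Cons.prems Cap by auto
      moreover have "ceq ?n (e # w) (pull j 0 @ w)" by (simp add: Cap ceq_refl)
      ultimately show ?thesis by (intro I)
    next
      case False
      \<comment> \<open>The place of the strand above the cap, which has removed two
        strands.\<close>
      define r' where "r' = (if r < j then r else r - 2)"
      have "r' < length zs" using False len Cons.prems by (auto simp: r'_def)
      from Cons.IH[OF zs(2) _ this] Cons.prems Cap obtain a k w' where
        IH: "r' = a \<or> r' = a + k + 1" "a + k + 1 < length zs" "cups w' = 0" "ceq (?n - 2) w (pull a k @ w')"
        unfolding len by auto
      have *: "ceq ?n (e # w) (Cap j # pull a k @ w')" unfolding Cap by (rule teq_Cap[OF IH(4)])
      consider "j \<le> a" | m where "j = a + m + 1" "m \<le> k" | m where "j = SS m" "a + k \<le> m"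
      proof (cases "j \<le> a")
        case False
        then obtain m where m: "j = a + m + 1" using less_imp_Suc_add[of a j] by auto
        show ?thesis
        proof (cases "m \<le> k")
          case False
          then obtain t where "m = Suc (k + t)" by (auto dest!: less_imp_Suc_add simp: not_le)
          then show ?thesis using m that(3)[of "a + k + t"] by simp
        qed (use m that in auto)
      qed (use that in auto)
      then show ?thesis
      proof cases
        case 1
        show ?thesis by (rule I[OF ceq_trans[OF * pull_Cap_low[OF 1]]]) (use IH False 1 len in \<open>auto simp: r'_def split: if_splits\<close>)
      next
        case (2 m)
        from ceq_trans[OF *[unfolded 2(1)] pull_Cap_inner[OF 2(2)]]
        have "ceq ?n (e # w) (pull a (SS k) @ Cap (a + m) # w')" using IH(2) len by simp
        moreover have "(r = a \<or> r = a + SS k + 1) \<and> a + SS k + 1 < ?n \<and> cups (Cap (a + m) # w') = 0"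
          using IH False 2 len by (auto simp: r'_def split: if_splits)
        ultimately show ?thesis by (rule I)
      next
        case (3 m)
        show ?thesis by (rule I[OF ceq_trans[OF *[unfolded 3(1)] pull_far_right_Cap[OF 3(2)]]]) (use IH False 3 len in \<open>auto simp: r'_def split: if_splits\<close>)
      qed
    qed
  next
    case (Cross j s)
    have len: "length zs = ?n" "j + 1 < ?n" using zs Cross by (auto simp: step.simps split: if_splits)
    define r' where "r' = (if r = j then Suc j else if r = Suc j then j else r)"
    have "r' < length zs" using len Cons.prems by (auto simp: r'_def)
    from Cons.IH[OF zs(2) _ this] Cons.prems Cross obtain a k w' where
      IH: "r' = a \<or> r' = a + k + 1" "a + k + 1 < ?n" "cups w' = 0" "ceq ?n w (pull a k @ w')"
      unfolding len by auto
    have *: "ceq ?n (e # w) (X j # pull a k @ w')"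
      unfolding Cross by (rule ceq_trans[OF teq_Cross[OF IH(4)] ceq_sign])
    \<comment> \<open>The crossing lies beside the arc, strictly under its span, or at one of its
      ends. At an end it lengthens the arc, cancels a crossing of it, or is a curl.\<close>
    consider "SS j \<le> a" | "a = Suc j" | "j = a" "k = 0" | k' where "j = a" "k = Suc k'"
      | m where "j = a + m + 1" "m + 2 \<le> k" | k' where "j = a + k' + 1" "k = Suc k'" | "j = a + k + 1" | m where "j = SS m" "a + k \<le> m"
    proof (cases "j \<le> a")
      case True
      then consider "SS j \<le> a" | "a = Suc j" | "j = a" by linarith
      then show ?thesis
      proof cases
        case 3
        show ?thesis
        proof (cases k)
          case 0 then show ?thesis using that(3) 3 by blast
        next
          case (Suc k') then show ?thesis using that(4) 3 by blast
        qed
      qed (use that(1,2) in auto)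
    next
      case False
      then obtain m where m: "j = a + m + 1" using less_imp_Suc_add[of a j] by auto
      then consider "m + 2 \<le> k" | "k = Suc m" | "m = k" | "Suc k \<le> m" by linarith
      then show ?thesis
      proof cases
        case 4
        then obtain t where "m = Suc (k + t)" by (auto simp: le_iff_add)
        then show ?thesis using m that(8)[of "a + k + t"] by simp
      qed (use m that in auto)
    qed
    then show ?thesis
    proof cases
      case 1
      show ?thesis by (rule I[OF ceq_trans[OF * pull_far_left[OF 1]]]) (use IH 1 in \<open>auto simp: r'_def split: if_splits\<close>)
    next
      case 2
      show ?thesis by (rule I[OF ceq_trans[OF *[unfolded 2] pull_left]]) (use IH 2 in \<open>auto simp: r'_def split: if_splits\<close>)
    next
      case 3
      have "ceq ?n (e # w) (pull a 0 @ w')"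
        using ceq_trans[OF *[unfolded 3]] x_R1_cap by simp
      moreover have "(r = a \<or> r = a + 0 + 1) \<and> a + 0 + 1 < ?n \<and> cups w' = 0"
        using IH 3 by (auto simp: r'_def split: if_splits)
      ultimately show ?thesis by (rule I)
    next
      case (4 k')
      have "ceq ?n (e # w) (pull (Suc a) k' @ w')"
        using ceq_trans[OF *[unfolded 4] pull_right] len 4 by simp
      moreover have "(r = Suc a \<or> r = Suc a + k' + 1) \<and> Suc a + k' + 1 < ?n \<and> cups w' = 0"
        using IH 4 by (auto simp: r'_def split: if_splits)
      ultimately show ?thesis by (rule I)
    next
      case (5 m)
      show ?thesis by (rule I[OF ceq_trans[OF *[unfolded 5(1)] pull_inner[OF 5(2)]]]) (use IH 5 in \<open>auto simp: r'_def split: if_splits\<close>)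
    next
      case (6 k')
      have "ceq ?n (X j # pull a k @ w') (pull a k' @ w')"
        using x_R2[of "a + k' + 1" ?n "pull a k' @ w'"] len 6 by simp
      with * have "ceq ?n (e # w) (pull a k' @ w')" by (rule ceq_trans)
      moreover have "(r = a \<or> r = a + k' + 1) \<and> a + k' + 1 < ?n \<and> cups w' = 0"
        using IH 6 by (auto simp: r'_def split: if_splits)
      ultimately show ?thesis by (rule I)
    next
      case 7
      then have "ceq ?n (e # w) (pull a (Suc k) @ w')" using * by simp
      moreover have "(r = a \<or> r = a + Suc k + 1) \<and> a + Suc k + 1 < ?n \<and> cups w' = 0"
        using IH 7 len by (auto simp: r'_def split: if_splits)
      ultimately show ?thesis by (rule I)
    next
      case (8 m)
      show ?thesis by (rule I[OF ceq_trans[OF *[unfolded 8(1)] pull_far_right[OF 8(2)]]]) (use IH 8 in \<open>auto simp: r'_def split: if_splits\<close>)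
    qed
  qed
qed simp

definition hred :: "diagram \<Rightarrow> diagram \<Rightarrow> bool" where
  "hred l r \<longleftrightarrow> (\<forall>u. link_diagram (u @ l) \<longrightarrow> link_diagram (u @ r) \<and> h (u @ l) = h (u @ r))"

lemma hred_trans [trans]: "hred l m \<Longrightarrow> hred m r \<Longrightarrow> hred l r" unfolding hred_def by metis

lemma hred_Cons: "hred l r \<Longrightarrow> hred (e # l) (e # r)"
  unfolding hred_def by (metis append_Cons append_Nil append_assoc)

lemma hred_deq: "deq 0 l r \<Longrightarrow> hred l r"
  unfolding hred_def h_def using f_deq_right unfolding deq_def by (metis append_Nil2)

lemma hred_ceq: "ceq 0 l r \<Longrightarrow> hred l r"
  unfolding hred_def tangle_rel_def by (metis append_Nil2 link_diagram_append zero_le)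

text \<open>The arc ends at a strand of the cup, so both belong to one strand that runs back and
  forth and has a curl. Straightening it leaves only crossings with the \<open>k\<close> strands in
  between.\<close>

lemma cup_pull_left: "\<exists>w. cups w = 0 \<and> hred (Cup i c # pull i (Suc k) @ v) (w @ v)"
proof (induction k)
  case 0
  have "hred (Cup i c # pull i (Suc 0) @ v) ([] @ v)"
    using hred_deq[OF deq_left_curl[of i c True v]] by simp
  then show ?case by (metis cups_simps(1))
next
  case (Suc k)
  then obtain w where w: "cups w = 0" "hred (Cup i c # pull i (Suc k) @ v) (w @ v)" by blast
  have "hred (Cup i c # X (SS (i + k)) # pull i (Suc k) @ v) (X (i + k) # Cup i c # pull i (Suc k) @ v)"
    by (rule hred_ceq, rule x_moves) simp
  also have "hred ... (X (i + k) # w @ v)" by (rule hred_Cons[OF w(2)])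
  finally have "hred (Cup i c # pull i (SS k) @ v) ((X (i + k) # w) @ v)" by simp
  then show ?case using w(1) by (metis cups_simps(2) is_cup.simps(3))
qed

lemma cup_pull_right: "\<exists>w. cups w = 0 \<and> hred (Cup (a + k + 1) c # pull a k @ v) (w @ v)"
proof (induction k arbitrary: v)
  case 0
  have "hred (Cup (a + 0 + 1) c # pull a 0 @ v) ([] @ v)"
    using hred_deq[OF deq_straighten_left[of a c v]] by simp
  then show ?case by (metis cups_simps(1))
next
  case (Suc k)
  obtain w where w: "cups w = 0" "hred (Cup (a + k + 1) c # pull a k @ X (a + k) # v) (w @ X (a + k) # v)" using Suc by blast
  have "hred (Cup (Suc (a + k + 1)) c # X (a + k + 1) # pull a k @ v) (Cup (a + k + 1) c # X (SS (a + k)) # pull a k @ v)"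
    using hred_ceq[OF ceq_sym[OF x_slide_cup[of 0 "a + k + 1" c "pull a k @ v"]]] by simp
  also have "hred ... (Cup (a + k + 1) c # pull a k @ X (a + k) # v)"
    by (rule hred_Cons, rule hred_ceq, rule pull_far_right) simp
  also have "hred ... (w @ X (a + k) # v)" by (rule w(2))
  finally have "hred (Cup (a + Suc k + 1) c # pull a (Suc k) @ v) ((w @ [X (a + k)]) @ v)" by simp
  moreover have "cups (w @ [X (a + k)]) = 0" using w(1) by simp
  ultimately show ?case by blast
qed

lemma h_split: "u \<noteq> [] \<Longrightarrow> link_diagram (u @ Cup i a # Cap i # v) \<Longrightarrow> h (u @ Cup i a # Cap i # v) = 0"
  using split_link by (simp add: h_def)

lemma run_Nil_cupless: "run w [] = Some [] \<Longrightarrow> cups w = 0 \<Longrightarrow> w = []"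
  by (cases w; cases "hd w") (auto simp: step_Suc_Nil)

text \<open>Induction on the number of cups. A strand of the last cup is followed to its cap: if
  both strands of the cup end there without a crossing, a circle splits off and the value is 0;
  otherwise a zigzag is straightened and a cup disappears. A lone circle has the value 1.\<close>

lemma h_range: "link_diagram D \<Longrightarrow> D \<noteq> [] \<Longrightarrow> h D \<in> {0, 1}"
proof (induction "cups D" arbitrary: D rule: less_induct)
  case less
  have "cups D \<noteq> 0" using run_Nil_cupless[of D] less.prems by (auto simp: link_diagram_def)
  then have "\<exists>e \<in> set D. is_cup e" by (auto simp: cups_def filter_empty_conv)
  then obtain u e w where D: "D = u @ e # w" "is_cup e" "\<forall>e \<in> set w. \<not> is_cup e"
    using split_list_last_prop[of D is_cup] by blast
  obtain i c where e: "e = Cup i c" using D(2) by (cases e) auto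
  have w: "cups w = 0" using D(3) by (simp add: cups_def filter_empty_conv)
  obtain xs where xs: "run (u @ [e]) [] = Some xs" "run w xs = Some []"
    using less.prems(1) D(1) link_diagram_append[of "u @ [e]" w] by auto
  have i: "i < length xs" using xs(1) e by (auto simp: run_append bind_eq_Some_conv step.simps split: if_splits)
  from expose_cap[OF xs(2) w i] obtain a k w' where r: "i = a \<or> i = a + k + 1" "a + k + 1 < length xs" "cups w' = 0"
     "ceq (length xs) w (pull a k @ w')" by blast
  have D': "link_diagram (u @ Cup i c # pull a k @ w')" "h D = h (u @ Cup i c # pull a k @ w')"
    using r(4) xs(1) less.prems(1) unfolding tangle_rel_def D(1) e
    by (metis append_Cons append_Nil append_Nil2 append_assoc order_refl)+
  show ?case
  proof (cases "u = []")
    case True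
    then have "xs = [c, \<not> c]" using xs(1) e by (cases i) (auto simp: step_Suc_Nil)
    moreover have "i = 0" using xs(1) e True by (cases i) (auto simp: step_Suc_Nil)
    ultimately have a: "a = 0" "k = 0" using r by auto
    then have "run w' [] = Some []" using D'(1) True \<open>i = 0\<close> by (auto simp: link_diagram_def split: if_splits)
    then have "w' = []" using r(3) run_Nil_cupless by blast
    then have "h D = h [Cup 0 c, Cap 0]" using D'(2) True a \<open>i = 0\<close> by simp
    also have "link_diagram [Cup 0 c, Cap 0]" by (simp add: link_diagram_def)
    then have "h [Cup 0 c, Cap 0] = h unknot"
      using circle_direction[of "[]" 0 c "[]" True] by (simp add: h_def unknot_def)
    finally show ?thesis by (simp add: h_def f_unknot)
  next
    case False
    have red: ?thesis if "hred (Cup i c # pull a k @ w') (w'' @ w')" "cups w'' = 0" for w''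
    proof -
      have "link_diagram (u @ w'' @ w')" "h D = h (u @ w'' @ w')" using that(1) D' unfolding hred_def by auto
      moreover have "cups (u @ w'' @ w') < cups D" using that(2) r(3) D(1,2) by simp
      ultimately show ?thesis using less.hyps False by (metis append_is_Nil_conv)
    qed
    show ?thesis
    proof (cases "i = a")
      case True
      show ?thesis
      proof (cases k)
        case 0
        then show ?thesis using h_split[OF False, of i c w'] D' True by simp
      next
        case (Suc k')
        then show ?thesis using red cup_pull_left[of i c k' w'] True by auto
      qed
    next
      case False
      then show ?thesis using red cup_pull_right[of a k c w'] r(1) by auto
    qed
  qed
qed

section \<open>Delta-moves change the second coefficient by at most one\<close>

abbreviation c :: "nat \<Rightarrow> diagram \<Rightarrow> int" where "c n D \<equiv> coeff (f D) n"

text \<open>\<open>eps s True * eps x y\<close> is the sign of a crossing with flag \<open>s\<close>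
  of strands with directions \<open>x\<close> and \<open>y\<close>.\<close>

definition eps :: "bool \<Rightarrow> bool \<Rightarrow> int" where "eps x y = (if x = y then 1 else - 1)"

definition smooth :: "nat \<Rightarrow> bool \<Rightarrow> bool \<Rightarrow> diagram" where "smooth i x y = (if x = y then [] else [Cap i, Cup i y])"

lemma run_smooth: "length A = i \<Longrightarrow> run (smooth i x y) (A @ x # y # B) = Some (A @ y # x # B)"
  by (auto simp: smooth_def step_Cap_at step_Cup_at)

lemma c_skein:
  assumes "run u [] = Some (A @ x # y # B)" "length A = i" "run v (A @ y # x # B) = Some []"
  shows "c (Suc n) (u @ Cross i s # v) - c (Suc n) (u @ Cross i (\<not> s) # v) = eps s True * eps x y * c n (u @ smooth i x y @ v)"
    and "link_diagram (u @ smooth i x y @ v)"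
proof -
  show l: "link_diagram (u @ smooth i x y @ v)"
    using assms by (simp add: link_diagram_def run_append run_smooth)
  have l2: "link_diagram (u @ Cross i s # v)"
    using assms by (simp add: link_diagram_def run_append step_Cross_at)
  have "f (u @ X i # v) - f (u @ Y i # v) = [: eps x y :] * ([:0, 1:] * f (u @ smooth i x y @ v))"
  proof (cases "x = y")
    case True
    then show ?thesis using skein_parallel[of u A x B i v] assms l by (simp add: smooth_def eps_def)
  next
    case False
    then have y: "y = (\<not> x)" by auto
    show ?thesis using skein_anti[OF _ assms(2) l2, of x B] assms(1) unfolding y by (simp add: smooth_def eps_def)
  qed
  from arg_cong[OF this, of "\<lambda>p. coeff p (Suc n)"]
  have "c (Suc n) (u @ X i # v) - c (Suc n) (u @ Y i # v) = eps x y * c n (u @ smooth i x y @ v)"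
    by simp
  then show "c (Suc n) (u @ Cross i s # v) - c (Suc n) (u @ Cross i (\<not> s) # v) = eps s True * eps x y * c n (u @ smooth i x y @ v)"
    by (cases s) (auto simp: eps_def)
qed

lemma c_teq: "teq n 0 l r \<Longrightarrow> run u [] = Some xs \<Longrightarrow> n \<le> length xs \<Longrightarrow> link_diagram (u @ l) \<Longrightarrow> f (u @ l) = f (u @ r)"
  unfolding tangle_rel_def ddist_0 using f_isotopic by (metis append_Nil2)

lemma c0_range: "link_diagram D \<Longrightarrow> D \<noteq> [] \<Longrightarrow> c 0 D = 0 \<or> c 0 D = 1"
  using h_range by (auto simp: h_def)

lemma delta_rule_bound:
  assumes "run u [] = Some (A @ x # y # z # B)" "length A = i" "run v (A @ z # y # x # B) = Some []"
  shows "\<bar>c 2 (u @ Cross i s # Cross (Suc i) (\<not> s) # Cross i s # v) -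
     c 2 (u @ Cross (Suc i) s # Cross i (\<not> s) # Cross (Suc i) s # v)\<bar> \<le> 1"
proof -
  let ?a = "Cross i s" and ?b = "Cross (Suc i) s" and ?A = "Cross i (\<not> s)" and ?B = "Cross (Suc i) (\<not> s)"
  note at = step_Cross_at[of A i] step_Cross_at[of "A @ [w]" "Suc i" for w, simplified]
     step_Cap_at[of A i] step_Cap_at[of "A @ [w]" "Suc i" for w, simplified] step_Cup_at[of A i] step_Cup_at[of "A @ [w]" "Suc i" for w, simplified]
  have une: "u \<noteq> []" using assms(1) by auto
  have ua: "run (u @ [?a]) [] = Some ((A @ [y]) @ x # z # B)" and ub: "run (u @ [?b]) [] = Some (A @ x # z # y # B)"
    using assms(1,2) at by (simp_all add: run_append)
  have l: "link_diagram (u @ ?a # ?b # ?a # v)"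
    using assms at by (simp add: link_diagram_def run_append)
  have R3: "f (u @ ?a # ?b # ?a # v) = f (u @ ?b # ?a # ?b # v)"
    by (rule c_teq[OF teq_R3 assms(1) _ l, of 0]) auto
  \<comment> \<open>The smoothings of the middle crossing. By \<open>R3\<close> the bound reduces to
    comparing their coefficients \<open>c 1\<close>.\<close>
  let ?l0 = "u @ ?a # smooth (Suc i) x z @ ?a # v" and ?r0 = "u @ ?b # smooth i x z @ ?b # v"
  have L: "c 2 (u @ ?a # ?b # ?a # v) - c 2 (u @ ?a # ?B # ?a # v) = eps s True * eps x z * c 1 ?l0" "link_diagram ?l0"
    using c_skein(1)[OF ua, of "Suc i" "?a # v" s 1] c_skein(2)[OF ua, of "Suc i" "?a # v"] assms at by (simp_all add: numeral_2_eq_2)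
  have R: "c 2 (u @ ?b # ?a # ?b # v) - c 2 (u @ ?b # ?A # ?b # v) = eps s True * eps x z * c 1 ?r0" "link_diagram ?r0"
    using c_skein(1)[OF ub, of i "?b # v" s 1] c_skein(2)[OF ub, of i "?b # v"] assms at by (simp_all add: numeral_2_eq_2)
  have "\<bar>c 1 ?l0 - c 1 ?r0\<bar> \<le> 1"
  proof (cases "x = z")
    case True
    \<comment> \<open>Here the smoothings are the full twists \<open>?a # ?a\<close> and
      \<open>?b # ?b\<close>. Switching one crossing reduces either of them to \<open>u @ v\<close>,
      with the same sign of the correction.\<close>
    then have z: "z = x" by simp
    have ua': "run (u @ [?a]) [] = Some (A @ y # x # z # B)" and ub': "run (u @ [?b]) [] = Some ((A @ [x]) @ z # y # B)"
      using ua ub by simp_all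
    have 1: "c 1 (u @ ?a # ?a # v) - c 1 (u @ ?a # ?A # v) = eps s True * eps y x * c 0 (u @ ?a # smooth i y x @ v)"
      "link_diagram (u @ ?a # smooth i y x @ v)"
      using c_skein(1)[OF ua' assms(2), of v s 0] c_skein(2)[OF ua' assms(2), of v] assms(3) z by simp_all
    have 2: "c 1 (u @ ?b # ?b # v) - c 1 (u @ ?b # ?B # v) = eps s True * eps z y * c 0 (u @ ?b # smooth (Suc i) z y @ v)"
      "link_diagram (u @ ?b # smooth (Suc i) z y @ v)"
      using c_skein(1)[OF ub', of "Suc i" v s 0] c_skein(2)[OF ub', of "Suc i" v] assms(2,3) z by simp_all
    have "link_diagram (u @ ?a # ?A # v)" "link_diagram (u @ ?b # ?B # v)"
      using assms at z by (simp_all add: link_diagram_def run_append)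
    then have "f (u @ ?a # ?A # v) = f (u @ v)" "f (u @ ?b # ?B # v) = f (u @ v)"
      using c_teq[OF teq_R2 assms(1), of i "length (A @ x # y # z # B)"] c_teq[OF teq_R2 assms(1), of "Suc i" "length (A @ x # y # z # B)"] assms(2) by simp_all
    moreover have "c 0 (u @ ?a # smooth i y x @ v) = 0 \<or> c 0 (u @ ?a # smooth i y x @ v) = 1"
      "c 0 (u @ ?b # smooth (Suc i) z y @ v) = 0 \<or> c 0 (u @ ?b # smooth (Suc i) z y @ v) = 1"
      using c0_range 1(2) 2(2) une by blast+
    ultimately show ?thesis using 1(1) 2(1) z by (auto simp: smooth_def eps_def split: if_splits)
  next
    case False
    then have z: "z = (\<not> x)" by auto
    \<comment> \<open>The first smoothing is isotopic to \<open>?l1\<close>, which has the shape of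
      \<open>?r0\<close> with both crossings switched; \<open>?m\<close> lies halfway.\<close>
    let ?l1 = "u @ ?B # Cap i # Cup i z # ?B # v" and ?m = "u @ ?b # Cap i # Cup i z # ?B # v"
    have "f ?l0 = f ?l1"
    proof -
      have "teq 0 0 (?a # Cap (Suc i) # Cup (Suc i) z # ?a # v) (?B # Cap i # Cup (Suc i) z # ?a # v)"
        by (rule mv; auto; fail)
      also have "teq 0 0 ... (?B # Cap i # Cup i z # ?B # v)"
        by (intro teq_Cross teq_Cap) (rule mv; auto; fail)
      finally show ?thesis using c_teq[OF _ assms(1)] L(2) z by (simp add: smooth_def)
    qed
    have r0: "?r0 = u @ ?b # Cap i # Cup i z # ?b # v" using z by (simp add: smooth_def)
    have u1: "run u [] = Some ((A @ [x]) @ y # z # B)" using assms(1) by simp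
    have 1: "c 1 ?m - c 1 ?l1 = eps s True * eps y z * c 0 (u @ smooth (Suc i) y z @ Cap i # Cup i z # ?B # v)"
      "link_diagram (u @ smooth (Suc i) y z @ Cap i # Cup i z # ?B # v)"
      using c_skein(1)[OF u1, of "Suc i" "Cap i # Cup i z # ?B # v" s 0] c_skein(2)[OF u1, of "Suc i" "Cap i # Cup i z # ?B # v"] assms(2,3) at z by simp_all
    have u2: "run (u @ [?b, Cap i, Cup i z]) [] = Some ((A @ [z]) @ x # y # B)"
      using assms(1,2) at z by (simp add: run_append)
    have 2: "c 1 ?r0 - c 1 ?m = eps s True * eps x y * c 0 (u @ ?b # Cap i # Cup i z # smooth (Suc i) x y @ v)"
      "link_diagram (u @ ?b # Cap i # Cup i z # smooth (Suc i) x y @ v)"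
      using c_skein(1)[OF u2, of "Suc i" v s 0] c_skein(2)[OF u2, of "Suc i" v] assms(2,3) unfolding r0 by simp_all
    have "c 0 (u @ ?b # Cap i # Cup i z # smooth (Suc i) x y @ v) = 0 \<or> c 0 (u @ ?b # Cap i # Cup i z # smooth (Suc i) x y @ v) = 1"
      "c 0 (u @ smooth (Suc i) y z @ Cap i # Cup i z # ?B # v) = 0 \<or> c 0 (u @ smooth (Suc i) y z @ Cap i # Cup i z # ?B # v) = 1"
      using c0_range 1(2) 2(2) une by blast+
    \<comment> \<open>The crossings switched have opposite signs, as exactly one of them is between
      parallel strands. So the two corrections enter as a difference of numbers 0 or 1, not as a
      sum.\<close>
    moreover have "eps y z = - eps x y" using z by (auto simp: eps_def)
    ultimately show ?thesis unfolding \<open>f ?l0 = f ?l1\<close> using 1(1) 2(1) by (auto simp: eps_def split: if_splits)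
  qed
  then show ?thesis using L(1) R(1) R3 by (auto simp: eps_def split: if_splits)
qed

lemma link_local_move: "local_move R D E \<Longrightarrow> link_diagram D \<and> link_diagram E"
  by (induction rule: local_move.induct) (simp add: link_diagram_def run_append)

lemma link_isotopic: "isotopic D E \<Longrightarrow> link_diagram D \<Longrightarrow> link_diagram E"
  unfolding isotopic_def by (induction rule: rtranclp_induct) (auto dest: link_local_move)

lemma run_two_crossings:
  assumes "run [Cross i s, Cross (Suc i) t, Cross i r] xs = Some ys"
  obtains A x y z B where "xs = A @ x # y # z # B" "length A = i" "ys = A @ z # y # x # B"
proof -
  have len: "i + 2 < length xs" using assms by (auto simp: step.simps bind_eq_Some_conv split: if_splits)
  define A where "A = take i xs"
  obtain x y z B where B: "drop i xs = x # y # z # B"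
    using len by (metis Cons_nth_drop_Suc Suc_lessD add_2_eq_Suc')
  have xs: "xs = A @ x # y # z # B" "length A = i" using len B by (auto simp: A_def) (metis append_take_drop_id)
  have "ys = A @ z # y # x # B" using assms xs
      step_Cross_at[of A i] step_Cross_at[of "A @ [w]" "Suc i" for w, simplified] by simp
  with that xs show ?thesis by blast
qed

lemma delta_bound: assumes "delta_move D E" shows "\<bar>c 2 D - c 2 E\<bar> \<le> 1"
proof -
  have *: "\<bar>c 2 (u @ l @ v) - c 2 (u @ r @ v)\<bar> \<le> 1"
    if "delta_rule l r" "run u [] = Some xs" "run l xs = Some ys" "run v ys = Some []" for l r u v xs ys
    using that(1)
  proof cases
    case (1 i s)
    then have "run [Cross i s, Cross (Suc i) (\<not> s), Cross i s] xs = Some ys" using that(3) by simp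
    then obtain A x y z B where "xs = A @ x # y # z # B" "length A = i" "ys = A @ z # y # x # B"
      by (rule run_two_crossings)
    then show ?thesis using delta_rule_bound[of u A x y z B i v s] that(2,4) 1 by simp
  qed
  show ?thesis using assms unfolding delta_move_def
  proof cases
    case (1 l r u xs ys v)
    then show ?thesis using *[of l r u xs ys v] *[of r l u xs ys v] by (auto simp: abs_minus_commute)
  qed
qed

lemma ddist_bound: "ddist k D E \<Longrightarrow> link_diagram D \<Longrightarrow> \<bar>c 2 D - c 2 E\<bar> \<le> int k"
proof (induction k arbitrary: D)
  case 0
  then show ?case using f_isotopic[of D E] link_isotopic by (simp add: ddist_0)
next
  case (Suc k)
  then obtain F G where *: "isotopic D F" "delta_move F G" "ddist k G E" by (auto simp: ddist_Suc)
  have "link_diagram F" "link_diagram G" using link_local_move *(2) by (auto simp: delta_move_def)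
  then show ?case using f_isotopic[OF Suc.prems(2) _ *(1)] delta_bound[OF *(2)] Suc.IH[OF *(3)] by simp
qed

lemma c2_unknot: "c 2 unknot = 0" by (simp add: f_unknot numeral_2_eq_2)

lemma c2_lower_bound: "ddist k D unknot \<Longrightarrow> link_diagram D \<Longrightarrow> \<bar>c 2 D\<bar> \<le> int k"
  using ddist_bound[of k D unknot] c2_unknot by simp

end

section \<open>Coefficients of the closed columns\<close>

lemma col_int: "col i (int m) = rep m (X i)" "col i (- int m) = rep m (Y i)"
  by (cases "m = 0"; simp add: col_def)+

definition closure :: "bool \<Rightarrow> int list \<Rightarrow> diagram" where "closure a ps = Cup 0 a # cols 0 a ps @ [Cap 0]"

lemma closed_cols_closure: "closed_cols a a p ps = closure a (p # ps)"
  by (simp add: closed_cols_def closure_def)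

text \<open>Once the second cup is slid up past the columns, it forms a zigzag with the inner
  cap.\<close>

lemma deq_fold: "deq 0 (Cup 0 a # Cup 0 a # cols (SS 0) b ps @ [Cap (Suc 0), Cap 0]) (Cup 0 a # cols 0 b ps @ [Cap 0])"
proof -
  have "teq 2 0 (Cup 0 a # cols (SS 0) b ps @ [Cap (Suc 0), Cap 0]) (cols 0 b ps @ Cup 0 a # [Cap (Suc 0), Cap 0])"
    unfolding cols_shift[of 0, symmetric] by (intro teq_sym[OF far_shift_Cup]) simp
  from teq_deq0[OF teq_Cup[of 0, OF this[unfolded numeral_2_eq_2]]]
  have "deq 0 (Cup 0 a # Cup 0 a # cols (SS 0) b ps @ [Cap (Suc 0), Cap 0]) (Cup 0 a # cols 0 b ps @ Cup 0 a # [Cap (Suc 0), Cap 0])" .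
  also have "deq 0 ... (Cup 0 a # cols 0 b ps @ [Cap 0])"
    by (intro deq_Cons deq_append_left deq_straighten_right)
  finally show ?thesis .
qed

lemma link_closure: "even (length ps) \<Longrightarrow> link_diagram (closure a ps)"
  using run_cols[of "[]" 0 "\<not> a" ps a "[]"] by (simp add: closure_def link_diagram_def run_append)

context conway
begin

abbreviation tw :: "diagram \<Rightarrow> nat \<Rightarrow> diagram \<Rightarrow> nat \<Rightarrow> diagram" where
  "tw u i v m \<equiv> u @ rep m (X i) @ v"

text \<open>Switching the last of \<open>m + 2\<close> crossings cancels it with its neighbour, and
  smoothing it leaves \<open>m + 1\<close>: a Fibonacci recursion in z.\<close>

lemma twist:
  assumes "run u [] = Some (A @ x # x # B)" "length A = i" "link_diagram (u @ v)"
  shows "f (tw u i v (SS m)) = f (tw u i v m) + [:0, 1:] * f (tw u i v (Suc m))"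
    and "link_diagram (tw u i v m)"
proof -
  have r: "run (u @ rep m (Cross i s)) [] = Some (A @ x # x # B)" for m s
    using run_replicate_Cross[OF assms(2), of m s x x B] assms(1) by (auto simp: run_append)
  have v: "run v (A @ x # x # B) = Some []" using assms link_iff by blast
  show "link_diagram (tw u i v m)" using r[of m True] v link_iff by (metis append_assoc)
  have l: "link_diagram ((u @ rep (Suc m) (X i)) @ v)" using r[of "Suc m" True] v link_iff by blast
  from skein_parallel[OF r assms(2) l]
  have "f (tw u i (X i # v) (Suc m)) - f (tw u i (Y i # v) (Suc m)) = [:0, 1:] * f (tw u i v (Suc m))" by simp
  moreover have "f (tw u i (Y i # v) (Suc m)) = f (tw u i v m)"
  proof -
    have e: "rep (Suc m) (X i) @ Y i # v = rep m (X i) @ X i # Y i # v"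
      by (simp add: rep_snoc)
    have "link_diagram ((u @ rep m (X i)) @ X i # Y i # v)"
      unfolding link_iff[OF r] using v step_Cross_at[OF assms(2), of _ x x B] by simp
    from c_teq[OF teq_R2_gen[of i "SS i" False True v] r[of m True] _ this] assms(2) show ?thesis unfolding e by simp
  qed
  moreover have "rep (SS m) (X i) @ v = rep (Suc m) (X i) @ X i # v" by (simp add: rep_snoc)
  ultimately show "f (tw u i v (SS m)) = f (tw u i v m) + [:0, 1:] * f (tw u i v (Suc m))"
    by (metis diff_eq_eq add.commute)
qed

text \<open>A coefficient at an index of one parity grows by the next lower coefficient at the other
  parity, so the values at 0 and 1 determine everything.\<close>

lemma twist_coeffs:
  fixes g :: "nat \<Rightarrow> int poly"
  assumes "\<And>m. g (SS m) = g m + [:0, 1:] * g (Suc m)"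
  shows "coeff (g (2 * k)) 0 = coeff (g 0) 0" "coeff (g (2 * k + 1)) 0 = coeff (g 1) 0"
    "coeff (g (2 * k)) 1 = coeff (g 0) 1 + int k * coeff (g 1) 0" "coeff (g (2 * k + 1)) 1 = coeff (g 1) 1 + int k * coeff (g 0) 0"
    "coeff (g (2 * k + 1)) 2 = coeff (g 1) 2 + int k * coeff (g 0) 1 + int (\<Sum>j\<le>k. j) * coeff (g 1) 0"
    "coeff (g (2 * k)) 2 = coeff (g 0) 2 + (\<Sum>j<k. coeff (g (2 * j + 1)) 1)"
proof -
  have c0: "coeff (g (SS m)) 0 = coeff (g m) 0" for m using assms[of m] by simp
  have cS: "coeff (g (SS m)) (Suc n) = coeff (g m) (Suc n) + coeff (g (Suc m)) n" for m n
    using assms[of m] by simp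
  show 1: "coeff (g (2 * k)) 0 = coeff (g 0) 0" and 2: "coeff (g (2 * k + 1)) 0 = coeff (g 1) 0" for k
    by (induction k) (simp_all add: c0)
  show 3: "coeff (g (2 * k)) 1 = coeff (g 0) 1 + int k * coeff (g 1) 0" for k
  proof (induction k)
    case (Suc k) then show ?case using cS[of "2 * k" 0] 2[of k] by (simp add: algebra_simps)
  qed simp
  show "coeff (g (2 * k + 1)) 1 = coeff (g 1) 1 + int k * coeff (g 0) 0"
  proof (induction k)
    case (Suc k) then show ?case using cS[of "2 * k + 1" 0] 1[of "Suc k"] by (simp add: algebra_simps)
  qed simp
  show "coeff (g (2 * k + 1)) 2 = coeff (g 1) 2 + int k * coeff (g 0) 1 + int (\<Sum>j\<le>k. j) * coeff (g 1) 0"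
  proof (induction k)
    case (Suc k) then show ?case using cS[of "2 * k + 1" 1] 3[of "Suc k"] by (simp add: algebra_simps numeral_2_eq_2)
  qed simp
  show "coeff (g (2 * k)) 2 = coeff (g 0) 2 + (\<Sum>j<k. coeff (g (2 * j + 1)) 1)"
  proof (induction k)
    case (Suc k) then show ?case using cS[of "2 * k" 1] by (simp add: algebra_simps numeral_2_eq_2)
  qed simp
qed

lemma f_teq0: "teq 0 0 l r \<Longrightarrow> link_diagram l \<Longrightarrow> f l = f r" "teq 0 0 l r \<Longrightarrow> link_diagram l \<Longrightarrow> link_diagram r"
  using f_deq_right[OF teq_deq0, of l r "[]"] teq_deq0[of 0 l r] unfolding deq_def by (simp, metis append_Nil append_Nil2)

lemma f_deq0: "deq 0 l r \<Longrightarrow> link_diagram l \<Longrightarrow> f l = f r"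
  using f_deq_right[of l r "[]"] by simp

text \<open>Each column is a local torus knot. Without crossings it would be a split circle, so
  \<open>g 0 = 0\<close>; with one crossing it is a curl, so \<open>g 1\<close> belongs to the
  shorter sum.\<close>

lemma closed_cols_0: "odd_pos ps \<Longrightarrow> a = (if even (length ps) then \<not> b else b) \<Longrightarrow>
   c 0 (closed_cols a b 0 ps) = 1 \<and> c 2 (closed_cols a b 0 ps) = int (tri ps)"
proof (induction ps arbitrary: b)
  case Nil
  have "f (closed_cols a b 0 []) = 1"
    using closed_0_unknot[of "[]" a b] f_deq0 link_closed_cols[of 0 a b "[]"] Nil f_unknot by (simp add: tri_def)
  then show ?case by (simp add: tri_def numeral_2_eq_2)
next
  case (Cons p ps)
  let ?u = "[Cup 0 a, Cup (Suc 0) (\<not> b), Cup (Suc 0) b]" and ?v = "Cap (Suc 0) # cols (SS 0) b ps @ [Cap (Suc 0), Cap 0]"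
  have p: "odd p" "0 < p" "odd_pos ps" using Cons.prems by auto
  define k where "k = nat (p div 2)"
  have lk: "link_diagram (closed_cols a b 0 q)" if "even (length q) = even (length (p # ps))" for q
    by (rule link_closed_cols) (use Cons.prems that in auto)
  have u: "run ?u [] = Some ([a, b] @ (\<not> b) # (\<not> b) # [b, \<not> a])" by simp
  have T: "teq 0 0 (closed_cols a b 0 (int m # ps)) (tw ?u (SS 0) ?v m)" for m
    using closed_cols_Cons[of a b 0 "int m" ps] by (simp add: col_int) (simp add: col_def)
  have link: "link_diagram (?u @ ?v)" using f_teq0(2)[OF T[of 0]] lk by simp
  define g where "g m = f (tw ?u (SS 0) ?v m)" for m
  have g: "g (SS m) = g m + [:0, 1:] * g (Suc m)" for m
    unfolding g_def by (rule twist(1)[OF u _ link]) simp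
  have "g 0 = 0" unfolding g_def using split_link[of "[Cup 0 a, Cup (Suc 0) (\<not> b)]" "Suc 0" b] link by simp
  have c: "closed_cols a (\<not> b) 0 ps = [Cup 0 a, Cup (Suc 0) (\<not> b)] @ cols (SS 0) b ps @ [Cap (Suc 0), Cap 0]"
    by (simp add: closed_cols_alt col_def)
  have "g 1 = f (closed_cols a (\<not> b) 0 ps)"
  proof -
    have l1: "link_diagram (tw ?u (SS 0) ?v 1)" by (rule twist(2)[OF u _ link]) simp
    show ?thesis unfolding g_def c using f_deq_right[OF deq_left_curl[of "Suc 0" b True "cols (SS 0) b ps @ [Cap (Suc 0), Cap 0]"], of "[Cup 0 a, Cup (Suc 0) (\<not> b)]"] l1 by simp
  qed
  moreover have "f (closed_cols a b 0 (p # ps)) = g (2 * k + 1)"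
  proof -
    have "p = int (2 * k + 1)" using p by (auto simp: k_def elim!: oddE)
    then show ?thesis unfolding g_def using f_teq0(1)[OF T[of "2 * k + 1"]] lk by simp
  qed
  moreover have "c 0 (closed_cols a (\<not> b) 0 ps) = 1 \<and> c 2 (closed_cols a (\<not> b) 0 ps) = int (tri ps)"
    by (rule Cons.IH) (use p Cons.prems in \<open>auto split: if_splits\<close>)
  ultimately show ?case using twist_coeffs(2,5)[of g k, OF g] \<open>g 0 = 0\<close> by (simp add: tri_def k_def)
qed

lemma closure_Nil: "f (closure a []) = 0"
proof -
  have "closure a [] = [Cup 0 a, Cap 0] @ Cup 0 a # Cap 0 # []" by (simp add: closure_def)
  then show ?thesis using split_link[of "[Cup 0 a, Cap 0]" 0 a "[]"] link_closure[of "[]" a] by simp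
qed

text \<open>For a link of two components, \<open>c 1\<close> is the linking number, here half the
  number of crossings. The induction removes two columns, each reduced to one crossing
  beforehand.\<close>

lemma closure_c1: "odd_pos ps \<Longrightarrow> even (length ps) \<Longrightarrow> 2 * c 1 (closure a ps) = sum_list ps"
proof (induction ps rule: induct_list012)
  case 1 then show ?case by (simp add: closure_Nil)
next
  case (3 p q ps)
  have p: "odd p" "0 < p" "odd q" "0 < q" "odd_pos ps" "even (length ps)" using 3 by auto
  let ?w = "cols (SS 0) a ps @ [Cap (Suc 0), Cap 0]"
  let ?u = "[Cup 0 a, Cup (Suc 0) (\<not> a), Cup (Suc 0) a]"
  have lk: "link_diagram (closure a (p # q # ps))" for p q by (rule link_closure) (use p in simp)
  have u0: "run ?u [] = Some ([] @ a # a # [\<not> a, \<not> a, a, \<not> a])" by simp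
  have u1: "run (?u @ [X 0]) [] = Some ([a, a] @ (\<not> a) # (\<not> a) # [a, \<not> a])" by simp
  have T: "teq 0 0 (closure a (p # q # ps)) (?u @ col 0 p @ col (SS 0) q @ Cap (Suc 0) # ?w)" for p q
    using closed_cols_Cons[of a a p q ps] by (simp add: closed_cols_closure)
  note f_T = f_teq0(1)[OF T lk] and l_T = f_teq0(2)[OF T lk]
  define g where "g m = f (tw ?u 0 (col (SS 0) q @ Cap (Suc 0) # ?w) m)" for m
  define g' where "g' m = f (tw (?u @ [X 0]) (SS 0) (Cap (Suc 0) # ?w) m)" for m
  have l0: "link_diagram (?u @ col (SS 0) q @ Cap (Suc 0) # ?w)" using l_T[of 0 q] by (simp add: col_def)
  have l1: "link_diagram ((?u @ [X 0]) @ Cap (Suc 0) # ?w)" using l_T[of 1 0] by (simp add: col_def)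
  have g: "g (SS m) = g m + [:0, 1:] * g (Suc m)" for m
    unfolding g_def by (rule twist(1)[OF u0 _ l0]) simp
  have g': "g' (SS m) = g' m + [:0, 1:] * g' (Suc m)" for m
    unfolding g'_def by (rule twist(1)[OF u1 _ l1]) simp
  have gf: "f (closure a (int m # q # ps)) = g m" for m
    using f_T[of "int m" q] by (simp add: g_def col_int)
  have gf': "f (closure a (1 # int m # ps)) = g' m" for m
    using f_T[of 1 "int m"] col_int(1)[of _ 1] by (simp add: g'_def col_int)
  have "coeff (g 0) 0 = 1"
    using gf[of 0] closed_cols_0[of "q # ps" a a] p by (simp add: closed_cols_closure)
  have "g' 0 = f (closed_cols a (\<not> a) 0 ps)"
    using f_deq_right[OF deq_right_curl[of 0 a True ?w], of "[Cup 0 a, Cup (Suc 0) (\<not> a)]"] l1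
    by (simp add: g'_def closed_cols_alt col_def)
  then have g'0: "coeff (g' 0) 0 = 1" using closed_cols_0[of ps a "\<not> a"] p by simp
  have g'1: "coeff (g' 1) 1 = c 1 (closure a ps) + 1"
  proof -
    let ?C = "Cap (Suc 0) # ?w"
    have v: "run ?C ([a, a] @ (\<not> a) # (\<not> a) # [a, \<not> a]) = Some []" using l1 link_iff[OF u1] by simp
    have "c 1 ((?u @ [X 0]) @ X (SS 0) # ?C) - c 1 ((?u @ [X 0]) @ Y (SS 0) # ?C) = coeff (g' 0) 0"
      using c_skein(1)[OF u1 _ v, of "SS 0" True 0] by (simp add: eps_def smooth_def g'_def)
    \<comment> \<open>With the crossing switched, two columns of one crossing each and of opposite
      signs are adjacent; they cancel and the link with two columns fewer remains.\<close>
    moreover have "f ((?u @ [X 0]) @ Y (SS 0) # ?C) = f (closure a ps)"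
    proof -
      let ?u2 = "[Cup 0 a, Cup (Suc 0) (\<not> a)]"
      have r2: "run ?u2 [] = Some [a, \<not> a, a, \<not> a]" by simp
      have "teq 4 0 (Cup (Suc 0) a # X 0 # Y (SS 0) # ?C)
         (Cup 0 a # Y (Suc 0) # Y (SS 0) # ?C)"
        by (rule mv; auto; fail)
      also have "teq 4 0 ... (Cup 0 a # Y (Suc 0) # X (Suc 0) # Cap (SS 0) # ?w)"
        by (intro teq_Cross teq_Cup) (rule mv; auto; fail)
      also have "teq 4 0 ... (Cup 0 a # Cap (SS 0) # ?w)"
        by (intro teq_Cup) (rule mv; auto; fail)
      also have "teq 4 0 ... (Cap 0 # Cup 0 a # ?w)"
        by (rule mv; auto; fail)
      finally have t: "teq 4 0 (Cup (Suc 0) a # X 0 # Y (SS 0) # ?C) (Cap 0 # Cup 0 a # ?w)" .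
      have l: "link_diagram (?u2 @ Cup (Suc 0) a # X 0 # Y (SS 0) # ?C)"
        using v step_Cross_at[of "[a, a]" "SS 0" False "\<not> a" "\<not> a" "[a, \<not> a]"] unfolding link_iff[OF r2] by simp
      have l': "link_diagram (?u2 @ Cap 0 # Cup 0 a # ?w)"
        using v unfolding link_iff[OF r2] by simp
      have "deq 0 (Cup 0 a # Cup (Suc 0) (\<not> a) # Cap 0 # Cup 0 a # ?w) (Cup 0 a # Cup 0 a # ?w)"
        by (intro deq_Cons deq_straighten_left)
      also have "deq 0 ... (Cup 0 a # cols 0 a ps @ [Cap 0])" by (rule deq_fold)
      finally have "f (?u2 @ Cap 0 # Cup 0 a # ?w) = f (closure a ps)" using f_deq0 l' by (simp add: closure_def)
      moreover have "f (?u2 @ Cup (Suc 0) a # X 0 # Y (SS 0) # ?C) = f (?u2 @ Cap 0 # Cup 0 a # ?w)"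
        by (rule c_teq[OF t r2 _ l]) simp
      ultimately show ?thesis by simp
    qed
    ultimately show ?thesis using g'0 by (simp add: g'_def)
  qed
  define k k' where "k = nat (p div 2)" and "k' = nat (q div 2)"
  have k: "p = int (2 * k + 1)" "q = int (2 * k' + 1)" using p by (auto simp: k_def k'_def elim!: oddE)
  have "c 1 (closure a (p # q # ps)) = coeff (g 1) 1 + int k"
    using twist_coeffs(4)[of g k, OF g] \<open>coeff (g 0) 0 = 1\<close> gf[of "2 * k + 1"] unfolding k(1) by simp
  also have "g 1 = g' (2 * k' + 1)" using gf[of 1] gf'[of "2 * k' + 1"] unfolding k(2) by simp
  also have "coeff (g' (2 * k' + 1)) 1 = coeff (g' 1) 1 + int k'"
    using twist_coeffs(4)[of g' k', OF g'] g'0 by simp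
  finally show ?case using g'1 3 p k by simp
qed simp

text \<open>The strands of the first column are parallel here. Passing from \<open>2 * j\<close> to
  \<open>2 * j + 2\<close> crossings adds the linking number of the link with
  \<open>2 * j + 1\<close> crossings in that column; the summands are twice these numbers.\<close>

lemma closed_cols_odd_c2: assumes "odd_pos ps" "odd (length ps)"
  shows "2 * c 2 (closed_cols a a (2 * int k) ps) = 2 * int (tri ps) + (\<Sum>j<k. 2 * int j + 1 + sum_list ps)"
proof -
  let ?u = "[Cup 0 a, Cup (Suc 0) a]" and ?v = "cols (SS 0) (\<not> a) ps @ [Cap (Suc 0), Cap 0]"
  have e: "closed_cols a a (int m) ps = tw ?u 0 ?v m" for m by (simp add: closed_cols_alt col_int)
  have u: "run ?u [] = Some ([] @ a # a # [\<not> a, \<not> a])" by simp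
  have l: "link_diagram (?u @ ?v)" using link_closed_cols[of 0 a a ps] e[of 0] assms(2) by simp
  define g where "g m = f (tw ?u 0 ?v m)" for m
  have g: "g (SS m) = g m + [:0, 1:] * g (Suc m)" for m
    unfolding g_def by (rule twist(1)[OF u _ l]) simp
  have "2 * coeff (g (2 * j + 1)) 1 = 2 * int j + 1 + sum_list ps" for j
    using closure_c1[of "int (2 * j + 1) # ps" a] assms e[of "2 * j + 1"] by (simp add: g_def closed_cols_closure)
  then have "2 * (\<Sum>j<k. coeff (g (2 * j + 1)) 1) = (\<Sum>j<k. 2 * int j + 1 + sum_list ps)"
    by (simp add: sum_distrib_left)
  moreover have "coeff (g 0) 2 = int (tri ps)"
    using closed_cols_0[OF assms(1), of a a] assms(2) e[of 0] by (simp add: g_def)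
  ultimately show ?thesis using twist_coeffs(6)[of g k, OF g] e[of "2 * k"] by (simp add: g_def)
qed

text \<open>The strands of the first column are antiparallel here. Smoothing one crossing opens the
  column, whose other crossings become curls; what remains is the link of the odd columns, so every
  pair of crossings adds the same linking number.\<close>

lemma closed_cols_even_c2: assumes "odd_pos ps" "even (length ps)"
  shows "2 * c 2 (closed_cols a (\<not> a) (- 2 * int k) ps) = 2 * int (tri ps) + int k * sum_list ps"
proof (induction k)
  case 0
  then show ?case using closed_cols_0[OF assms(1), of a "\<not> a"] assms(2) by simp
next
  case (Suc k)
  let ?u = "[Cup 0 a, Cup (Suc 0) (\<not> a)]" and ?v = "cols (SS 0) a ps @ [Cap (Suc 0), Cap 0]"
  let ?uo = "?u @ rep (2 * k + 1) (Y 0)" and ?ue = "?u @ rep (2 * k) (Y 0)"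
  have n1: "- int (2 * j) = - 2 * int j" for j by simp
  have e: "closed_cols a (\<not> a) (- int m) ps = ?u @ rep m (Y 0) @ ?v" for m
    by (simp add: closed_cols_alt col_int)
  have r: "run (?u @ rep m (Y 0)) [] = Some (if even m then [a, \<not> a, a, \<not> a] else [\<not> a, a, a, \<not> a])" for m
    using run_replicate_Cross[of "[]" 0 m False a "\<not> a" "[a, \<not> a]"] by simp
  have u0: "run ?ue [] = Some [a, \<not> a, a, \<not> a]" using r[of "2 * k"] by simp
  have u1: "run ?uo [] = Some ([] @ (\<not> a) # a # [a, \<not> a])" using r[of "2 * k + 1"] by simp
  have "link_diagram (?ue @ ?v)" using link_closed_cols[of "- int (2 * k)" a "\<not> a" ps] e[of "2 * k"] assms(2) by simp
  then have v: "run ?v ([] @ a # (\<not> a) # [a, \<not> a]) = Some []" using link_iff[OF u0] by simp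
  let ?s = "?uo @ smooth 0 (\<not> a) a @ ?v"
  have 1: "c 2 (?uo @ Y 0 # ?v) - c 2 (?uo @ X 0 # ?v) = c 1 ?s" and l: "link_diagram ?s"
    using c_skein(1)[OF u1 _ v, of 0 False 1] c_skein(2)[OF u1 _ v, of 0] by (simp_all add: eps_def numeral_2_eq_2)
  have "?uo @ Y 0 # ?v = closed_cols a (\<not> a) (- int (2 * Suc k)) ps"
    unfolding e by (simp add: rep_snoc)
  then have "?uo @ Y 0 # ?v = closed_cols a (\<not> a) (- 2 * int (Suc k)) ps" unfolding n1 .
  moreover have "f (?uo @ X 0 # ?v) = f (closed_cols a (\<not> a) (- 2 * int k) ps)"
  proof -
    have e1: "?uo @ X 0 # ?v = ?ue @ Y 0 # X 0 # ?v" by (simp add: rep_snoc)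
    have "link_diagram (?ue @ Y 0 # X 0 # ?v)"
      using v link_iff[OF u0] by simp
    from c_teq[OF teq_R2_gen[of 0 2 True False ?v] u0 _ this] have "f (?ue @ Y 0 # X 0 # ?v) = f (closed_cols a (\<not> a) (- int (2 * k)) ps)"
      unfolding e append_assoc by simp
    then show ?thesis unfolding n1 e1 .
  qed
  moreover have "f ?s = f (closure a ps)"
  proof -
    have "teq n 0 (rep m (Y 0) @ Cap 0 # w) (Cap 0 # w)" for m n w
    proof (induction m)
      case (Suc m)
      show ?case using teq_trans0[OF teq_Cross[OF Suc] teq_R1_cap] by simp
    qed (simp add: teq_refl)
    then have "teq 0 0 (Cup 0 a # Cup (Suc 0) (\<not> a) # rep (2 * k + 1) (Y 0) @ Cap 0 # Cup 0 a # ?v) (Cup 0 a # Cup (Suc 0) (\<not> a) # Cap 0 # Cup 0 a # ?v)"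
      by (intro teq_Cup)
    then have "deq 0 (Cup 0 a # Cup (Suc 0) (\<not> a) # rep (2 * k + 1) (Y 0) @ Cap 0 # Cup 0 a # ?v) (Cup 0 a # Cup (Suc 0) (\<not> a) # Cap 0 # Cup 0 a # ?v)"
      by (rule teq_deq0)
    also have "deq 0 ... (Cup 0 a # Cup 0 a # ?v)" by (intro deq_Cons deq_straighten_left)
    also have "deq 0 ... (Cup 0 a # cols 0 a ps @ [Cap 0])" by (rule deq_fold)
    finally show ?thesis using f_deq0 l by (simp add: closure_def smooth_def)
  qed
  ultimately have "c 2 (closed_cols a (\<not> a) (- 2 * int (Suc k)) ps) = c 2 (closed_cols a (\<not> a) (- 2 * int k) ps) + c 1 (closure a ps)"
    using 1 by (simp only: diff_eq_eq add.commute)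
  with Suc closure_c1[OF assms, of a] show ?case by (simp add: algebra_simps)
qed

end

section \<open>The unknotting number of the pretzel knots\<close>

text \<open>For \<open>p = 2 * k + 1\<close> the triangular number \<open>k * (k + 1) / 2\<close>
  equals an eighth of \<open>p * p - 1\<close>.\<close>

lemma tri_odd_pos: "odd_pos ps \<Longrightarrow> 8 * int (tri ps) = (\<Sum>p\<leftarrow>ps. p\<^sup>2 - 1)"
proof (induction ps)
  case (Cons p ps)
  then obtain k where k: "p = 2 * k + 1" "0 \<le> k" by (auto elim!: oddE)
  have "2 * (\<Sum>j\<le>m. j) = m * (m + 1)" for m :: nat by (induction m) auto
  from arg_cong[OF this[of "nat k"], of int] k have "2 * int (\<Sum>j\<le>nat (p div 2). j) = k * (k + 1)" by (simp add: algebra_simps)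
  then show ?case using Cons k by (simp add: tri_def power2_eq_square algebra_simps)
qed (simp add: tri_def)

lemma delta_unknotting_number_eqI:
  assumes "ddist N D unknot" "\<And>k. ddist k D unknot \<Longrightarrow> N \<le> k"
  shows "delta_unknotting_number D = N"
  unfolding delta_unknotting_number_def delta_gordian_distance_def ddist_def[symmetric]
  using assms by (rule Least_equality)

lemma delta_unknotting_number_pretzel:
  assumes "link_diagram (pretzel n p d)" "n \<ge> 1" "odd_pos (map p [2..<Suc n])"
    and "if even n then p 1 = 2 * int k else p 1 = - 2 * int k"
  defines "S \<equiv> sum_list (map p [2..<Suc n])" and "Q \<equiv> (\<Sum>i\<leftarrow>map p [2..<Suc n]. i\<^sup>2 - 1)"
  shows "8 * int (delta_unknotting_number (pretzel n p d)) = (if even n then 4 * (int k)\<^sup>2 else 0) + 4 * int k * S + Q"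
    and "int (delta_unknotting_number (pretzel n p d)) = a2 (pretzel n p d)"
proof -
  let ?ps = "map p [2..<Suc n]" and ?P = "pretzel n p d"
  have "is_conway_polynomial conway_polynomial"
    unfolding conway_polynomial_def using conway_polynomial_exists by (rule someI[of is_conway_polynomial])
  then interpret conway conway_polynomial by unfold_locales
  have "even (p 1)" using assms(4) by (auto split: if_splits)
  then obtain a b where iso: "isotopic ?P (closed_cols a b (p 1) ?ps)" and ab: "a = (if odd n then \<not> b else b)"
    using pretzel_closed_cols[OF assms(1,2) _ assms(3)] by metis
  have len: "even (length ?ps) \<longleftrightarrow> odd n" using assms(2) by (simp del: upt_Suc)
  have link: "link_diagram (closed_cols a b (p 1) ?ps)" by (rule link_isotopic[OF iso assms(1)])
  \<comment> \<open>One sweep for each pair of crossings in the first column, for even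
    \<open>n\<close> the moves for crossing that column itself, and finally the torus knots.\<close>
  define N where "N = (if even n then k * cost_down ?ps + (\<Sum>j<k. j) + tri ?ps else k * cost_down ?ps + tri ?ps)"
  have tri: "8 * int (tri ?ps) = Q" unfolding Q_def by (rule tri_odd_pos[OF assms(3)])
  have cost: "2 * int (cost_down ?ps) = S + (if odd n then 0 else 1)"
    using costs[OF assms(3)] len by (simp add: S_def del: upt_Suc)
  have sum: "2 * int (\<Sum>j<k. j) = int k * int k - int k" by (induction k) (auto simp: algebra_simps)
  have N: "8 * int N = (if even n then 4 * (int k)\<^sup>2 else 0) + 4 * int k * S + Q"
  proof -
    have "8 * int N = 4 * int k * (2 * int (cost_down ?ps)) + (if even n then 4 * (2 * int (\<Sum>j<k. j)) else 0) + 8 * int (tri ?ps)"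
      by (simp add: N_def del: upt_Suc of_nat_sum)
    also have "... = (if even n then 4 * (int k)\<^sup>2 else 0) + 4 * int k * S + Q"
      unfolding cost sum tri by (simp add: algebra_simps power2_eq_square)
    finally show ?thesis .
  qed
  have "deq N (closed_cols a b (p 1) ?ps) unknot"
  proof (cases "even n")
    case True
    then show ?thesis using closed_odd_unknot[OF assms(3), of k a b] len assms(4) by (simp add: N_def del: upt_Suc)
  next
    case False
    then show ?thesis using closed_even_unknot[OF assms(3), of k a b] len assms(4) by (simp add: N_def del: upt_Suc)
  qed
  then have "ddist N (closed_cols a b (p 1) ?ps) unknot"
    using link unfolding deq_def by (metis append_Nil append_Nil2)
  with iso have up: "ddist N ?P unknot" by (rule ddist_isotopic)
  have "8 * c 2 (closed_cols a b (p 1) ?ps) = 8 * int N"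
  proof (cases "even n")
    case True
    then have "2 * c 2 (closed_cols a b (p 1) ?ps) = 2 * int (tri ?ps) + (\<Sum>j<k. 2 * int j + 1 + S)"
      using closed_cols_odd_c2[OF assms(3), of b k] len assms(4) ab by (simp add: S_def del: upt_Suc)
    moreover have "(\<Sum>j<k. 2 * int j + 1 + S) = int k * int k + int k * S" by (induction k) (auto simp: algebra_simps)
    ultimately show ?thesis using N tri True by (simp add: power2_eq_square algebra_simps)
  next
    case False
    then have "2 * c 2 (closed_cols a b (p 1) ?ps) = 2 * int (tri ?ps) + int k * S"
      using closed_cols_even_c2[OF assms(3), of a k] len assms(4) ab by (simp add: S_def del: upt_Suc)
    then show ?thesis using N tri False by (simp add: algebra_simps)
  qed
  then have c2: "c 2 ?P = int N" using f_isotopic[OF assms(1) link iso] by simp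
  have "delta_unknotting_number ?P = N"
  proof (rule delta_unknotting_number_eqI[OF up])
    fix j assume "ddist j ?P unknot"
    from c2_lower_bound[OF this assms(1)] show "N \<le> j" using c2 by simp
  qed
  then show "8 * int (delta_unknotting_number ?P) = (if even n then 4 * (int k)\<^sup>2 else 0) + 4 * int k * S + Q"
    and "int (delta_unknotting_number ?P) = a2 ?P"
    using N c2 by (simp_all add: a2_def)
qed

theorem theorem1p2:
  fixes n :: nat and p :: "nat \<Rightarrow> int" and d :: "nat \<Rightarrow> bool"
  assumes "n \<ge> 1"
    and "even (p 1)"
    and "\<And>i. i \<in> {2..n} \<Longrightarrow> odd (p i) \<and> p i > 0"
    and "link_diagram (pretzel n p d)"
  shows "(even n \<and> p 1 > 0 \<longrightarrow>
      real (delta_unknotting_number (pretzel n p d)) =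
        1/8 * (\<Sum>i=1..n. (real_of_int (p i))\<^sup>2) + 1/4 * p 1 * (\<Sum>i=2..n. real_of_int (p i))
          - 1/8 * (real n - 1) \<and>
      int (delta_unknotting_number (pretzel n p d)) = a2 (pretzel n p d)) \<and>
    (odd n \<and> p 1 < 0 \<longrightarrow>
      real (delta_unknotting_number (pretzel n p d)) =
        1/8 * (\<Sum>i=2..n. (real_of_int (p i))\<^sup>2) - 1/4 * p 1 * (\<Sum>i=2..n. real_of_int (p i))
          - 1/8 * (real n - 1) \<and>
      int (delta_unknotting_number (pretzel n p d)) = a2 (pretzel n p d))"
proof -
  let ?u = "delta_unknotting_number (pretzel n p d)"
  define S where "S = (\<Sum>i=2..n. p i)"
  define Q where "Q = (\<Sum>i=2..n. (p i)\<^sup>2)"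
  have set: "{2..n} = set [2..<Suc n]" by auto
  have odd_pos: "odd_pos (map p [2..<Suc n])"
    unfolding odd_pos_def using assms(3) by (auto simp del: upt_Suc)
  have S: "sum_list (map p [2..<Suc n]) = S"
    unfolding S_def set by (rule sum_set_upt_conv_sum_list_nat[symmetric])
  have Q: "(\<Sum>i\<leftarrow>map p [2..<Suc n]. i\<^sup>2 - 1) = Q - (int n - 1)"
  proof -
    have "(\<Sum>i\<leftarrow>map p [2..<Suc n]. i\<^sup>2 - 1) = (\<Sum>i=2..n. (p i)\<^sup>2 - 1)"
      unfolding set by (simp add: comp_def sum_set_upt_conv_sum_list_nat del: upt_Suc set_upt)
    also have "... = Q - (int n - 1)" using assms(1) by (simp add: Q_def sum_subtractf of_nat_diff)
    finally show ?thesis .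
  qed
  have eight: "8 * int ?u = (if even n then 4 * (int k)\<^sup>2 else 0) + 4 * int k * S + (Q - (int n - 1)) \<and>
     int ?u = a2 (pretzel n p d)" if "if even n then p 1 = 2 * int k else p 1 = - 2 * int k" for k
    using delta_unknotting_number_pretzel[OF assms(4,1) odd_pos that] unfolding S Q by blast
  have RS: "(\<Sum>i=2..n. real_of_int (p i)) = real_of_int S" and RQ: "(\<Sum>i=2..n. (real_of_int (p i))\<^sup>2) = real_of_int Q"
    by (simp_all add: S_def Q_def)
  have R1: "(\<Sum>i=1..n. (real_of_int (p i))\<^sup>2) = (real_of_int (p 1))\<^sup>2 + real_of_int Q"
    using assms(1) RQ by (simp add: sum.atLeast_Suc_atMost numeral_2_eq_2)
  show ?thesis
  proof (intro conjI impI; elim conjE)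
    assume n: "even n" "p 1 > 0"
    define k where "k = nat (p 1 div 2)"
    have k: "p 1 = 2 * int k" using assms(2) n by (auto simp: k_def)
    have e: "8 * int ?u = 4 * (int k)\<^sup>2 + 4 * int k * S + (Q - (int n - 1))" and a: "int ?u = a2 (pretzel n p d)"
      using eight[of k] k n by auto
    from arg_cong[OF e, of real_of_int]
    show "real ?u = 1/8 * (\<Sum>i=1..n. (real_of_int (p i))\<^sup>2) + 1/4 * p 1 * (\<Sum>i=2..n. real_of_int (p i)) - 1/8 * (real n - 1)"
      unfolding RS R1 k by (simp add: power2_eq_square field_simps)
    show "int ?u = a2 (pretzel n p d)" by (rule a)
  next
    assume n: "odd n" "p 1 < 0"
    define k where "k = nat (- p 1 div 2)"
    have k: "p 1 = - 2 * int k" using assms(2) n by (auto simp: k_def)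
    have e: "8 * int ?u = 4 * int k * S + (Q - (int n - 1))" and a: "int ?u = a2 (pretzel n p d)"
      using eight[of k] k n by auto
    from arg_cong[OF e, of real_of_int]
    show "real ?u = 1/8 * (\<Sum>i=2..n. (real_of_int (p i))\<^sup>2) - 1/4 * p 1 * (\<Sum>i=2..n. real_of_int (p i)) - 1/8 * (real n - 1)"
      unfolding RS RQ k by (simp add: field_simps)
    show "int ?u = a2 (pretzel n p d)" by (rule a)
  qed
qed

end
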